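(* Let $0<p\leq q<\infty$, let $\omega\in\hat{\mathcal D}$, and let $\mu$ be a positive Borel measure on $\mathbb{B}$. Then the following statements hold. (i) $\mu$ is a $q$-Carleson measure for $A_\omega^p$ if and only if $$\sup_{a\in\mathbb{B}}\frac{\mu(S_a)}{(\omega(S_a))^{q/p}}<\infty .$$ Moreover, if $\mu$ is a $q$-Carleson measure for $A_\omega^p$, then the identity operator $Id:A_\omega^p\to L_\mu^q$ satisfies $$\|Id\|_{A_\omega^p\to L_\mu^q}^q\approx \sup_{a\in\mathbb{B}}\frac{\mu(S_a)}{(\omega(S_a))^{q/p}} .$$ (ii) $\mu$ is a vanishing $q$-Carleson measure for $A_\omega^p$ if and only if $$\lim_{|a|\to1}\frac{\mu(S_a)}{(\omega(S_a))^{q/p}}=0 .$$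
   Context: $\mathbb{B}$ is the open unit ball of $\mathbb{C}^n$, $dV$ the normalized volume measure on $\mathbb{B}$, $H(\mathbb{B})$ the space of holomorphic functions on $\mathbb{B}$, and $\langle z,w\rangle=\sum_j z_j\overline{w_j}$. A radial weight is a positive integrable function $\omega$ on $\mathbb{B}$ with $\omega(z)=\omega(|z|)$; put $\hat\omega(r)=\int_r^1\omega(t)\,dt$. Then $\omega\in\hat{\mathcal D}$ (doubling weight) means that $\omega$ is a radial weight and there is $C>0$ with $\hat\omega(r)<C\,\hat\omega(\frac{1+r}{2})$ for all $0\le r<1$. For measurable $E\subset\mathbb{B}$, $\omega(E)=\int_E\omega\,dV$. $A_\omega^p$ is the space of all $f\in H(\mathbb{B})$ with $\|f\|_{A_\omega^p}^p=\int_{\mathbb{B}}|f|^p\omega\,dV<\infty$. $L_\mu^q$ is the space of measurable functions on $\mathbb{B}$ with $\|f\|_{L_\mu^q}=(\int_{\mathbb{B}}|f|^q\,d\mu)^{1/q}<\infty$. Carleson blocks: for $a\in\mathbb{B}\setminus\{0\}$, $S_a=\{z\in\mathbb{B}: |a|<|z|<1,\ |1-\langle \frac{a}{|a|},\frac{z}{|z|}\rangle|\le 1-|a|\}$; for $a=0$, $S_0=\mathbb{B}$. $\mu$ is a $q$-Carleson measure for $A_\omega^p$ if the identity operator $Id:A_\omega^p\to L_\mu^q$ is bounded; it is a vanishing $q$-Carleson measure for $A_\omega^p$ if $Id:A_\omega^p\to L_\mu^q$ is compact. $A\approx B$ means $C^{-1}A\le B\le CA$ with a positive constant $C$ (here independent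 of $\mu$).
   Formalization: In (ii) the measure μ is also assumed finite on compact subsets of the ball; without this (ii) fails, e.g. for μ = ∞·δ_0, where the limit is 0 but the constant function 1 in A_ω^p is not in L_μ^q. *)

theory Defs
  imports "HOL-Analysis.Analysis"
begin

definition hinner :: "complex ^ 'n::finite \<Rightarrow> complex ^ 'n \<Rightarrow> complex" where
  "hinner z w = (\<Sum>j\<in>UNIV. z $ j * cnj (w $ j))"

(* The space of this measure is the open unit ball itself, so measurability and integrability
   never refer to values outside the ball. *)
definition ball_volume :: "(complex ^ 'n::finite) measure" where
  "ball_volume = uniform_measure (lebesgue_on (ball 0 1)) (ball 0 1)"

(* Holomorphy in several variables: the real Frechet derivative exists and is complex linear. *)
definition holomorphic_on_ball :: "(complex ^ 'n::finite \<Rightarrow> complex) \<Rightarrow> bool" where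
  "holomorphic_on_ball f \<longleftrightarrow>
     (\<forall>z\<in>ball 0 1. \<exists>f'. (f has_derivative f') (at z) \<and> (\<forall>c v. f' (c *s v) = c * f' v))"

(* A radial weight is represented by its profile on [0,1); the weight itself is
   z |-> w (norm z).  The type argument carries the dimension n. *)
definition radial_weight :: "'n::finite itself \<Rightarrow> (real \<Rightarrow> real) \<Rightarrow> bool" where
  "radial_weight _ \<omega> \<longleftrightarrow>
     (\<forall>z\<in>ball (0 :: complex ^ 'n) 1. 0 < \<omega> (norm z)) \<and>
     integrable (ball_volume :: (complex ^ 'n) measure) (\<lambda>z. \<omega> (norm z))"

(* Integrability of the weight over the ball does not exclude a tail integral that is infinite
   at r = 0, hence the values in the extended reals. *)
definition weight_tail :: "(real \<Rightarrow> real) \<Rightarrow> real \<Rightarrow> ennreal" where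
  "weight_tail \<omega> r = (\<integral>\<^sup>+t\<in>{r<..<1}. ennreal (\<omega> t) \<partial>lebesgue)"

definition doubling_weight :: "'n::finite itself \<Rightarrow> (real \<Rightarrow> real) \<Rightarrow> bool" where
  "doubling_weight n \<omega> \<longleftrightarrow>
     radial_weight n \<omega> \<and>
     (\<exists>C>0. \<forall>r. 0 \<le> r \<and> r < 1 \<longrightarrow> weight_tail \<omega> r < ennreal C * weight_tail \<omega> ((1 + r) / 2))"

definition weight_of :: "(real \<Rightarrow> real) \<Rightarrow> (complex ^ 'n::finite) set \<Rightarrow> real" where
  "weight_of \<omega> E = (LINT z:E|ball_volume. \<omega> (norm z))"

definition bergman :: "real \<Rightarrow> (real \<Rightarrow> real) \<Rightarrow> (complex ^ 'n::finite \<Rightarrow> complex) set" where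
  "bergman p \<omega> = {f. holomorphic_on_ball f \<and>
     integrable ball_volume (\<lambda>z. norm (f z) powr p * \<omega> (norm z))}"

definition bergman_norm :: "real \<Rightarrow> (real \<Rightarrow> real) \<Rightarrow> (complex ^ 'n::finite \<Rightarrow> complex) \<Rightarrow> real" where
  "bergman_norm p \<omega> f = (LINT z|ball_volume. norm (f z) powr p * \<omega> (norm z)) powr (1 / p)"

definition Lq :: "real \<Rightarrow> 'a measure \<Rightarrow> ('a \<Rightarrow> complex) set" where
  "Lq q \<mu> = {f \<in> borel_measurable \<mu>. integrable \<mu> (\<lambda>z. norm (f z) powr q)}"

definition Lq_norm :: "real \<Rightarrow> 'a measure \<Rightarrow> ('a \<Rightarrow> complex) \<Rightarrow> real" where
  "Lq_norm q \<mu> f = (LINT z|\<mu>. norm (f z) powr q) powr (1 / q)"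

definition carleson_block :: "complex ^ 'n::finite \<Rightarrow> (complex ^ 'n) set" where
  "carleson_block a =
     (if a = 0 then ball 0 1
      else {z. norm a < norm z \<and> norm z < 1 \<and>
               cmod (1 - hinner (a /\<^sub>R norm a) (z /\<^sub>R norm z)) \<le> 1 - norm a})"

definition borel_measure_on_ball :: "(complex ^ 'n::finite) measure \<Rightarrow> bool" where
  "borel_measure_on_ball \<mu> \<longleftrightarrow> sets \<mu> = sets (restrict_space borel (ball 0 1))"

definition finite_on_compacts :: "(complex ^ 'n::finite) measure \<Rightarrow> bool" where
  "finite_on_compacts \<mu> \<longleftrightarrow> (\<forall>K. compact K \<and> K \<subseteq> ball 0 1 \<longrightarrow> emeasure \<mu> K < \<infinity>)"

definition carleson_measure ::
  "real \<Rightarrow> real \<Rightarrow> (real \<Rightarrow> real) \<Rightarrow> (complex ^ 'n::finite) measure \<Rightarrow> bool" where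
  "carleson_measure p q \<omega> \<mu> \<longleftrightarrow>
     bergman p \<omega> \<subseteq> Lq q \<mu> \<and>
     (\<exists>C. \<forall>f\<in>bergman p \<omega>. Lq_norm q \<mu> f \<le> C * bergman_norm p \<omega> f)"

(* The operator (quasi-)norm of the identity; meaningful when the identity is bounded. *)
definition Id_norm ::
  "real \<Rightarrow> real \<Rightarrow> (real \<Rightarrow> real) \<Rightarrow> (complex ^ 'n::finite) measure \<Rightarrow> real" where
  "Id_norm p q \<omega> \<mu> = (SUP f\<in>{f \<in> bergman p \<omega>. bergman_norm p \<omega> f \<le> 1}. Lq_norm q \<mu> f)"

(* Compactness of the identity: every bounded sequence has a subsequence converging in L^q. *)
definition vanishing_carleson_measure ::
  "real \<Rightarrow> real \<Rightarrow> (real \<Rightarrow> real) \<Rightarrow> (complex ^ 'n::finite) measure \<Rightarrow> bool" where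
  "vanishing_carleson_measure p q \<omega> \<mu> \<longleftrightarrow>
     bergman p \<omega> \<subseteq> Lq q \<mu> \<and>
     (\<forall>f :: nat \<Rightarrow> complex ^ 'n \<Rightarrow> complex.
        (\<forall>k. f k \<in> bergman p \<omega>) \<and> (\<exists>M. \<forall>k. bergman_norm p \<omega> (f k) \<le> M) \<longrightarrow>
        (\<exists>g\<in>Lq q \<mu>. \<exists>r :: nat \<Rightarrow> nat. strict_mono r \<and>
           (\<lambda>k. Lq_norm q \<mu> (\<lambda>z. f (r k) z - g z)) \<longlonglongrightarrow> 0))"

definition carleson_ratio ::
  "real \<Rightarrow> real \<Rightarrow> (real \<Rightarrow> real) \<Rightarrow> (complex ^ 'n::finite) measure \<Rightarrow> complex ^ 'n \<Rightarrow> ennreal" where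
  "carleson_ratio p q \<omega> \<mu> a =
     emeasure \<mu> (carleson_block a) / ennreal (weight_of \<omega> (carleson_block a) powr (q / p))"

end

(*
Write Q(e,d) for the tent of all w in the ball with |1 - <w,e>| < d; Carleson blocks and tents are
comparable, and m denotes the measure with density omega.

The condition on omega says that its radial tail is doubling. In polar coordinates this makes m
doubling on tents, because the measure of a spherical cap is comparable to that of an ellipsoid, an
image of the ball under a nonisotropic dilation.  The sub-mean value property of |F|^s over such an
ellipsoid, together with the monotonicity of spherical means, bounds |F(z)|^s by the m-average of
|F|^s over the whole ball divided by m(Q_z), where Q_z is the tent at z.  Applied to F times a high
power of the kernel peaking at z, this bounds |F|^s by a maximal function over tents.  A Vitali
covering argument gives a weak type estimate for that maximal function with respect to mu, and
summation over dyadic levels with s = p/2 gives the embedding.  Necessity follows by testing on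
powers of the kernel.

For vanishing measures the embedding is applied to the restriction of mu to a thin collar
1 - h < |z| < 1, whose Carleson constant is small; on the remaining compact set locally uniform
convergence suffices.  Conversely, normalised kernels tend to 0 pointwise, so by Fatou's lemma every
limit in L^q(mu) of a subsequence vanishes.
*)
theory Submission
  imports Defs "HOL-Complex_Analysis.Complex_Analysis" "HOL-Probability.Probability_Measure"
begin

section \<open>Subharmonicity on the disc\<close>

text \<open>The doubling condition bounds tails of omega and says nothing about omega at a given
  radius, so a mean over an ellipsoid at depth d cannot be compared directly with an integral
  against omega there. Monotone spherical means push the ellipsoid mean out to every sphere of
  radius r \<ge> 1 - d/2; integrating over these radii brings in the tail, which carries a fixed
  share of the mass of the tent. The price is an integral over the whole ball. The high kernel power
  restores locality, because its decay beats the growth of m under doubling of tents.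

  The choice s = p/2 comes from maximal function theory: averages of |f|^s satisfy a weak estimate,
  and summation over levels needs p/s = 2 > 1. As p may be below 1, subharmonicity of |f|^s for
  every s > 0 takes the place of duality. Constants depend on the weight, the dimension and the
  exponents and are fixed before mu, which gives the norm equivalence and lets the embedding be
  applied to restrictions of mu.\<close>

lemma Re_mult_cnj_poly_on_circle:
  "\<exists>r. \<forall>z\<in>sphere 0 1. Re (poly p z * cnj (poly q z)) = Re (poly r z)"
proof (induction q arbitrary: p)
  case 0
  show ?case by (rule exI[of _ 0]) simp
next
  case (pCons a q)
  obtain b p' where p: "p = pCons b p'" by (cases p)
  from pCons.IH[of p'] obtain r where r: "\<forall>z\<in>sphere 0 1. Re (poly p' z * cnj (poly q z)) = Re (poly r z)" by blast
  show ?case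
  \<comment> \<open>Split off the constant coefficients \<open>b\<close> of \<open>p\<close> and
    \<open>a\<close> of the second factor. On the circle \<open>z * cnj z = 1\<close>, so the
    product of the two tails is covered by the induction hypothesis; the mixed term
    \<open>b * cnj z * cnj (poly q z)\<close> is the conjugate of a polynomial and has the same real
    part as that polynomial.\<close>
  proof (rule exI[of _ "smult (cnj a) p + pCons 0 (smult (cnj b) q) + r"], safe)
    fix z :: complex assume z: "z \<in> sphere 0 1"
    then have zz: "z * cnj z = 1" by (simp add: complex_norm_square[symmetric])
    have "poly p z * cnj (poly (pCons a q) z)
        = cnj a * poly p z + b * cnj z * cnj (poly q z) + (z * cnj z) * (poly p' z * cnj (poly q z))"
      by (simp add: p algebra_simps)
    also have "\<dots> = cnj a * poly p z + cnj (cnj b * z * poly q z) + poly p' z * cnj (poly q z)"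
      by (simp add: zz)
    finally have *: "Re (poly p z * cnj (poly (pCons a q) z))
        = Re (cnj a * poly p z) + Re (cnj b * z * poly q z) + Re (poly p' z * cnj (poly q z))"
      by (simp only: plus_complex.sel cnj.sel)
    show "Re (poly p z * cnj (poly (pCons a q) z))
      = Re (poly (smult (cnj a) p + pCons 0 (smult (cnj b) q) + r) z)"
      unfolding * using r z by (simp add: algebra_simps)
  qed
qed

text \<open>Stone-Weierstrass for real parts of polynomials. Closure under products is the point:
  \<open>Re u * Re v\<close> is half of \<open>Re (u * v) + Re (u * cnj v)\<close>, and on the
  circle the second term is again the real part of a polynomial.\<close>

lemma approx_by_Re_poly_on_circle:
  fixes f :: "complex \<Rightarrow> real"
  assumes "continuous_on (sphere 0 1) f" "0 < e"
  shows "\<exists>p. \<forall>z\<in>sphere 0 1. \<bar>f z - Re (poly p z)\<bar> < e"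
proof -
  let ?P = "\<lambda>g::complex\<Rightarrow>real. \<exists>p. \<forall>z\<in>sphere 0 1. g z = Re (poly p z)"
  have "\<exists>g. ?P g \<and> (\<forall>x\<in>sphere 0 1. \<bar>f x - g x\<bar> < e)"
  proof (rule Stone_Weierstrass_HOL)
    show "compact (sphere 0 (1::real) :: complex set)" by simp
    show "?P (\<lambda>_. c)" for c by (rule exI[of _ "[:of_real c:]"]) simp
    show "continuous_on (sphere 0 1) g" if g: "?P g" for g
    proof -
      from g obtain p where p: "\<forall>z\<in>sphere 0 1. g z = Re (poly p z)" by blast
      have "continuous_on (sphere 0 1) (\<lambda>z. Re (poly p z))"
        by (intro continuous_intros)
      then show ?thesis using p by (subst continuous_on_cong[OF refl]) auto
    qed
    show "?P (\<lambda>x. f x + g x)" if "?P f \<and> ?P g" for f g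
    proof -
      from that obtain p q where pq: "\<forall>z\<in>sphere 0 1. f z = Re (poly p z)" "\<forall>z\<in>sphere 0 1. g z = Re (poly q z)" by blast
      show ?thesis by (rule exI[of _ "p + q"]) (use pq in simp)
    qed
    show "?P (\<lambda>x. f x * g x)" if fg: "?P f \<and> ?P g" for f g
    proof -
      from fg obtain p q where pq: "\<forall>z\<in>sphere 0 1. f z = Re (poly p z)" "\<forall>z\<in>sphere 0 1. g z = Re (poly q z)" by blast
      obtain r where r: "\<forall>z\<in>sphere 0 1. Re (poly p z * cnj (poly q z)) = Re (poly r z)"
        using Re_mult_cnj_poly_on_circle by blast
      have *: "Re u * Re v = (Re (u * v) + Re (u * cnj v)) / 2" for u v :: complex
        by (simp add: algebra_simps)
      show ?thesis
      proof (rule exI[of _ "smult (1/2) (p * q + r)"], safe)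
        fix z :: complex assume z: "z \<in> sphere 0 1"
        have "f z * g z = (Re (poly p z * poly q z) + Re (poly r z)) / 2"
          using pq r z * by metis
        then show "f z * g z = Re (poly (smult (1/2) (p * q + r)) z)" by simp
      qed
    qed
    show "\<exists>f. ?P f \<and> f x \<noteq> f y" if xy: "x \<in> sphere 0 1 \<and> y \<in> sphere 0 1 \<and> x \<noteq> y" for x y
    proof (cases "Re x = Re y")
      case True
      then have "Im x \<noteq> Im y" using xy complex_eqI by blast
      moreover have "?P Im" by (rule exI[of _ "[:0, -\<i>:]"]) simp
      ultimately show ?thesis by blast
    next
      case False
      moreover have "?P Re" by (rule exI[of _ "[:0, 1:]"]) simp
      ultimately show ?thesis by blast
    qed
  qed (use assms in auto)
  then show ?thesis by (metis)
qed

text \<open>The Poisson kernel at the real point t, with the angle measured as a fraction of a full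
  turn; this is the parameter of \<open>circlepath\<close>, and the total mass over [0,1] is
  1.\<close>

definition poisson_kernel :: "real \<Rightarrow> real \<Rightarrow> real" where
  "poisson_kernel t x = (1 - t\<^sup>2) / (cmod (1 - t * cis (2 * pi * x)))\<^sup>2"

lemma one_minus_cis_nz:
  assumes "0 \<le> t" "t < 1"
  shows "1 - complex_of_real t * cis x \<noteq> 0"
proof
  assume "1 - complex_of_real t * cis x = 0"
  then have "cmod (complex_of_real t * cis x) = 1" by simp
  then show False using assms by (simp add: norm_mult)
qed

lemma poisson_kernel_nonneg: "0 \<le> t \<Longrightarrow> t < 1 \<Longrightarrow> 0 \<le> poisson_kernel t x"
  by (simp add: poisson_kernel_def abs_square_le_1)

lemma continuous_on_poisson_kernel [continuous_intros]:
  assumes "0 \<le> t" "t < 1"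
  shows "continuous_on A (poisson_kernel t)"
proof -
  have "continuous_on A (\<lambda>x. (1 - t\<^sup>2) / (cmod (1 - t * cis (2 * pi * x)))\<^sup>2)"
    using one_minus_cis_nz[OF assms] by (intro continuous_intros) auto
  then show ?thesis unfolding poisson_kernel_def[abs_def] .
qed

text \<open>Cauchy's formula for \<open>k z / (1 - t z)\<close> turns into Poisson's formula for \<open>k\<close>.\<close>

lemma poisson_formula_holomorphic:
  fixes k :: "complex \<Rightarrow> complex" and t :: real
  assumes "k holomorphic_on ball 0 R" "1 < R" "0 \<le> t" "t < 1"
  shows "((\<lambda>x. poisson_kernel t x * k (cis (2 * pi * x))) has_integral k t) {0..1}"
proof -
  let ?K = "\<lambda>z::complex. k z / (1 - of_real t * z)"
  \<comment> \<open>A disc larger than the closed unit disc that avoids the pole 1/t. For t = 0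
    there is no pole, and the convention \<open>1 / 0 = 0\<close> forces the case
    distinction.\<close>
  define r where "r = (if t = 0 then R else min R (1 / t))"
  have r: "1 < r" "r \<le> R" using assms by (auto simp: r_def field_simps)
  have nz: "1 - complex_of_real t * z \<noteq> 0" if "z \<in> ball 0 r" for z
  proof
    assume "1 - complex_of_real t * z = 0"
    then have 1: "cmod (complex_of_real t * z) = 1" by simp
    then have "t \<noteq> 0" by auto
    then have "norm z < 1 / t" using that assms by (auto simp: r_def)
    then show False using 1 assms \<open>t \<noteq> 0\<close> by (simp add: norm_mult field_simps)
  qed
  have hol: "?K holomorphic_on ball 0 r"
    using assms(1) r nz by (intro holomorphic_intros) (auto elim: holomorphic_on_subset)
  have "((\<lambda>u. ?K u / (u - t)) has_contour_integral (2 * of_real pi * \<i> * ?K t)) (circlepath 0 1)"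
    using r assms by (intro Cauchy_integral_circlepath_simple holomorphic_on_subset[OF hol]) auto
  then have "((\<lambda>x. ?K (circlepath 0 1 x) / (circlepath 0 1 x - t) *
      vector_derivative (circlepath 0 1) (at x within {0..1})) has_integral (2 * of_real pi * \<i> * ?K t)) {0..1}"
    by (simp add: has_contour_integral_def)
  moreover have circ: "circlepath 0 1 x = cis (2 * pi * x)" "exp (2 * of_real pi * \<i> * of_real x) = cis (2 * pi * x)" for x
    by (simp_all add: circlepath cis_conv_exp mult_ac)
  ultimately have "((\<lambda>x. ?K (cis (2 * pi * x)) / (cis (2 * pi * x) - t) *
      (2 * of_real pi * \<i> * cis (2 * pi * x))) has_integral (2 * of_real pi * \<i> * ?K t)) {0..1}"
    by (elim has_integral_eq[rotated])
      (simp only: vector_derivative_circlepath01 circ mult_ac atLeastAtMost_iff mult_1_left of_real_1 of_real_mult of_real_numeral)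
  then have *: "((\<lambda>x. (1 - t\<^sup>2) / (2 * of_real pi * \<i>) * (?K (cis (2 * pi * x)) / (cis (2 * pi * x) - t) *
      (2 * of_real pi * \<i> * cis (2 * pi * x)))) has_integral ((1 - t\<^sup>2) / (2 * of_real pi * \<i>) * (2 * of_real pi * \<i> * ?K t))) {0..1}"
    by (rule has_integral_mult_right)
  have t2: "1 - (complex_of_real t)\<^sup>2 \<noteq> 0"
    using assms by (metis abs_square_less_1 abs_of_nonneg eq_iff_diff_eq_0 of_real_1 of_real_eq_iff of_real_power order_less_irrefl)
  have kt: "(1 - t\<^sup>2) / (2 * of_real pi * \<i>) * (2 * of_real pi * \<i> * ?K t) = k t"
    using t2 by (simp add: power2_eq_square field_simps)
  have "(1 - t\<^sup>2) / (2 * of_real pi * \<i>) * (?K (cis y) / (cis y - t) * (2 * of_real pi * \<i> * cis y))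
       = ((1 - t\<^sup>2) / (cmod (1 - t * cis y))\<^sup>2) * k (cis y)" for y
  proof -
    have c: "cis y * cnj (cis y) = 1" by (metis complex_norm_square norm_cis of_real_1 one_power2)
    have 1: "cis y - t = cis y * cnj (1 - t * cis y)"
      using c by (simp add: algebra_simps)
    have 2: "of_real ((cmod (1 - t * cis y))\<^sup>2) = (1 - t * cis y) * cnj (1 - t * cis y)"
      using complex_norm_square by blast
    have 3: "1 - t * cis y \<noteq> 0" "cis y \<noteq> 0" using one_minus_cis_nz assms by auto
    have 4: "cnj (1 - t * cis y) \<noteq> 0" using 3 by (metis complex_cnj_zero_iff)
    show ?thesis unfolding 1 of_real_divide 2 using 3 4
      by (simp add: divide_simps del: complex_cnj_diff complex_cnj_mult) (simp add: algebra_simps)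
  qed
  then have eq: "(1 - t\<^sup>2) / (2 * of_real pi * \<i>) * (?K (cis (2*pi*x)) / (cis (2*pi*x) - t) * (2 * of_real pi * \<i> * cis (2*pi*x)))
       = poisson_kernel t x * k (cis (2*pi*x))" for x
    unfolding poisson_kernel_def by simp
  show ?thesis using * unfolding kt eq .
qed

lemma has_integral_poisson_kernel:
  assumes "0 \<le> t" "t < 1"
  shows "(poisson_kernel t has_integral 1) {0..1}"
proof -
  have "((\<lambda>x. complex_of_real (poisson_kernel t x)) has_integral 1) {0..1}"
    using poisson_formula_holomorphic[of "\<lambda>_. 1" 2 t] assms by simp
  from has_integral_linear[OF this bounded_linear_Re] show ?thesis by (simp add: o_def)
qed

text \<open>On the circle \<open>ln (\<bar>h\<bar> + e)\<close> is approximated by the real part of a polynomial \<open>q\<close>. By the maximum principle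
  \<open>\<bar>h\<bar> \<le> exp (Re q)\<close> in the disc, and Poisson's formula applies to \<open>exp (s q)\<close>; zeros of \<open>h\<close> need no attention.\<close>

lemma powr_cmod_le_poisson_integral:
  assumes h: "h holomorphic_on ball 0 R" "1 < R" and t: "0 \<le> t" "t < 1" and s: "0 < s"
  shows "cmod (h t) powr s \<le> integral {0..1} (\<lambda>x. poisson_kernel t x * cmod (h (cis (2 * pi * x))) powr s)"
proof -
  have cont: "continuous_on (cball 0 1) h"
    using h by (intro holomorphic_on_imp_continuous_on holomorphic_on_subset[OF h(1)]) auto
  then have conts: "continuous_on (sphere 0 1) h" by (rule continuous_on_subset) auto
  have contc: "continuous_on A (\<lambda>x::real. h (cis (2 * pi * x)))" for A
    by (rule continuous_on_compose2[OF conts]) (auto intro!: continuous_intros)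
  have key: "cmod (h t) powr s \<le> integral {0..1} (\<lambda>x. poisson_kernel t x * ((cmod (h (cis (2 * pi * x))) + e) powr s * exp (2 * s * e)))"
    if e: "e > 0" for e
  proof -
    have "continuous_on (sphere 0 1) (\<lambda>z. ln (cmod (h z) + e))"
      using e by (intro continuous_intros conts) (auto simp: add_nonneg_eq_0_iff)
    from approx_by_Re_poly_on_circle[OF this e] obtain p
      where p: "\<forall>z\<in>sphere 0 1. \<bar>ln (cmod (h z) + e) - Re (poly p z)\<bar> < e" by blast
    \<comment> \<open>Raising the approximant by e puts Re q above ln (|h| + e) on the circle, and
      at most 2 e above it. The e inside the logarithm keeps it finite at zeros of h.\<close>
    define q where "q = p + [:of_real e:]"
    have q1: "ln (cmod (h z) + e) \<le> Re (poly q z)" and q2: "Re (poly q z) \<le> ln (cmod (h z) + e) + 2 * e"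
      if "z \<in> sphere 0 1" for z
      using p that by (auto simp: q_def abs_less_iff dest!: bspec)
    have pos: "0 < cmod (h z) + e" for z using e by (simp add: add_nonneg_pos)
    have le1: "cmod (h t * exp (- poly q t)) \<le> 1"
    proof (rule maximum_modulus_frontier[of "\<lambda>z. h z * exp (- poly q z)" "cball 0 1"])
      show "(\<lambda>z. h z * exp (- poly q z)) holomorphic_on interior (cball 0 1)"
        using h by (intro holomorphic_intros holomorphic_on_subset[OF h(1)]) auto
      show "continuous_on (closure (cball 0 1)) (\<lambda>z. h z * exp (- poly q z))"
        using cont by (intro continuous_intros) auto
      show "cmod (h z * exp (- poly q z)) \<le> 1" if "z \<in> frontier (cball 0 1)" for z
      proof -
        have z: "z \<in> sphere 0 1" using that by simp
        have "cmod (h z) \<le> exp (ln (cmod (h z) + e))" using pos[of z] e by simp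
        also have "\<dots> \<le> exp (Re (poly q z))" using q1[OF z] by simp
        finally show ?thesis by (simp add: norm_mult norm_divide exp_minus divide_simps)
      qed
    qed (use t in auto)
    define k where "k = (\<lambda>z. exp (of_real s * poly q z))"
    have "cmod (h t) \<le> exp (Re (poly q t))"
      using le1 by (simp add: norm_mult norm_divide exp_minus divide_simps)
    then have "cmod (h t) powr s \<le> exp (Re (poly q t)) powr s"
      using s by (intro powr_mono2) auto
    also have "\<dots> = cmod (k t)" by (simp add: k_def powr_def)
    also have "\<dots> \<le> integral {0..1} (\<lambda>x. poisson_kernel t x * ((cmod (h (cis (2 * pi * x))) + e) powr s * exp (2 * s * e)))"
    proof -
      have I: "((\<lambda>x. poisson_kernel t x * k (cis (2 * pi * x))) has_integral k t) {0..1}"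
        by (rule poisson_formula_holomorphic[of _ 2]) (auto simp: k_def intro!: holomorphic_intros t)
      have "cmod (integral {0..1} (\<lambda>x. poisson_kernel t x * k (cis (2 * pi * x))))
        \<le> integral {0..1} (\<lambda>x. poisson_kernel t x * ((cmod (h (cis (2 * pi * x))) + e) powr s * exp (2 * s * e)))"
      proof (rule integral_norm_bound_integral)
        show "(\<lambda>x. of_real (poisson_kernel t x) * k (cis (2 * pi * x))) integrable_on {0..1}" using I by blast
        have "continuous_on {0..1} (\<lambda>x. poisson_kernel t x * ((cmod (h (cis (2 * pi * x))) + e) powr s * exp (2 * s * e)))"
          using pos by (intro continuous_intros contc t) (auto simp: less_imp_neq[OF pos, symmetric])
        then show "(\<lambda>x. poisson_kernel t x * ((cmod (h (cis (2 * pi * x))) + e) powr s * exp (2 * s * e))) integrable_on {0..1}"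
          by (rule integrable_continuous_real)
        fix x :: real
        let ?z = "cis (2 * pi * x)"
        have "cmod (k ?z) = exp (s * Re (poly q ?z))" by (simp add: k_def)
        also have "\<dots> \<le> exp (s * (ln (cmod (h ?z) + e) + 2 * e))" using q2[of ?z] s by simp
        also have "\<dots> = (cmod (h ?z) + e) powr s * exp (2 * s * e)"
          using pos[of ?z] by (simp add: powr_def exp_add[symmetric] algebra_simps)
        finally show "cmod (of_real (poisson_kernel t x) * k ?z) \<le> poisson_kernel t x * ((cmod (h ?z) + e) powr s * exp (2 * s * e))"
          using poisson_kernel_nonneg[OF t, of x] by (simp add: norm_mult mult_left_mono)
      qed
      then show ?thesis using I by (simp add: integral_unique)
    qed
    finally show ?thesis .
  qed
  obtain M where M: "\<And>z. z \<in> sphere 0 1 \<Longrightarrow> cmod (h z) \<le> M"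
    using compact_imp_bounded[OF compact_continuous_image[OF conts compact_sphere]] unfolding bounded_iff by blast
  \<comment> \<open>The right side of \<open>key\<close> for e = 1/(n+1). Dominated convergence lets
    e tend to 0, with the bound for e = 1 as majorant.\<close>
  let ?f = "\<lambda>n x. poisson_kernel t x * ((cmod (h (cis (2 * pi * x))) + inverse (real (Suc n))) powr s * exp (2 * s * inverse (real (Suc n))))"
  have pos: "0 < cmod (h z) + inverse (real (Suc n))" for z n by (simp add: add_nonneg_pos)
  have "(\<lambda>n. integral {0..1} (?f n)) \<longlonglongrightarrow> integral {0..1} (\<lambda>x. poisson_kernel t x * cmod (h (cis (2 * pi * x))) powr s)"
  proof (rule dominated_convergence)
    show "?f n integrable_on {0..1}" for n
      using less_imp_neq[OF pos, of _ n]
      by (intro integrable_continuous_real continuous_intros contc t) (auto simp del: of_nat_Suc)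
    show "(\<lambda>x. poisson_kernel t x * ((M + 1) powr s * exp (2 * s))) integrable_on {0..1}"
      by (intro integrable_continuous_real continuous_intros t)
    show "norm (?f n x) \<le> poisson_kernel t x * ((M + 1) powr s * exp (2 * s))" if "x \<in> {0..1}" for n x
    proof -
      have i: "inverse (real (Suc n)) \<le> 1" by (simp add: field_simps)
      have "cmod (h (cis (2 * pi * x))) + inverse (real (Suc n)) \<le> M + 1"
        using M[of "cis (2 * pi * x)"] i by simp
      then have "(cmod (h (cis (2 * pi * x))) + inverse (real (Suc n))) powr s * exp (2 * s * inverse (real (Suc n)))
        \<le> (M + 1) powr s * exp (2 * s)"
        using s i by (intro mult_mono powr_mono2) (auto simp: mult_left_le)
      then show ?thesis using poisson_kernel_nonneg[OF t, of x] by (simp add: abs_mult mult_left_mono)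
    qed
    show "(\<lambda>n. ?f n x) \<longlonglongrightarrow> poisson_kernel t x * cmod (h (cis (2 * pi * x))) powr s" if "x \<in> {0..1}" for x
    proof -
      have 1: "(\<lambda>n. inverse (real (Suc n))) \<longlonglongrightarrow> 0" by (rule LIMSEQ_inverse_real_of_nat)
      have 2: "(\<lambda>n. (cmod (h (cis (2 * pi * x))) + inverse (real (Suc n))) powr s) \<longlonglongrightarrow> (cmod (h (cis (2 * pi * x))) + 0) powr s"
        using s by (intro tendsto_powr' tendsto_intros 1) auto
      have "(\<lambda>n. ?f n x) \<longlonglongrightarrow> poisson_kernel t x * ((cmod (h (cis (2 * pi * x))) + 0) powr s * exp (2 * s * 0))"
        by (intro tendsto_mult tendsto_exp tendsto_const 1 2)
      then show ?thesis by simp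
    qed
  qed
  then show ?thesis
    by (rule LIMSEQ_le_const) (use key in auto)
qed

section \<open>Linear images of Lebesgue measure\<close>

lemma borel_measurable_linear: "linear f \<Longrightarrow> f \<in> borel \<rightarrow>\<^sub>M borel"
  for f :: "'a::euclidean_space \<Rightarrow> 'b::euclidean_space"
  by (intro borel_measurable_continuous_onI linear_continuous_on linear_conv_bounded_linear[THEN iffD1])

lemma distr_lborel_reflect: "distr lborel borel (\<lambda>y. x - y) = (lborel :: 'a::euclidean_space measure)"
  using lborel_affine[of "-1" x] by (simp add: density_1)

text \<open>The double integral of \<open>1\<^sub>A(x) 1\<^sub>B(x + y)\<close> is evaluated in both orders.\<close>

lemma translation_invariant_measure_unique:
  fixes M :: "'a::euclidean_space measure"
  assumes [measurable_cong]: "sets M = sets borel" and "sigma_finite_measure M"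
    and inv: "\<And>a. distr M borel ((+) a) = M"
    and [measurable]: "A \<in> sets borel" "B \<in> sets borel"
  shows "emeasure M A * emeasure lborel B = emeasure M B * emeasure lborel A"
proof -
  interpret M: sigma_finite_measure M by fact
  interpret pair_sigma_finite M lborel ..
  have "emeasure M A * emeasure lborel B = (\<integral>\<^sup>+x. indicator A x * emeasure lborel B \<partial>M)"
    by (simp add: nn_integral_multc assms(1))
  also have "\<dots> = (\<integral>\<^sup>+x. \<integral>\<^sup>+y. indicator A x * indicator B (x + y) \<partial>lborel \<partial>M)"
  proof (rule nn_integral_cong)
    fix x
    have "emeasure lborel B = (\<integral>\<^sup>+y. indicator B y \<partial>distr lborel borel ((+) x))"
      by (simp add: lborel_distr_plus)
    also have "\<dots> = (\<integral>\<^sup>+y. indicator B (x + y) \<partial>lborel)"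
      by (subst nn_integral_distr) auto
    finally show "indicator A x * emeasure lborel B = (\<integral>\<^sup>+y. indicator A x * indicator B (x + y) \<partial>lborel)"
      by (simp add: nn_integral_cmult)
  qed
  also have "\<dots> = (\<integral>\<^sup>+y. \<integral>\<^sup>+x. indicator A x * indicator B (x + y) \<partial>M \<partial>lborel)"
    by (rule Fubini'[symmetric]) measurable
  also have "\<dots> = (\<integral>\<^sup>+y. \<integral>\<^sup>+x. indicator A (x - y) * indicator B x \<partial>M \<partial>lborel)"
  proof (rule nn_integral_cong)
    fix y
    have "(\<integral>\<^sup>+x. indicator A (x - y) * indicator B x \<partial>M)
      = (\<integral>\<^sup>+x. indicator A (x - y) * indicator B x \<partial>distr M borel ((+) y))" by (simp add: inv)
    also have "\<dots> = (\<integral>\<^sup>+x. indicator A x * indicator B (x + y) \<partial>M)"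
      by (subst nn_integral_distr) (auto simp: add.commute)
    finally show "(\<integral>\<^sup>+x. indicator A x * indicator B (x + y) \<partial>M) = (\<integral>\<^sup>+x. indicator A (x - y) * indicator B x \<partial>M)" ..
  qed
  also have "\<dots> = (\<integral>\<^sup>+x. \<integral>\<^sup>+y. indicator A (x - y) * indicator B x \<partial>lborel \<partial>M)"
    by (rule Fubini') measurable
  also have "\<dots> = (\<integral>\<^sup>+x. indicator B x * emeasure lborel A \<partial>M)"
  proof (rule nn_integral_cong)
    fix x
    have "emeasure lborel A = (\<integral>\<^sup>+y. indicator A y \<partial>distr lborel borel (\<lambda>y. x - y))"
      by (simp add: distr_lborel_reflect)
    also have "\<dots> = (\<integral>\<^sup>+y. indicator A (x - y) \<partial>lborel)"
      by (subst nn_integral_distr) auto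
    finally show "(\<integral>\<^sup>+y. indicator A (x - y) * indicator B x \<partial>lborel) = indicator B x * emeasure lborel A"
      by (simp add: nn_integral_multc) (simp add: mult.commute)
  qed
  also have "\<dots> = emeasure M B * emeasure lborel A"
    by (simp add: nn_integral_multc assms(1))
  finally show ?thesis .
qed

text \<open>The image measure is translation invariant, finite on balls, and positive on the unit
  ball because the preimage of that ball is open and contains 0. Uniqueness then makes it a positive
  multiple of Lebesgue measure.\<close>

lemma distr_lborel_linear:
  fixes f :: "'a::euclidean_space \<Rightarrow> 'a"
  assumes f: "linear f" "bij f"
  shows "\<exists>c::real>0. distr lborel borel f = density lborel (\<lambda>_. ennreal c)"
proof -
  define g where "g = inv f"
  have g: "linear g"
    using f by (auto simp: g_def bij_is_inj bij_is_surj inj_linear_imp_inv_linear)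
  have vim: "f -` E = g ` E" for E
    using f(2) by (simp add: g_def bij_vimage_eq_inv_image)
  let ?M = "distr lborel borel f"
  note [measurable] = borel_measurable_linear[OF f(1)]
  have emM: "emeasure ?M E = emeasure lborel (g ` E)" if "E \<in> sets borel" for E
    using that by (simp add: emeasure_distr vim)
  have fin: "emeasure ?M (ball 0 r) < \<infinity>" for r
  proof -
    have "bounded (g ` ball 0 r)"
      using g by (intro bounded_linear_image) (auto simp: linear_conv_bounded_linear)
    then show ?thesis using emeasure_bounded_finite[of "g ` ball 0 r"] by (subst emM) auto
  qed
  have sf: "sigma_finite_measure ?M"
  proof (standard, rule exI[of _ "range (\<lambda>n::nat. ball 0 (real n))"], intro conjI ballI)
    show "\<Union> (range (\<lambda>n::nat. ball (0::'a) (real n))) = space ?M"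
      by (auto intro: reals_Archimedean2)
  qed (use fin in \<open>auto simp: less_top\<close>)
  have inv: "distr ?M borel ((+) a) = ?M" for a
  proof -
    have "(+) a \<circ> f = f \<circ> (+) (g a)"
      using f by (auto simp: fun_eq_iff linear_add g_def bij_is_surj surj_f_inv_f)
    then have "distr ?M borel ((+) a) = distr (distr lborel borel ((+) (g a))) borel f"
      by (simp add: distr_distr)
    then show ?thesis by (simp add: lborel_distr_plus)
  qed
  let ?B = "ball (0::'a) 1"
  define c where "c = measure ?M ?B / measure lborel ?B"
  have op: "open (g ` ?B)"
    unfolding vim[symmetric] using f(1) by (intro open_vimage linear_continuous_on) (auto simp: linear_conv_bounded_linear)
  have "0 \<in> g ` ?B" using linear_0[OF g] by (force simp: image_iff)
  then obtain r where r: "r > 0" "ball 0 r \<subseteq> g ` ?B" using op by (auto simp: open_contains_ball)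
  have "0 < emeasure lborel (ball (0::'a) r)"
    using content_ball_pos[OF r(1), of "0::'a"] by (simp add: measure_def enn2real_positive_iff)
  also have "\<dots> \<le> emeasure ?M ?B"
    using r(2) op by (subst emM) (auto intro!: emeasure_mono)
  finally have "emeasure ?M ?B > 0" .
  then have c0: "measure ?M ?B > 0" using fin[of 1]
    by (simp add: measure_def enn2real_positive_iff)
  have b0: "measure lborel ?B > 0" by (simp add: content_ball_pos)
  have "?M = density lborel (\<lambda>_. ennreal c)"
  proof (rule measure_eqI)
    fix A assume "A \<in> sets ?M" then have [measurable]: "A \<in> sets borel" by simp
    have "emeasure ?M A * ennreal (measure lborel ?B) = ennreal (measure ?M ?B) * emeasure lborel A"
      using translation_invariant_measure_unique[OF _ sf inv, of A ?B] fin[of 1] emeasure_lborel_ball_finite[of "0::'a" 1]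
      by (simp add: emeasure_eq_ennreal_measure less_top del: emeasure_lborel_ball_finite)
    then have "emeasure ?M A * ennreal (measure lborel ?B) / ennreal (measure lborel ?B)
      = ennreal (measure ?M ?B) * emeasure lborel A / ennreal (measure lborel ?B)" by simp
    then have "emeasure ?M A = ennreal (measure ?M ?B) * emeasure lborel A / ennreal (measure lborel ?B)"
      using b0 by (simp add: ennreal_mult_divide_eq)
    also have "\<dots> = ennreal c * emeasure lborel A"
      unfolding c_def using b0 c0 by (simp add: divide_ennreal[symmetric] ennreal_times_divide mult.commute)
    finally show "emeasure ?M A = emeasure (density lborel (\<lambda>_. ennreal c)) A"
      by (simp add: emeasure_density_const)
  qed simp
  then show ?thesis using b0 c0 by (intro exI[of _ c]) (auto simp: c_def)
qed

section \<open>Polar coordinates\<close>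

definition unif_ball :: "'a::euclidean_space measure" where
  "unif_ball = uniform_measure lborel (ball 0 1)"

definition norm_law :: "'a::euclidean_space itself \<Rightarrow> real measure" where
  "norm_law _ = distr (unif_ball :: 'a measure) borel norm"

text \<open>Normalised surface measure, taken as the law of the direction of a uniform point of the
  ball; it inherits invariance under linear isometries from Lebesgue measure.\<close>

definition sphere_measure :: "'a::euclidean_space measure" where
  "sphere_measure = distr unif_ball borel sgn"

lemma borel_measurable_sgn_vec [measurable]: "sgn \<in> borel_measurable (borel :: 'a::euclidean_space measure)"
  by (simp add: sgn_div_norm[abs_def])

lemma sets_unif_ball [simp, measurable_cong]: "sets unif_ball = sets borel"
  and space_unif_ball [simp]: "space unif_ball = UNIV"
  by (simp_all add: unif_ball_def)

lemma sets_norm_law [simp, measurable_cong]: "sets (norm_law n) = sets borel"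
  and space_norm_law [simp]: "space (norm_law n) = UNIV"
  by (simp_all add: norm_law_def)

lemma sets_sphere_measure [simp, measurable_cong]: "sets sphere_measure = sets borel"
  and space_sphere_measure [simp]: "space sphere_measure = UNIV"
  by (simp_all add: sphere_measure_def)

lemma emeasure_lborel_unit_ball:
  "emeasure lborel (ball (0::'a::euclidean_space) 1) \<noteq> 0" "emeasure lborel (ball (0::'a::euclidean_space) 1) < \<infinity>"
  using content_ball_pos[of 1 "0::'a"] emeasure_lborel_ball_finite[of "0::'a" 1]
  by (auto simp: measure_def)

lemma prob_space_unif_ball: "prob_space unif_ball"
  unfolding unif_ball_def using emeasure_lborel_unit_ball
  by (intro prob_space_uniform_measure) (auto simp: less_top[symmetric])

interpretation unif_ball: prob_space unif_ball by (rule prob_space_unif_ball)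

interpretation sphere_measure: prob_space sphere_measure
  unfolding sphere_measure_def by (intro unif_ball.prob_space_distr) measurable

interpretation norm_law: prob_space "norm_law n" for n
  unfolding norm_law_def by (intro unif_ball.prob_space_distr) measurable

lemma emeasure_unif_ball:
  fixes E :: "'a::euclidean_space set"
  shows "E \<in> sets borel \<Longrightarrow> emeasure unif_ball E = emeasure lborel (ball 0 1 \<inter> E) / emeasure lborel (ball (0::'a) 1)"
  by (simp add: unif_ball_def)

lemma null_unif_ball:
  fixes E :: "'a::euclidean_space set"
  assumes "E \<in> null_sets lborel" shows "E \<in> null_sets unif_ball"
proof -
  have [measurable]: "E \<in> sets borel" using assms by auto
  have "ball 0 1 \<inter> E \<in> null_sets lborel"
    using assms by (intro null_set_Int1) auto
  then have "emeasure lborel (ball 0 1 \<inter> E) = 0" by auto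
  then show ?thesis by (simp add: null_sets_def emeasure_unif_ball)
qed

lemma AE_unif_ball_in_ball: "AE x in unif_ball. x \<in> ball (0::'a::euclidean_space) 1"
  unfolding unif_ball_def by (rule AE_uniform_measureI) auto

lemma AE_unif_ball_nonzero: "AE x in unif_ball. x \<noteq> (0::'a::euclidean_space)"
  using null_unif_ball[OF finite_imp_null_set_lborel, of "{0::'a}"] by (intro AE_I'[of "{0}"]) auto

lemma AE_unif_ball_norm_neq: "AE x in unif_ball. norm (x::'a::euclidean_space) \<noteq> r"
proof -
  have "negligible (sphere (0::'a) r)" by (rule negligible_sphere)
  then have "sphere (0::'a) r \<in> null_sets lborel"
    by (simp add: negligible_iff_null_sets null_sets_completion_iff)
  from null_unif_ball[OF this] show ?thesis by (intro AE_I'[of "sphere 0 r"]) auto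
qed

text \<open>The distribution function of the norm of a uniform point in the unit ball of real
  dimension d.\<close>

definition clamp_pow :: "nat \<Rightarrow> real \<Rightarrow> real" where
  "clamp_pow d x = (if x \<le> 0 then 0 else if x < 1 then x ^ d else 1)"

text \<open>Independence of norm and direction on half lines: the homothety with ratio x carries the
  cone over E in the unit ball onto its part of norm below x and multiplies volume by a power of x.
  The gap between < and \<le> is a null sphere.\<close>

lemma measure_unif_ball_cone:
  fixes E :: "'a::euclidean_space set"
  assumes [measurable]: "E \<in> sets borel"
  shows "measure unif_ball {w. norm w \<le> x \<and> sgn w \<in> E} = clamp_pow (DIM('a)) x * measure unif_ball {w::'a. sgn w \<in> E}"
proof -
  consider "x \<le> 0" | "0 < x" "x < 1" | "x \<ge> 1" by linarith
  then show ?thesis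
  proof cases
    case 1
    have "measure unif_ball {w. norm w \<le> x \<and> sgn w \<in> E} = measure unif_ball ({} :: 'a set)"
      by (rule measure_eq_AE, use AE_unif_ball_nonzero in eventually_elim)
         (use 1 in \<open>auto simp: norm_le_zero_iff dest: order_trans\<close>)
    then show ?thesis using 1 by (simp add: clamp_pow_def)
  next
    case 2
    let ?S = "{w::'a. norm w < x \<and> sgn w \<in> E}"
    let ?W = "{w::'a. norm w < 1 \<and> sgn w \<in> E}"
    have vim: "(\<lambda>y. 0 + x *\<^sub>R y) -` ?S = ?W"
      using 2 by (auto simp: sgn_scaleR)
    have "emeasure lborel ?S = emeasure (density (distr lborel borel (\<lambda>y. 0 + x *\<^sub>R y)) (\<lambda>_. \<bar>x\<bar> ^ DIM('a))) ?S"
      using 2 by (subst lborel_affine[of x 0]) auto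
    also have "\<dots> = ennreal (x ^ DIM('a)) * emeasure lborel ?W"
      using 2 by (subst emeasure_density_const) (auto simp: emeasure_distr sgn_scaleR)
    finally have e: "emeasure lborel ?S = ennreal (x ^ DIM('a)) * emeasure lborel ?W" .
    have "measure unif_ball {w. norm w \<le> x \<and> sgn w \<in> E} = measure unif_ball ?S"
      by (rule measure_eq_AE, use AE_unif_ball_norm_neq[of x] in eventually_elim) auto
    also have "emeasure unif_ball ?S = ennreal (x ^ DIM('a)) * emeasure unif_ball {w. sgn w \<in> E}"
    proof -
      have 1: "ball 0 1 \<inter> ?S = ?S" "ball 0 1 \<inter> {w. sgn w \<in> E} = ?W" using 2 by auto
      show ?thesis by (subst (1 2) emeasure_unif_ball) (auto simp: 1 e ennreal_times_divide)
    qed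
    then have "measure unif_ball ?S = x ^ DIM('a) * measure unif_ball {w. sgn w \<in> E}"
      using 2 by (simp add: measure_def enn2real_mult)
    finally show ?thesis using 2 by (simp add: clamp_pow_def)
  next
    case 3
    have "measure unif_ball {w. norm w \<le> x \<and> sgn w \<in> E} = measure unif_ball {w::'a. sgn w \<in> E}"
      by (rule measure_eq_AE, use AE_unif_ball_in_ball in eventually_elim) (use 3 in auto)
    then show ?thesis using 3 by (simp add: clamp_pow_def)
  qed
qed

lemma measure_unif_ball_cone_greater:
  fixes E :: "'a::euclidean_space set"
  assumes [measurable]: "E \<in> sets borel"
  shows "measure unif_ball {w. x < norm w \<and> sgn w \<in> E}
    = (1 - clamp_pow (DIM('a)) x) * measure unif_ball {w::'a. sgn w \<in> E}"
proof -
  have "{w. x < norm w \<and> sgn w \<in> E} = {w::'a. sgn w \<in> E} - {w. norm w \<le> x \<and> sgn w \<in> E}" by auto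
  moreover have "measure unif_ball ({w::'a. sgn w \<in> E} - {w. norm w \<le> x \<and> sgn w \<in> E})
    = measure unif_ball {w::'a. sgn w \<in> E} - measure unif_ball {w. norm w \<le> x \<and> sgn w \<in> E}"
    by (rule unif_ball.finite_measure_Diff) auto
  ultimately show ?thesis by (simp add: measure_unif_ball_cone algebra_simps)
qed

lemma clamp_pow_le_1: "clamp_pow d x \<le> 1"
  by (auto simp: clamp_pow_def power_le_one)

lemma emeasure_norm_law_greaterThan:
  "emeasure (norm_law TYPE('a::euclidean_space)) {x<..} = ennreal (1 - clamp_pow (DIM('a)) x)"
proof -
  have "emeasure (norm_law TYPE('a)) {x<..} = emeasure (unif_ball :: 'a measure) {w. x < norm w}"
    unfolding norm_law_def by (subst emeasure_distr) (auto intro!: arg_cong[where f="emeasure _"])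
  also have "\<dots> = ennreal (1 - clamp_pow (DIM('a)) x)"
    using measure_unif_ball_cone_greater[of "UNIV :: 'a set" x] unif_ball.prob_space[where 'a='a]
    by (simp add: unif_ball.emeasure_eq_measure)
  finally show ?thesis .
qed

text \<open>For fixed E both sides are finite measures in A. Such measures on the line agree once
  they agree on the half lines \<open>{x<..}\<close>, where the cone formula applies.\<close>

lemma distr_polar:
  "distr unif_ball (borel \<Otimes>\<^sub>M borel) (\<lambda>w. (norm w, sgn w))
    = norm_law TYPE('a::euclidean_space) \<Otimes>\<^sub>M (sphere_measure :: 'a measure)"
proof (rule pair_measure_eqI[symmetric])
  show "sigma_finite_measure (norm_law TYPE('a))" "sigma_finite_measure (sphere_measure :: 'a measure)" by unfold_locales
  fix A :: "real set" and E :: "'a set"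
  assume "A \<in> sets (norm_law TYPE('a))" "E \<in> sets sphere_measure"
  then have [measurable]: "A \<in> sets borel" "E \<in> sets borel" by simp_all
  let ?M1 = "distr (density unif_ball (indicator {w::'a. sgn w \<in> E})) borel norm"
  let ?M2 = "density (norm_law TYPE('a)) (\<lambda>_. emeasure (unif_ball::'a measure) {w. sgn w \<in> E})"
  have M1: "emeasure ?M1 X = emeasure unif_ball {w. norm w \<in> X \<and> sgn w \<in> E}" if [measurable]: "X \<in> sets borel" for X
  proof -
    have "emeasure ?M1 X = emeasure (density unif_ball (indicator {w::'a. sgn w \<in> E})) {w. norm w \<in> X}"
      by (subst emeasure_distr) (auto simp: vimage_def)
    also have "\<dots> = emeasure unif_ball ({w. sgn w \<in> E} \<inter> {w. norm w \<in> X})"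
      by (subst emeasure_restricted) auto
    finally show ?thesis by (simp add: Int_def conj_commute)
  qed
  have "?M1 = ?M2"
  proof (rule measure_eqI_lessThan)
    fix x
    show "emeasure ?M1 {x<..} < \<infinity>" by (subst M1) (auto simp: unif_ball.emeasure_eq_measure)
    have "emeasure ?M2 {x<..} = emeasure (unif_ball::'a measure) {w. sgn w \<in> E} * ennreal (1 - clamp_pow (DIM('a)) x)"
      by (subst emeasure_density_const) (auto simp: emeasure_norm_law_greaterThan)
    then show "emeasure ?M1 {x<..} = emeasure ?M2 {x<..}"
      by (subst M1) (auto simp: unif_ball.emeasure_eq_measure measure_unif_ball_cone_greater ennreal_mult' mult.commute clamp_pow_le_1)
  qed auto
  then have "emeasure ?M1 A = emeasure ?M2 A" by simp
  then have "emeasure unif_ball {w. norm w \<in> A \<and> sgn w \<in> E} = emeasure (unif_ball::'a measure) {w. sgn w \<in> E} * emeasure (norm_law TYPE('a)) A"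
    by (simp add: M1 emeasure_density_const)
  moreover have "emeasure (sphere_measure :: 'a measure) E = emeasure (unif_ball::'a measure) {w. sgn w \<in> E}"
    unfolding sphere_measure_def by (subst emeasure_distr) (auto simp: vimage_def)
  moreover have "emeasure (distr unif_ball (borel \<Otimes>\<^sub>M borel) (\<lambda>w. (norm w, sgn w))) (A \<times> E)
    = emeasure unif_ball {w::'a. norm w \<in> A \<and> sgn w \<in> E}"
    by (subst emeasure_distr) (auto simp: vimage_def)
  ultimately show "emeasure (norm_law TYPE('a)) A * emeasure (sphere_measure :: 'a measure) E
    = emeasure (distr unif_ball (borel \<Otimes>\<^sub>M borel) (\<lambda>w. (norm w, sgn w))) (A \<times> E)"
    by (simp add: mult.commute)
qed (simp cong: sets_pair_measure_cong)

lemma nn_integral_polar: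
  fixes F :: "'a::euclidean_space \<Rightarrow> ennreal"
  assumes [measurable]: "F \<in> borel_measurable borel"
  shows "(\<integral>\<^sup>+w. F w \<partial>unif_ball) = (\<integral>\<^sup>+r. \<integral>\<^sup>+z. F (r *\<^sub>R z) \<partial>sphere_measure \<partial>norm_law TYPE('a))"
proof -
  have "(\<integral>\<^sup>+w. F w \<partial>unif_ball) = (\<integral>\<^sup>+w. F (norm w *\<^sub>R sgn w) \<partial>unif_ball)"
  proof (rule nn_integral_cong)
    show "F w = F (norm w *\<^sub>R sgn w)" for w :: 'a by (cases "w = 0") (simp_all add: sgn_div_norm)
  qed
  also have "\<dots> = (\<integral>\<^sup>+p. F (fst p *\<^sub>R snd p) \<partial>distr unif_ball (borel \<Otimes>\<^sub>M borel) (\<lambda>w. (norm w, sgn w)))"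
    by (subst nn_integral_distr) auto
  also have "\<dots> = (\<integral>\<^sup>+p. F (fst p *\<^sub>R snd p) \<partial>(norm_law TYPE('a) \<Otimes>\<^sub>M sphere_measure))"
    by (simp add: distr_polar)
  also have "\<dots> = (\<integral>\<^sup>+r. \<integral>\<^sup>+z. F (r *\<^sub>R z) \<partial>sphere_measure \<partial>norm_law TYPE('a))"
    by (subst sphere_measure.nn_integral_fst[symmetric]) auto
  finally show ?thesis .
qed

lemma AE_sphere_measure_norm: "AE z in sphere_measure. norm (z::'a::euclidean_space) = 1"
proof -
  have "AE w in unif_ball. norm (sgn w :: 'a) = 1"
    using AE_unif_ball_nonzero by eventually_elim (simp add: norm_sgn)
  then show ?thesis unfolding sphere_measure_def by (subst AE_distr_iff) auto
qed

lemma norm_law_density: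
  "norm_law TYPE('a::euclidean_space)
    = density lborel (\<lambda>t. ennreal (real DIM('a) * t ^ (DIM('a) - 1)) * indicator {0<..<1} t)" (is "_ = ?D")
proof (rule measure_eqI_lessThan)
  fix x :: real
  let ?d = "DIM('a)"
  show "emeasure (norm_law TYPE('a)) {x<..} < \<infinity>" by (simp add: emeasure_norm_law_greaterThan)
  \<comment> \<open>Half lines starting outside [0,1] have the same mass as those starting at the
    clamped point, which reduces all cases to one integral.\<close>
  define y where "y = min 1 (max 0 x)"
  have y: "0 \<le> y" "y \<le> 1" by (auto simp: y_def)
  have "emeasure ?D {x<..} = (\<integral>\<^sup>+t. ennreal (real ?d * t ^ (?d - 1)) * indicator {0<..<1} t * indicator {x<..} t \<partial>lborel)"
    by (subst emeasure_density) auto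
  also have "\<dots> = (\<integral>\<^sup>+t. ennreal (real ?d * t ^ (?d - 1)) * indicator {y..1} t \<partial>lborel)"
    by (rule nn_integral_cong_AE, use AE_lborel_singleton[of 1] AE_lborel_singleton[of y] in eventually_elim)
       (auto simp: y_def indicator_def max_def min_def split: if_splits)
  also have "\<dots> = ennreal (1 ^ ?d - y ^ ?d)"
    using y by (intro nn_integral_FTC_Icc) (auto intro!: derivative_eq_intros)
  also have "\<dots> = ennreal (1 - clamp_pow ?d x)"
    by (auto simp: y_def clamp_pow_def min_def max_def)
  finally show "emeasure (norm_law TYPE('a)) {x<..} = emeasure ?D {x<..}" by (simp add: emeasure_norm_law_greaterThan)
qed auto

lemma nn_integral_norm_law:
  assumes [measurable]: "f \<in> borel_measurable borel"
  shows "(\<integral>\<^sup>+t. f t \<partial>norm_law TYPE('a::euclidean_space))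
    = (\<integral>\<^sup>+t. ennreal (real DIM('a) * t ^ (DIM('a) - 1)) * indicator {0<..<1} t * f t \<partial>lborel)"
  unfolding norm_law_density by (subst nn_integral_density) auto

lemma AE_norm_law: "AE t in norm_law TYPE('a::euclidean_space). 0 < t \<and> t < 1"
  unfolding norm_law_density by (subst AE_density) (auto simp: indicator_def)

text \<open>The Jacobian factor is found by testing the image measure on the unit ball, which is its
  own preimage under a norm preserving map.\<close>

lemma isometry_distr_unif_ball:
  fixes f :: "'a::euclidean_space \<Rightarrow> 'a"
  assumes f: "linear f" "bij f" "\<And>x. norm (f x) = norm x"
  shows "distr unif_ball borel f = unif_ball"
proof -
  obtain c where c: "c > 0" "distr lborel borel f = density lborel (\<lambda>_. ennreal c)"
    using distr_lborel_linear[OF f(1,2)] by blast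
  note [measurable] = borel_measurable_linear[OF f(1)]
  have vim: "f -` ball 0 1 = ball 0 1" using f(3) by auto
  have "emeasure (distr lborel borel f) (ball 0 1) = emeasure lborel (ball (0::'a) 1)"
    by (subst emeasure_distr) (auto simp: vim)
  then have "ennreal c * emeasure lborel (ball (0::'a) 1) = 1 * emeasure lborel (ball (0::'a) 1)"
    by (simp add: c(2) emeasure_density_const)
  then have c1: "ennreal c = 1"
    using emeasure_lborel_unit_ball[where 'a='a]
    by (metis ennreal_mult_divide_eq infinity_ennreal_def order_less_irrefl)
  then have d: "distr lborel borel f = lborel" by (simp add: c(2) density_1)
  have "emeasure (distr unif_ball borel f) E = emeasure unif_ball E" if [measurable]: "E \<in> sets borel" for E
  proof -
    have "emeasure (distr unif_ball borel f) E = emeasure lborel (ball 0 1 \<inter> f -` E) / emeasure lborel (ball (0::'a) 1)"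
      by (subst emeasure_distr) (auto simp: emeasure_unif_ball measurable_sets_borel[OF borel_measurable_linear[OF f(1)]])
    also have "ball 0 1 \<inter> f -` E = f -` (ball 0 1 \<inter> E)" using vim by auto
    also have "emeasure lborel (f -` (ball 0 1 \<inter> E)) = emeasure (distr lborel borel f) (ball 0 1 \<inter> E)"
      by (subst emeasure_distr) auto
    finally show ?thesis by (simp add: d emeasure_unif_ball)
  qed
  then show ?thesis by (intro measure_eqI) auto
qed

lemma isometry_distr_sphere_measure:
  fixes f :: "'a::euclidean_space \<Rightarrow> 'a"
  assumes f: "linear f" "bij f" "\<And>x. norm (f x) = norm x"
  shows "distr sphere_measure borel f = sphere_measure"
proof -
  note [measurable] = borel_measurable_linear[OF f(1)]
  have eq: "f \<circ> sgn = sgn \<circ> f"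
    using f by (auto simp: fun_eq_iff sgn_div_norm linear_cmul)
  have "distr sphere_measure borel f = distr unif_ball borel (f \<circ> sgn)"
    unfolding sphere_measure_def by (subst distr_distr) auto
  also have "\<dots> = distr (distr unif_ball borel f) borel sgn"
    unfolding eq by (subst distr_distr) auto
  finally show ?thesis by (simp add: isometry_distr_unif_ball[OF f] sphere_measure_def)
qed

section \<open>The Hermitian product and nonisotropic geometry\<close>

lemma hinner_add_left: "hinner (x + y) z = hinner x z + hinner y z"
  and hinner_diff_left: "hinner (x - y) z = hinner x z - hinner y z"
  and hinner_diff_right: "hinner z (x - y) = hinner z x - hinner z y"
  and hinner_smult_left: "hinner (c *s x) z = c * hinner x z"
  and hinner_smult_right: "hinner z (c *s x) = cnj c * hinner z x"
  and hinner_scaleR_left: "hinner (r *\<^sub>R x) z = of_real r * hinner x z"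
  and hinner_scaleR_right: "hinner z (r *\<^sub>R x) = of_real r * hinner z x"
  and hinner_zero_left [simp]: "hinner 0 z = 0"
  and hinner_zero_right [simp]: "hinner z 0 = 0"
  by (simp_all add: hinner_def algebra_simps sum.distrib sum_subtractf sum_distrib_left scaleR_conv_of_real[where 'a=complex])

lemma cnj_hinner: "cnj (hinner x y) = hinner y x"
  by (simp add: hinner_def mult.commute)

lemma norm_cvec: "(norm x)\<^sup>2 = (\<Sum>j\<in>UNIV. (cmod (x $ j))\<^sup>2)" for x :: "complex ^ 'n::finite"
  by (simp add: norm_vec_def L2_set_def sum_nonneg)

lemma hinner_self: "hinner x x = of_real ((norm x)\<^sup>2)"
  unfolding hinner_def norm_cvec of_real_sum complex_norm_square ..

lemma hinner_Cauchy_Schwarz: "cmod (hinner x y) \<le> norm x * norm y"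
proof -
  have "cmod (hinner x y) \<le> (\<Sum>j\<in>UNIV. cmod (x $ j) * cmod (y $ j))"
    unfolding hinner_def by (rule order_trans[OF norm_sum]) (simp add: norm_mult)
  also have "\<dots> \<le> norm x * norm y"
    using L2_set_mult_ineq[of "\<lambda>j. cmod (x $ j)" "\<lambda>j. cmod (y $ j)" UNIV] by (simp add: norm_vec_def)
  finally show ?thesis .
qed

lemma obtain_direction:
  fixes z :: "complex ^ 'n::finite"
  obtains e where "norm e = 1" "z = norm z *\<^sub>R e"
proof (cases "z = 0")
  case True
  then show ?thesis using that[of "axis undefined 1"] by simp
next
  case False
  then show ?thesis using that[of "sgn z"] by (simp add: norm_sgn sgn_div_norm)
qed

lemma norm_diff_hinner:
  "(norm (z - c *s u))\<^sup>2 = (norm z)\<^sup>2 - 2 * Re (cnj c * hinner z u) + (cmod c)\<^sup>2 * (norm u)\<^sup>2"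
proof -
  have "complex_of_real ((norm (z - c *s u))\<^sup>2) = hinner (z - c *s u) (z - c *s u)" by (simp add: hinner_self)
  also have "\<dots> = hinner z z - (cnj c * hinner z u + cnj (cnj c * hinner z u)) + (c * cnj c) * hinner u u"
    by (simp add: hinner_diff_left hinner_diff_right hinner_smult_left hinner_smult_right cnj_hinner algebra_simps)
  also have "\<dots> = of_real ((norm z)\<^sup>2 - 2 * Re (cnj c * hinner z u) + (cmod c)\<^sup>2 * (norm u)\<^sup>2)"
    by (simp only: hinner_self complex_add_cnj complex_norm_square[symmetric]) simp
  finally show ?thesis using of_real_eq_iff by blast
qed

text \<open>Here u may be any vector. For |u| \<le> 1 the factor 2 - |u|^2 is at least 1, which
  bounds the part of a point z of the ball transversal to u by 1 - |<z,u>|^2.\<close>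

lemma norm_diff_hinner_proj:
  "(norm (z - hinner z u *s u))\<^sup>2 = (norm z)\<^sup>2 - (2 - (norm u)\<^sup>2) * (cmod (hinner z u))\<^sup>2"
proof -
  have "Re (cnj (hinner z u) * hinner z u) = (cmod (hinner z u))\<^sup>2"
    by (simp only: mult.commute[of "cnj _"] complex_norm_square[symmetric]) simp
  then show ?thesis by (simp add: norm_diff_hinner algebra_simps)
qed

lemma norm_Pythagoras:
  assumes "norm e = 1"
  shows "(norm v)\<^sup>2 = (cmod (hinner v e))\<^sup>2 + (norm (v - hinner v e *s e))\<^sup>2"
  using norm_diff_hinner_proj[of v e] assms by simp

text \<open>The term \<open>\<langle>z, w\<rangle> - \<langle>z, u\<rangle> \<langle>u, w\<rangle>\<close> is a positive semidefinite form in \<open>z, w\<close>, controlled by its diagonal.\<close>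

lemma hinner_quasi_triangle:
  assumes z: "norm z \<le> 1" and w: "norm w \<le> 1" and u: "norm u \<le> 1"
  shows "cmod (1 - hinner z w) \<le> 4 * (cmod (1 - hinner z u) + cmod (1 - hinner u w))"
proof -
  define a b where "a = hinner z u" and "b = hinner u w"
  define A B where "A = cmod (1 - a)" and "B = cmod (1 - b)"
  define z' w' where "z' = z - a *s u" and "w' = w - cnj b *s u"
  have cb: "cnj b = hinner w u" by (simp add: b_def cnj_hinner)
  have u2: "(norm u)\<^sup>2 \<le> 1" using u by (simp add: power_le_one)
  have le1: "cmod a \<le> 1" "cmod b \<le> 1" "cmod a \<le> norm u"
    using hinner_Cauchy_Schwarz[of z u] hinner_Cauchy_Schwarz[of u w] mult_le_one[OF z _ u] mult_le_one[OF u _ w]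
      mult_left_le_one_le[of "norm u" "norm z"] z
    by (simp_all add: a_def b_def)
  have oneA: "1 - cmod a \<le> A" "1 - cmod b \<le> B"
    using norm_triangle_ineq2[of 1 a] norm_triangle_ineq2[of 1 b] by (auto simp: A_def B_def)
  have aux: "(norm (x - hinner x u *s u))\<^sup>2 \<le> 1 - (cmod (hinner x u))\<^sup>2" if x: "norm x \<le> 1" for x
  proof -
    have "(norm x)\<^sup>2 \<le> 1" using x by (simp add: power_le_one)
    moreover have "1 * (cmod (hinner x u))\<^sup>2 \<le> (2 - (norm u)\<^sup>2) * (cmod (hinner x u))\<^sup>2"
      using u2 by (intro mult_right_mono) auto
    ultimately show ?thesis unfolding norm_diff_hinner_proj by linarith
  qed
  have z'2: "(norm z')\<^sup>2 \<le> 1 - (cmod a)\<^sup>2" using aux[OF z] by (simp add: z'_def a_def)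
  have w'2: "(norm w')\<^sup>2 \<le> 1 - (cmod b)\<^sup>2" using aux[OF w] by (simp add: w'_def cb) (simp add: cb[symmetric])
  \<comment> \<open>Three contributions: the one-variable term 1 - a b, the part transversal to u,
    and a correction because u may lie inside the ball. The last is controlled since |a| \<le> |u|
    gives 1 - |u| \<le> 1 - |a| \<le> A.\<close>
  have eq: "1 - hinner z w = (1 - a * b) - hinner z' w' - a * b * of_real (1 - (norm u)\<^sup>2)"
    by (simp add: z'_def w'_def hinner_diff_left hinner_diff_right hinner_smult_left hinner_smult_right hinner_self
        a_def[symmetric] b_def[symmetric] algebra_simps)
  have sq: "1 - x\<^sup>2 \<le> 2 * (1 - x)" for x :: real
    using zero_le_power2[of "1 - x"] by (simp add: power2_eq_square algebra_simps)
  have "cmod (1 - a * b) = cmod ((1 - a) + a * (1 - b))" by (simp add: algebra_simps)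
  also have "\<dots> \<le> A + cmod a * B" unfolding A_def B_def by (rule order_trans[OF norm_triangle_ineq]) (simp add: norm_mult)
  also have "\<dots> \<le> A + B" using le1 by (simp add: B_def mult_left_le_one_le)
  finally have 1: "cmod (1 - a * b) \<le> A + B" .
  have "cmod (hinner z' w') \<le> norm z' * norm w'" by (rule hinner_Cauchy_Schwarz)
  also have "\<dots> \<le> ((norm z')\<^sup>2 + (norm w')\<^sup>2) / 2"
    using zero_le_power2[of "norm z' - norm w'"] by (simp add: power2_eq_square algebra_simps)
  also have "\<dots> \<le> A + B" using z'2 w'2 sq[of "cmod a"] sq[of "cmod b"] oneA by simp
  finally have 2: "cmod (hinner z' w') \<le> A + B" .
  have "cmod (a * b * of_real (1 - (norm u)\<^sup>2)) = cmod a * cmod b * (1 - (norm u)\<^sup>2)"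
    using u2 by (simp only: norm_mult norm_of_real abs_of_nonneg diff_ge_0_iff_ge)
  also have "\<dots> \<le> 1 * (1 - (norm u)\<^sup>2)"
    using le1 u2 by (intro mult_right_mono mult_le_one) auto
  also have "\<dots> \<le> 2 * A" using sq[of "norm u"] le1(3) oneA by simp
  finally have 3: "cmod (a * b * of_real (1 - (norm u)\<^sup>2)) \<le> 2 * A" .
  have "cmod (1 - hinner z w) \<le> cmod (1 - a * b) + cmod (hinner z' w') + cmod (a * b * of_real (1 - (norm u)\<^sup>2))"
    unfolding eq by (intro order_trans[OF norm_triangle_ineq4] add_mono order_refl)
  then have "cmod (1 - hinner z w) \<le> 4 * A + 2 * B" using 1 2 3 by linarith
  moreover have "0 \<le> B" by (simp add: B_def)
  ultimately have "cmod (1 - hinner z w) \<le> 4 * A + 4 * B" by linarith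
  then show ?thesis by (simp add: A_def B_def a_def b_def)
qed

section \<open>Tents, polar sectors and Carleson blocks\<close>

definition tent :: "complex ^ 'n::finite \<Rightarrow> real \<Rightarrow> (complex ^ 'n) set" where
  "tent e d = {w \<in> ball 0 1. cmod (1 - hinner w e) < d}"

lemma continuous_on_hinner [continuous_intros]:
  "continuous_on A f \<Longrightarrow> continuous_on A g \<Longrightarrow> continuous_on A (\<lambda>x. hinner (f x) (g x))"
  unfolding hinner_def by (intro continuous_intros)

lemma borel_measurable_hinner [measurable]: "(\<lambda>w. hinner w e) \<in> borel_measurable borel"
  by (intro borel_measurable_continuous_onI continuous_intros)

lemma open_tent [simp]: "open (tent e d)"
proof -
  have "tent e d = ball 0 1 \<inter> (\<lambda>w. cmod (1 - hinner w e)) -` {..<d}" by (auto simp: tent_def)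
  then show ?thesis
    by (simp only:) (intro open_Int open_vimage continuous_intros open_ball open_lessThan)
qed

lemma tent_subset_ball: "tent e d \<subseteq> ball 0 1" by (auto simp: tent_def)

lemma tent_mono: "d \<le> d' \<Longrightarrow> tent e d \<subseteq> tent e d'" by (auto simp: tent_def)

lemma tent_eq_ball:
  assumes "norm e = 1" "2 \<le> d"
  shows "tent e d = ball 0 1"
proof -
  have "cmod (1 - hinner w e) < d" if "norm w < 1" for w
  proof -
    have "cmod (1 - hinner w e) \<le> 1 + norm w * norm e"
      using norm_triangle_ineq4[of 1 "hinner w e"] hinner_Cauchy_Schwarz[of w e] by simp
    then show ?thesis using that assms by simp
  qed
  then show ?thesis by (auto simp: tent_def)
qed

lemma norm_sgn_diff: "norm (sgn w - w) = 1 - norm w" if "norm w \<le> 1" "w \<noteq> 0" for w :: "'a::real_normed_vector"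
proof -
  have "sgn w - w = (1 - norm w) *\<^sub>R sgn w" using that by (simp add: sgn_div_norm algebra_simps)
  then show ?thesis using that by (simp add: norm_sgn)
qed

lemma one_minus_hinner_sgn:
  assumes "norm w \<le> 1" "w \<noteq> 0" "norm e = 1"
  shows "cmod (1 - hinner (sgn w) e) \<le> cmod (1 - hinner w e) + (1 - norm w)"
    and "cmod (1 - hinner w e) \<le> cmod (1 - hinner (sgn w) e) + (1 - norm w)"
proof -
  have *: "cmod (hinner (sgn w - w) e) \<le> 1 - norm w"
    using hinner_Cauchy_Schwarz[of "sgn w - w" e] assms norm_sgn_diff[of w] by simp
  have "cmod ((1 - hinner w e) - hinner (sgn w - w) e) \<le> cmod (1 - hinner w e) + (1 - norm w)"
    by (rule order_trans[OF norm_triangle_ineq4]) (use * in simp)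
  then show "cmod (1 - hinner (sgn w) e) \<le> cmod (1 - hinner w e) + (1 - norm w)"
    by (simp add: hinner_diff_left)
  have "cmod ((1 - hinner (sgn w) e) + hinner (sgn w - w) e) \<le> cmod (1 - hinner (sgn w) e) + (1 - norm w)"
    by (rule order_trans[OF norm_triangle_ineq]) (use * in simp)
  then show "cmod (1 - hinner w e) \<le> cmod (1 - hinner (sgn w) e) + (1 - norm w)"
    by (simp add: hinner_diff_left)
qed

lemma one_minus_norm_le:
  assumes "norm e = 1" shows "1 - norm w \<le> cmod (1 - hinner w e)"
  using norm_triangle_ineq2[of 1 "hinner w e"] hinner_Cauchy_Schwarz[of w e] assms by simp

text \<open>Passing from w to its direction changes 1 - <w,e> by at most 1 - |w|, which is itself at
  most |1 - <w,e>|. Tents and polar sectors over caps are therefore nested up to a factor 2 in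
  scale, one way here and the other way in \<open>tentI_polar\<close>.\<close>

lemma tentD_polar:
  assumes "w \<in> tent e d" "norm e = 1" "w \<noteq> 0"
  shows "1 - d < norm w" "cmod (1 - hinner (sgn w) e) < 2 * d"
  using one_minus_hinner_sgn(1)[of w e] one_minus_norm_le[of e w] assms by (auto simp: tent_def)

lemma tentI_polar:
  assumes "norm w < 1" "w \<noteq> 0" "1 - d / 2 < norm w" "cmod (1 - hinner (sgn w) e) \<le> d / 2" "norm e = 1"
  shows "w \<in> tent e d"
  using one_minus_hinner_sgn(2)[of w e] assms by (auto simp: tent_def)

lemma carleson_block_eq:
  assumes e: "norm e = 1" and d: "0 < d" "d < 1"
  shows "carleson_block ((1 - d) *\<^sub>R e) = {w. 1 - d < norm w \<and> norm w < 1 \<and> cmod (1 - hinner (sgn w) e) \<le> d}"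
proof -
  have n: "norm ((1 - d) *\<^sub>R e) = 1 - d" using e d by simp
  have e0: "e \<noteq> 0" using e by auto
  have 1: "((1 - d) *\<^sub>R e) /\<^sub>R (1 - d) = e" using d by simp
  have 2: "cmod (1 - hinner e (w /\<^sub>R norm w)) = cmod (1 - hinner (sgn w) e)" for w
  proof -
    have "cmod (1 - hinner e (sgn w)) = cmod (cnj (1 - hinner e (sgn w)))" by (rule complex_mod_cnj[symmetric])
    then show ?thesis by (simp add: cnj_hinner sgn_div_norm)
  qed
  show ?thesis unfolding carleson_block_def n 1 2 using d e0 by simp
qed

lemma carleson_block_subset_tent:
  assumes "norm e = 1" "0 < d" "d < 1"
  shows "carleson_block ((1 - d) *\<^sub>R e) \<subseteq> tent e (2 * d)"
  unfolding carleson_block_eq[OF assms] using assms by (auto intro!: tentI_polar)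

lemma tent_subset_carleson_block:
  assumes "norm e = 1" "0 < d" "d < 1"
  shows "tent e (d / 2) \<subseteq> carleson_block ((1 - d) *\<^sub>R e)"
proof
  fix w assume w: "w \<in> tent e (d / 2)"
  have "w \<noteq> 0" using w assms by (auto simp: tent_def)
  from tentD_polar[OF w assms(1) this] w show "w \<in> carleson_block ((1 - d) *\<^sub>R e)"
    unfolding carleson_block_eq[OF assms] using assms by (auto simp: tent_def)
qed

text \<open>The engulfing property behind the Vitali covering. The quasi-triangle inequality gives 4
  (d' + d') \<le> 8 d through the centre e', then 4 (8 d + d) = 36 d through w. The size is rounded
  up to 64 d so that six doublings compare the measures.\<close>

lemma tent_absorb:
  assumes e: "norm e = 1" "norm e' = 1" and d: "d' \<le> d" and w: "w \<in> tent e d" "w \<in> tent e' d'"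
  shows "tent e' d' \<subseteq> tent e (64 * d)"
proof
  fix x assume x: "x \<in> tent e' d'"
  have sym: "cmod (1 - hinner e' w) = cmod (1 - hinner w e')"
    by (metis cnj_hinner complex_cnj_diff complex_cnj_one complex_mod_cnj)
  have n: "norm x \<le> 1" "norm w \<le> 1" using x w by (auto simp: tent_def)
  have "cmod (1 - hinner x w) \<le> 4 * (cmod (1 - hinner x e') + cmod (1 - hinner e' w))"
    using n e by (intro hinner_quasi_triangle) auto
  then have "cmod (1 - hinner x w) < 8 * d" using x w d sym by (auto simp: tent_def)
  moreover have "cmod (1 - hinner x e) \<le> 4 * (cmod (1 - hinner x w) + cmod (1 - hinner w e))"
    using n e by (intro hinner_quasi_triangle) auto
  ultimately have "cmod (1 - hinner x e) < 36 * d" using w by (auto simp: tent_def)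
  moreover have "0 < d" using w(1) le_less_trans[OF norm_ge_zero] by (auto simp: tent_def)
  ultimately show "x \<in> tent e (64 * d)" using x by (auto simp: tent_def)
qed

text \<open>The nonisotropic dilation adapted to a tent at e: where 1 - <w,e> has size d, the
  component of a point w of the ball orthogonal to e is at most of order sqrt d. The map is complex
  linear, so composing with it preserves holomorphy.\<close>

definition dil :: "complex ^ 'n::finite \<Rightarrow> real \<Rightarrow> complex ^ 'n \<Rightarrow> complex ^ 'n" where
  "dil e d v = d *\<^sub>R (hinner v e *s e) + sqrt d *\<^sub>R (v - hinner v e *s e)"

lemma smult_scaleR_swap: "c *s (r *\<^sub>R x) = r *\<^sub>R (c *s x)" for x :: "complex ^ 'n::finite"
  by (simp add: vec_eq_iff)

lemma linear_dil: "linear (dil e d)"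
  by (rule linearI)
     (simp_all add: dil_def hinner_add_left hinner_scaleR_left algebra_simps vec_eq_iff scaleR_conv_of_real[where 'a=complex])

lemma dil_smult: "dil e d (c *s v) = c *s dil e d v"
  by (simp add: dil_def hinner_smult_left vec_eq_iff scaleR_conv_of_real[where 'a=complex] algebra_simps)

lemma hinner_dil:
  assumes "norm e = 1"
  shows "hinner (dil e d v) e = of_real d * hinner v e"
  using assms by (simp add: dil_def hinner_add_left hinner_diff_left hinner_scaleR_left hinner_smult_left hinner_self)

lemma dil_perp:
  assumes "norm e = 1"
  shows "dil e d v - hinner (dil e d v) e *s e = sqrt d *\<^sub>R (v - hinner v e *s e)"
  unfolding hinner_dil[OF assms] by (simp add: dil_def vec_eq_iff scaleR_conv_of_real[where 'a=complex])

lemma norm_dil: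
  assumes "norm e = 1" "0 \<le> d"
  shows "(norm (dil e d v))\<^sup>2 = d\<^sup>2 * (cmod (hinner v e))\<^sup>2 + d * (norm (v - hinner v e *s e))\<^sup>2"
proof -
  have "(norm (dil e d v))\<^sup>2 = (cmod (of_real d * hinner v e))\<^sup>2 + (norm (sqrt d *\<^sub>R (v - hinner v e *s e)))\<^sup>2"
    using norm_Pythagoras[OF assms(1), of "dil e d v"] by (simp only: dil_perp[OF assms(1)]) (simp only: hinner_dil[OF assms(1)])
  then show ?thesis using assms by (simp add: norm_mult power_mult_distrib)
qed

lemma dil_dil:
  assumes "norm e = 1" "0 \<le> d" "0 \<le> d'"
  shows "dil e d (dil e d' v) = dil e (d * d') v"
  unfolding dil_def[of e d] dil_perp[OF assms(1)] hinner_dil[OF assms(1)]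
  using assms by (simp add: dil_def real_sqrt_mult vec_eq_iff scaleR_conv_of_real[where 'a=complex] mult_ac)

lemma dil_1: "dil e 1 v = v" by (simp add: dil_def)

lemma bij_dil:
  assumes "norm e = 1" "0 < d"
  shows "bij (dil e d)"
  by (rule o_bij[of "dil e (1 / d)"]) (use assms in \<open>auto simp: fun_eq_iff dil_dil dil_1\<close>)

lemma norm_dil_le:
  assumes "norm e = 1" "1 \<le> d"
  shows "norm (dil e d v) \<le> d * norm v"
proof -
  have "(norm (dil e d v))\<^sup>2 \<le> d\<^sup>2 * (cmod (hinner v e))\<^sup>2 + d\<^sup>2 * (norm (v - hinner v e *s e))\<^sup>2"
    using assms self_le_power[of d 2] by (subst norm_dil) (auto intro!: mult_right_mono)
  also have "\<dots> = (d * norm v)\<^sup>2"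
    using norm_Pythagoras[OF assms(1), of v] by (simp add: power_mult_distrib algebra_simps)
  finally show ?thesis using assms by (simp add: power2_le_iff_abs_le)
qed

text \<open>The Jacobian of the dilation. Its value \<open>d ^ (n + 1)\<close> is never needed, only its doubling property.\<close>

definition dil_vol :: "complex ^ 'n::finite \<Rightarrow> real \<Rightarrow> real" where
  "dil_vol e d = (SOME c. c > 0 \<and> distr lborel borel (dil e d) = density lborel (\<lambda>_. ennreal (1 / c)))"

lemma dil_vol:
  assumes "norm e = 1" "0 < d"
  shows "dil_vol e d > 0" "distr lborel borel (dil e d) = density lborel (\<lambda>_. ennreal (1 / dil_vol e d))"
proof -
  obtain c where "c > 0" "distr lborel borel (dil e d) = density lborel (\<lambda>_. ennreal c)"
    using distr_lborel_linear[OF linear_dil bij_dil[OF assms]] by blast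
  then have "\<exists>c>0. distr lborel borel (dil e d) = density lborel (\<lambda>_. ennreal (1 / c))"
    by (intro exI[of _ "1 / c"]) auto
  from someI_ex[OF this] show "dil_vol e d > 0" "distr lborel borel (dil e d) = density lborel (\<lambda>_. ennreal (1 / dil_vol e d))"
    by (auto simp: dil_vol_def)
qed

lemma distr_affine_dil:
  fixes e :: "complex ^ 'n::finite"
  assumes e: "norm e = 1" "0 < d" and c: "0 < c"
  shows "distr lborel borel (\<lambda>v. z + c *\<^sub>R dil e d v)
    = density lborel (\<lambda>_. ennreal (1 / (c ^ DIM(complex ^ 'n) * dil_vol e d)))"
proof -
  let ?n = "DIM(complex ^ 'n)"
  note [measurable] = borel_measurable_linear[OF linear_dil]
  have aff: "distr lborel borel (\<lambda>y::complex^'n. z + c *\<^sub>R y) = density lborel (\<lambda>_. ennreal (1 / c ^ ?n))"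
  proof -
    have "density lborel (\<lambda>_. ennreal (1 / c ^ ?n)) = density (density (distr lborel borel (\<lambda>y::complex^'n. z + c *\<^sub>R y)) (\<lambda>_. ennreal (\<bar>c\<bar> ^ ?n))) (\<lambda>_. ennreal (1 / c ^ ?n))"
      using c by (subst lborel_affine[of c z]) auto
    also have "\<dots> = distr lborel borel (\<lambda>y. z + c *\<^sub>R y)"
      using c by (simp add: density_density_eq ennreal_mult'[symmetric] density_1)
    finally show ?thesis ..
  qed
  have "distr lborel borel (\<lambda>v. z + c *\<^sub>R dil e d v) = distr (distr lborel borel (dil e d)) borel (\<lambda>y. z + c *\<^sub>R y)"
    by (subst distr_distr) (auto simp: o_def)
  also have "\<dots> = density (distr lborel borel (\<lambda>y. z + c *\<^sub>R y)) (\<lambda>_. ennreal (1 / dil_vol e d))"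
    unfolding dil_vol(2)[OF e] using density_distr[of "\<lambda>_. ennreal (1 / dil_vol e d)" borel "\<lambda>y. z + c *\<^sub>R y" lborel] by auto
  also have "\<dots> = density lborel (\<lambda>_. ennreal (1 / (c ^ ?n * dil_vol e d)))"
    unfolding aff using c dil_vol(1)[OF e] by (simp add: density_density_eq ennreal_mult'[symmetric])
  finally show ?thesis .
qed

definition ellipsoid :: "complex ^ 'n::finite \<Rightarrow> real \<Rightarrow> real \<Rightarrow> complex ^ 'n \<Rightarrow> (complex ^ 'n) set" where
  "ellipsoid e d c z = (\<lambda>v. z + c *\<^sub>R dil e d v) ` ball 0 1"

lemma mem_ellipsoid_iff:
  assumes "norm e = 1" "0 < d" "0 < c"
  shows "w \<in> ellipsoid e d c z \<longleftrightarrow> norm (dil e (1 / d) ((w - z) /\<^sub>R c)) < 1"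
proof
  assume "w \<in> ellipsoid e d c z"
  then obtain v where "norm v < 1" "w = z + c *\<^sub>R dil e d v" by (auto simp: ellipsoid_def)
  then show "norm (dil e (1 / d) ((w - z) /\<^sub>R c)) < 1" using assms by (simp add: dil_dil dil_1)
next
  assume *: "norm (dil e (1 / d) ((w - z) /\<^sub>R c)) < 1"
  have eq: "w = z + c *\<^sub>R dil e d (dil e (1 / d) ((w - z) /\<^sub>R c))" using assms by (simp add: dil_dil dil_1)
  show "w \<in> ellipsoid e d c z" unfolding ellipsoid_def
    by (rule image_eqI[where x="dil e (1 / d) ((w - z) /\<^sub>R c)"], rule eq) (use * in simp)
qed

lemma sets_ellipsoid [measurable]:
  assumes "norm e = 1" "0 < d" "0 < c"
  shows "ellipsoid e d c z \<in> sets borel"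
proof -
  note [measurable] = borel_measurable_linear[OF linear_dil]
  have "ellipsoid e d c z = {w. norm (dil e (1 / d) ((w - z) /\<^sub>R c)) < 1}"
    using mem_ellipsoid_iff[OF assms] by blast
  then show ?thesis by simp
qed

lemma nn_integral_ellipsoid:
  fixes e :: "complex ^ 'n::finite"
  assumes e: "norm e = 1" "0 < d" and c: "0 < c" and [measurable]: "F \<in> borel_measurable borel"
  shows "(\<integral>\<^sup>+w. F w * indicator (ellipsoid e d c z) w \<partial>lborel)
    = ennreal (c ^ DIM(complex ^ 'n) * dil_vol e d) * (\<integral>\<^sup>+v. F (z + c *\<^sub>R dil e d v) * indicator (ball 0 1) v \<partial>lborel)"
proof -
  let ?k = "c ^ DIM(complex ^ 'n) * dil_vol e d"
  have k: "?k > 0" using c dil_vol(1)[OF e] by simp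
  note [measurable] = borel_measurable_linear[OF linear_dil] sets_ellipsoid[OF e c]
  have ind: "indicator (ellipsoid e d c z) (z + c *\<^sub>R dil e d v) = (indicator (ball 0 1) v :: ennreal)" for v
    using e c by (simp add: mem_ellipsoid_iff dil_dil dil_1 indicator_def)
  have "(\<integral>\<^sup>+v. F (z + c *\<^sub>R dil e d v) * indicator (ball 0 1) v \<partial>lborel)
    = (\<integral>\<^sup>+w. F w * indicator (ellipsoid e d c z) w \<partial>distr lborel borel (\<lambda>v. z + c *\<^sub>R dil e d v))"
    by (subst nn_integral_distr) (auto simp: ind)
  also have "\<dots> = ennreal (1 / ?k) * (\<integral>\<^sup>+w. F w * indicator (ellipsoid e d c z) w \<partial>lborel)"
    unfolding distr_affine_dil[OF e c] by (subst nn_integral_density) (auto simp: nn_integral_cmult)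
  finally have "ennreal ?k * (\<integral>\<^sup>+v. F (z + c *\<^sub>R dil e d v) * indicator (ball 0 1) v \<partial>lborel)
    = ennreal (?k * (1 / ?k)) * (\<integral>\<^sup>+w. F w * indicator (ellipsoid e d c z) w \<partial>lborel)"
    using k by (simp only: mult.assoc[symmetric] ennreal_mult''[OF less_imp_le, OF divide_pos_pos[OF zero_less_one k]])
  moreover have "?k * (1 / ?k) = 1" using k by (metis less_irrefl right_inverse inverse_eq_divide)
  ultimately show ?thesis by (simp only: ennreal_1 mult_1_left)
qed

lemma emeasure_ellipsoid:
  fixes e :: "complex ^ 'n::finite"
  assumes e: "norm e = 1" "0 < d" and c: "0 < c"
  shows "emeasure lborel (ellipsoid e d c z) = ennreal (c ^ DIM(complex ^ 'n) * dil_vol e d) * emeasure lborel (ball (0 :: complex ^ 'n) 1)"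
  using nn_integral_ellipsoid[OF assms, of "\<lambda>_. 1" z] sets_ellipsoid[OF assms, of z] by simp

text \<open>Since \<open>dil e 2\<close> at most doubles norms, the ellipsoid of scale 2 d lies in
  the doubled ellipsoid of scale d; comparing volumes costs 2 to the real dimension.\<close>

lemma dil_vol_double_le:
  fixes e :: "complex ^ 'n::finite"
  assumes e: "norm e = 1" and d: "0 < d"
  shows "dil_vol e (2 * d) \<le> 2 ^ DIM(complex ^ 'n) * dil_vol e d"
proof -
  have "ellipsoid e (2 * d) 1 0 \<subseteq> ellipsoid e d 2 0"
  proof
    fix w assume "w \<in> ellipsoid e (2 * d) 1 0"
    then obtain v where v: "norm v < 1" "w = dil e (2 * d) v" by (auto simp: ellipsoid_def)
    have "dil e (1 / d) (w /\<^sub>R 2) = dil e 2 v /\<^sub>R 2"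
      using e d v by (simp add: linear_cmul[OF linear_dil] dil_dil)
    then show "w \<in> ellipsoid e d 2 0" using norm_dil_le[OF e, of 2 v] e d v by (simp add: mem_ellipsoid_iff)
  qed
  then have "emeasure lborel (ellipsoid e (2 * d) 1 0) \<le> emeasure lborel (ellipsoid e d 2 0)"
    using e d by (intro emeasure_mono) auto
  moreover have "emeasure lborel (ball (0 :: complex ^ 'n) 1) = ennreal (measure lborel (ball (0 :: complex ^ 'n) 1))"
    by (rule emeasure_eq_ennreal_measure) (use emeasure_lborel_unit_ball(2) in \<open>auto simp: less_top\<close>)
  ultimately have "ennreal (dil_vol e (2 * d) * measure lborel (ball (0 :: complex ^ 'n) 1))
    \<le> ennreal (2 ^ DIM(complex ^ 'n) * dil_vol e d * measure lborel (ball (0 :: complex ^ 'n) 1))"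
    using e d by (simp only: emeasure_ellipsoid[OF e] mult_pos_pos zero_less_numeral zero_less_one power_one mult_1_left
        ennreal_mult''[OF measure_nonneg])
  then have "dil_vol e (2 * d) * measure lborel (ball (0 :: complex ^ 'n) 1)
    \<le> 2 ^ DIM(complex ^ 'n) * dil_vol e d * measure lborel (ball (0 :: complex ^ 'n) 1)"
    using dil_vol(1)[OF e d] by (subst (asm) ennreal_le_iff) auto
  then show ?thesis using content_ball_pos[of 1 "0 :: complex ^ 'n"] by simp
qed

section \<open>Measures of spherical caps\<close>

definition cap_measure :: "complex ^ 'n::finite \<Rightarrow> real \<Rightarrow> real" where
  "cap_measure e d = measure sphere_measure {z. cmod (1 - hinner z e) < d}"

lemma measure_polar_sector:
  fixes E :: "'a::euclidean_space set"
  assumes [measurable]: "E \<in> sets borel"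
  shows "measure unif_ball {w. x < norm w \<and> sgn w \<in> E} = (1 - clamp_pow (DIM('a)) x) * measure sphere_measure E"
proof -
  have "measure sphere_measure E = measure unif_ball {w::'a. sgn w \<in> E}"
    unfolding sphere_measure_def by (subst measure_distr) (auto simp: vimage_def)
  then show ?thesis by (simp add: measure_unif_ball_cone_greater)
qed

lemma clamp_pow_bounds:
  assumes "0 \<le> d" "d \<le> 1" "0 < n"
  shows "d \<le> 1 - clamp_pow n (1 - d)"
proof -
  have "(1 - d) ^ n \<le> (1 - d) ^ 1" using assms by (intro power_decreasing) auto
  then show ?thesis using assms by (auto simp: clamp_pow_def)
qed

lemma clamp_pow_upper:
  assumes "0 \<le> d" "0 < n"
  shows "1 - clamp_pow n (1 - d) \<le> real n * d"
proof (cases "d < 1")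
  case True
  have "1 + real n * (- d) \<le> (1 + (- d)) ^ n" using True by (intro Bernoulli_inequality) auto
  then show ?thesis using True assms by (auto simp: clamp_pow_def)
next
  case False
  have "1 * 1 \<le> real n * d" using False assms by (intro mult_mono) auto
  then show ?thesis using False by (simp add: clamp_pow_def)
qed

lemma measure_unif_ball_eq:
  fixes E :: "'a::euclidean_space set"
  shows "E \<in> sets borel \<Longrightarrow> measure unif_ball E = measure lborel (ball 0 1 \<inter> E) / measure lborel (ball (0::'a) 1)"
  unfolding unif_ball_def using emeasure_lborel_unit_ball by (subst measure_uniform_measure) (auto simp: less_top)

lemma measure_ellipsoid:
  fixes e :: "complex ^ 'n::finite"
  assumes "norm e = 1" "0 < d" "0 < c"
  shows "measure lborel (ellipsoid e d c z) = c ^ DIM(complex ^ 'n) * dil_vol e d * measure lborel (ball (0 :: complex ^ 'n) 1)"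
  using emeasure_ellipsoid[OF assms, of z] dil_vol(1)[OF assms(1,2)] assms
  by (simp add: measure_def enn2real_mult)

lemma finite_ellipsoid:
  fixes e :: "complex ^ 'n::finite"
  assumes "norm e = 1" "0 < d" "0 < c"
  shows "emeasure lborel (ellipsoid e d c z) < \<infinity>"
  unfolding emeasure_ellipsoid[OF assms] using emeasure_lborel_unit_ball(2)[where 'a="complex ^ 'n"]
  by (simp add: ennreal_mult_less_top)

lemma measure_unif_ball_le_ellipsoid:
  fixes e :: "complex ^ 'n::finite"
  assumes e: "norm e = 1" "0 < d" "0 < c" and X: "X \<in> sets borel" "ball 0 1 \<inter> X \<subseteq> ellipsoid e d c z"
  shows "measure unif_ball X \<le> c ^ DIM(complex ^ 'n) * dil_vol e d"
proof -
  have "measure lborel (ball 0 1 \<inter> X) \<le> measure lborel (ellipsoid e d c z)"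
    using X finite_ellipsoid[OF e, of z] sets_ellipsoid[OF e, of z] by (intro measure_mono_fmeasurable) (auto simp: fmeasurable_def)
  then show ?thesis using X content_ball_pos[of 1 "0 :: complex ^ 'n"]
    by (simp add: measure_unif_ball_eq measure_ellipsoid[OF e] divide_simps)
qed

lemma measure_unif_ball_ellipsoid:
  fixes e :: "complex ^ 'n::finite"
  assumes e: "norm e = 1" "0 < d" "0 < c" and X: "ellipsoid e d c z \<subseteq> ball 0 1"
  shows "measure unif_ball (ellipsoid e d c z) = c ^ DIM(complex ^ 'n) * dil_vol e d"
proof -
  have "ball 0 1 \<inter> ellipsoid e d c z = ellipsoid e d c z" using X by auto
  then show ?thesis using content_ball_pos[of 1 "0 :: complex ^ 'n"]
    by (simp add: measure_unif_ball_eq[OF sets_ellipsoid[OF e]] measure_ellipsoid[OF e])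
qed

text \<open>The centre lies at depth h on the axis of e. A point of the ellipsoid is displaced by at
  most c d along e and c sqrt d across, so a small c keeps ellipsoids of scale comparable to h
  inside the ball.\<close>

lemma ellipsoid_bounds:
  assumes e: "norm e = 1" "0 < d" "0 < c" and h: "h \<le> 1" "0 \<le> h" and w: "w \<in> ellipsoid e d c ((1 - h) *\<^sub>R e)"
  shows "cmod (1 - hinner w e) \<le> h + c * d" "(norm w)\<^sup>2 \<le> (1 - h + c * d)\<^sup>2 + c\<^sup>2 * d"
proof -
  obtain v where v: "norm v < 1" "w = (1 - h) *\<^sub>R e + c *\<^sub>R dil e d v" using w by (auto simp: ellipsoid_def)
  have we: "hinner w e = of_real (1 - h) + of_real (c * d) * hinner v e"
    using e by (simp add: v hinner_add_left hinner_scaleR_left hinner_self hinner_dil)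
  have perp: "w - hinner w e *s e = (c * sqrt d) *\<^sub>R (v - hinner v e *s e)"
  proof -
    have "w - (of_real (1 - h) + of_real (c * d) * hinner v e) *s e = c *\<^sub>R (dil e d v - (of_real d * hinner v e) *s e)"
      unfolding v(2)
      by (simp add: vec_eq_iff scaleR_conv_of_real[where 'a=complex] algebra_simps)
    then have "w - hinner w e *s e = c *\<^sub>R (dil e d v - hinner (dil e d v) e *s e)"
      by (simp only: we hinner_dil[OF e(1)])
    then show ?thesis by (simp add: dil_perp[OF e(1)])
  qed
  have ve: "cmod (hinner v e) \<le> 1" using hinner_Cauchy_Schwarz[of v e] e v by simp
  have cd: "0 \<le> c * d" using e by simp
  have "cmod (of_real (c * d) * hinner v e) \<le> c * d"
    unfolding norm_mult norm_of_real abs_of_nonneg[OF cd] using ve cd by (metis mult_left_le)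
  then have b: "cmod (of_real (c * d) * hinner v e) \<le> c * d" .
  have "1 - hinner w e = of_real h - of_real (c * d) * hinner v e" by (simp add: we)
  then have "cmod (1 - hinner w e) \<le> cmod (of_real h) + cmod (of_real (c * d) * hinner v e)"
    by (simp only: norm_triangle_ineq4)
  then show "cmod (1 - hinner w e) \<le> h + c * d" using b h by simp
  have "cmod (hinner w e) \<le> cmod (of_real (1 - h)) + cmod (of_real (c * d) * hinner v e)"
    unfolding we by (rule norm_triangle_ineq)
  then have 1: "cmod (hinner w e) \<le> 1 - h + c * d" proof -
    have "cmod (of_real (1 - h)) = 1 - h" using h by (simp only: norm_of_real abs_of_nonneg diff_ge_0_iff_ge)
    then show "cmod (hinner w e) \<le> 1 - h + c * d"
      using b \<open>cmod (hinner w e) \<le> cmod (of_real (1 - h)) + _\<close> by linarith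
  qed
  have "(norm (v - hinner v e *s e))\<^sup>2 \<le> (norm v)\<^sup>2" using norm_Pythagoras[OF e(1), of v] by simp
  also have "\<dots> \<le> 1" using v by (simp add: power_le_one)
  finally have "c\<^sup>2 * d * (norm (v - hinner v e *s e))\<^sup>2 \<le> c\<^sup>2 * d * 1" using e by (intro mult_left_mono) auto
  moreover have "(cmod (hinner w e))\<^sup>2 \<le> (1 - h + c * d)\<^sup>2" using 1 by (intro power_mono) auto
  moreover have "(norm w)\<^sup>2 = (cmod (hinner w e))\<^sup>2 + c\<^sup>2 * d * (norm (v - hinner v e *s e))\<^sup>2"
    using e by (simp add: norm_Pythagoras[OF e(1), of w] perp power_mult_distrib)
  ultimately show "(norm w)\<^sup>2 \<le> (1 - h + c * d)\<^sup>2 + c\<^sup>2 * d" by linarith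
qed

text \<open>The sector over a cap of size \<open>d\<close> within the collar \<open>1 - d < \<bar>w\<bar> < 1\<close> is comparable to an ellipsoid, so that the
  measure of the cap is comparable to \<open>dil_vol e d / d\<close>.\<close>

lemma cap_measure_upper:
  fixes e :: "complex ^ 'n::finite"
  assumes e: "norm e = 1" and d: "0 < d" "d \<le> 1"
  shows "cap_measure e d * d \<le> 3 ^ DIM(complex ^ 'n) * dil_vol e d"
proof -
  let ?E = "{z. cmod (1 - hinner z e) < d}" and ?n = "DIM(complex ^ 'n)"
  \<comment> \<open>After the inverse dilation, w - e has squared norm at most 4 from the direction
    e and at most 4 from the orthogonal one; 8 < 9 explains the factor 3.\<close>
  have "ball 0 1 \<inter> {w. 1 - d < norm w \<and> sgn w \<in> ?E} \<subseteq> ellipsoid e d 3 e"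
  proof
    fix w assume "w \<in> ball 0 1 \<inter> {w. 1 - d < norm w \<and> sgn w \<in> ?E}"
    then have w: "norm w < 1" "1 - d < norm w" "cmod (1 - hinner (sgn w) e) < d" by auto
    have w0: "w \<noteq> 0" using w d by auto
    have we: "cmod (1 - hinner w e) < 2 * d"
      using one_minus_hinner_sgn(2)[of w e] w w0 e by simp
    let ?u = "w - e"
    have ue: "hinner ?u e = hinner w e - 1" using e by (simp add: hinner_diff_left hinner_self)
    have perp: "?u - hinner ?u e *s e = w - hinner w e *s e"
      unfolding ue by (simp add: vec_eq_iff algebra_simps)
    have "1 - cmod (hinner w e) \<le> cmod (1 - hinner w e)" using norm_triangle_ineq2[of 1 "hinner w e"] by simp
    then have lo: "1 - cmod (hinner w e) < 2 * d" using we by simp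
    have "(norm w)\<^sup>2 \<le> 1" using w by (simp add: power_le_one)
    then have "(norm (w - hinner w e *s e))\<^sup>2 \<le> 1 - (cmod (hinner w e))\<^sup>2"
      using norm_Pythagoras[OF e, of w] by simp
    also have "\<dots> \<le> 2 * (1 - cmod (hinner w e))"
      using zero_le_power2[of "1 - cmod (hinner w e)"] by (simp add: power2_eq_square algebra_simps)
    finally have p: "(norm (w - hinner w e *s e))\<^sup>2 \<le> 4 * d" using lo by simp
    have "(norm (dil e (1 / d) (?u /\<^sub>R 3)))\<^sup>2 = (norm (dil e (1 / d) ?u))\<^sup>2 / 9"
      by (simp add: linear_cmul[OF linear_dil] power_divide)
    also have "(norm (dil e (1 / d) ?u))\<^sup>2 = (cmod (1 - hinner w e))\<^sup>2 / d\<^sup>2 + (norm (w - hinner w e *s e))\<^sup>2 / d"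
      using e d by (simp only: norm_dil[OF e] perp divide_nonneg_nonneg) (simp add: norm_dil perp ue power_divide norm_minus_commute)
    also have "\<dots> \<le> (2 * d)\<^sup>2 / d\<^sup>2 + 4 * d / d"
      using we p d by (intro add_mono divide_right_mono power_mono) auto
    also have "\<dots> = 8" using d by (simp add: power2_eq_square)
    finally have "(norm (dil e (1 / d) (?u /\<^sub>R 3)))\<^sup>2 < 1\<^sup>2" by simp
    then have "norm (dil e (1 / d) (?u /\<^sub>R 3)) < 1" by (rule power2_less_imp_less) simp
    then show "w \<in> ellipsoid e d 3 e" using e d by (simp add: mem_ellipsoid_iff)
  qed
  then have "measure unif_ball {w. 1 - d < norm w \<and> sgn w \<in> ?E} \<le> 3 ^ ?n * dil_vol e d"
    using e d by (intro measure_unif_ball_le_ellipsoid) auto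
  then have "(1 - clamp_pow ?n (1 - d)) * cap_measure e d \<le> 3 ^ ?n * dil_vol e d"
    by (subst (asm) measure_polar_sector) (auto simp: cap_measure_def)
  moreover have "d * cap_measure e d \<le> (1 - clamp_pow ?n (1 - d)) * cap_measure e d"
    using d by (intro mult_right_mono clamp_pow_bounds) (auto simp: cap_measure_def)
  ultimately show ?thesis by (simp add: mult.commute)
qed

lemma cap_measure_lower:
  fixes e :: "complex ^ 'n::finite"
  assumes e: "norm e = 1" and d: "0 < d" "d \<le> 1"
  shows "(1 / 8) ^ DIM(complex ^ 'n) * dil_vol e d \<le> cap_measure e d * (real DIM(complex ^ 'n) * d)"
proof -
  let ?E = "{z. cmod (1 - hinner z e) < d}" and ?n = "DIM(complex ^ 'n)"
  \<comment> \<open>Depth d/4 and factor 1/8: every point has |1 - <w,e>| \<le> 3d/8 < d/2, and (1 -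
    d/8)^2 + d/64 < 1 for d \<le> 1, so the ellipsoid stays in the ball and inside the tent of size
    d/2.\<close>
  let ?L = "ellipsoid e d (1 / 8) ((1 - d / 4) *\<^sub>R e)"
  have L: "norm w < 1" "1 - d / 2 < norm w" "cmod (1 - hinner (sgn w) e) < d" if w: "w \<in> ?L" for w
  proof -
    have 1: "cmod (1 - hinner w e) \<le> d / 4 + 1 / 8 * d" "(norm w)\<^sup>2 \<le> (1 - d / 4 + 1 / 8 * d)\<^sup>2 + (1 / 8)\<^sup>2 * d"
      using ellipsoid_bounds[OF e d(1) _ _ _ w] d by auto
    have "d * d \<le> d * 1" using d by (intro mult_left_mono) auto
    then have "(1 - d / 4 + 1 / 8 * d)\<^sup>2 + (1 / 8)\<^sup>2 * d < 1"
      using d by (simp add: power2_eq_square algebra_simps)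
    then have "(norm w)\<^sup>2 < 1\<^sup>2" using 1 by simp
    then show n1: "norm w < 1" by (rule power2_less_imp_less) simp
    then have t: "w \<in> tent e (d / 2)" using 1 d by (simp add: tent_def)
    have "1 - norm w \<le> cmod (1 - hinner w e)" by (rule one_minus_norm_le[OF e])
    then have "w \<noteq> 0" using 1 d by auto
    from tentD_polar[OF t e this] show "1 - d / 2 < norm w" "cmod (1 - hinner (sgn w) e) < d" by auto
  qed
  have "(1 / 8) ^ ?n * dil_vol e d = measure unif_ball ?L"
    using e d L(1) by (intro measure_unif_ball_ellipsoid[symmetric]) auto
  also have "\<dots> \<le> measure unif_ball {w. 1 - d / 2 < norm w \<and> sgn w \<in> ?E}"
    using L e d by (intro unif_ball.finite_measure_mono) auto
  also have "\<dots> = (1 - clamp_pow ?n (1 - d / 2)) * cap_measure e d"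
    by (subst measure_polar_sector) (auto simp: cap_measure_def)
  also have "\<dots> \<le> (real ?n * (d / 2)) * cap_measure e d"
    using d by (intro mult_right_mono clamp_pow_upper) (auto simp: cap_measure_def)
  also have "\<dots> \<le> cap_measure e d * (real ?n * d)"
    using d by (simp add: cap_measure_def mult_nonneg_nonneg)
  finally show ?thesis .
qed

lemma cap_measure_mono: "d \<le> d' \<Longrightarrow> cap_measure e d \<le> cap_measure e d'"
  unfolding cap_measure_def by (rule sphere_measure.finite_measure_mono) auto

lemma cap_measure_le_1: "cap_measure e d \<le> 1"
  unfolding cap_measure_def by simp

lemma cap_measure_double:
  "\<exists>C>0. \<forall>(e :: complex ^ 'n::finite) d. norm e = 1 \<longrightarrow> 0 < d \<longrightarrow> cap_measure e (2 * d) \<le> C * cap_measure e d"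
proof -
  let ?n = "DIM(complex ^ 'n)"
  define C where "C = real ?n * 8 ^ ?n * 6 ^ ?n"
  have small: "cap_measure e (2 * d) \<le> C * cap_measure e d" if e: "norm e = 1" and d: "0 < d" "d \<le> 1 / 2" for e :: "complex ^ 'n" and d
  proof -
    have D: "dil_vol e d \<le> 8 ^ ?n * (cap_measure e d * (real ?n * d))"
      using cap_measure_lower[OF e d(1)] d by (simp add: power_divide divide_simps mult_ac)
    have "cap_measure e (2 * d) * (2 * d) \<le> 3 ^ ?n * dil_vol e (2 * d)"
      using d by (intro cap_measure_upper e) auto
    also have "\<dots> \<le> 3 ^ ?n * (2 ^ ?n * dil_vol e d)"
      using d by (intro mult_left_mono dil_vol_double_le e) auto
    also have "\<dots> = 6 ^ ?n * dil_vol e d"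
      using power_mult_distrib[of "3::real" 2 ?n] by simp
    also have "\<dots> \<le> 6 ^ ?n * (8 ^ ?n * (cap_measure e d * (real ?n * d)))"
      using D by (intro mult_left_mono) auto
    also have "\<dots> = C * cap_measure e d * d" by (simp add: C_def)
    finally have "cap_measure e (2 * d) * 2 \<le> C * cap_measure e d" using d by simp
    moreover have "0 \<le> cap_measure e (2 * d)" by (simp add: cap_measure_def)
    ultimately show ?thesis by simp
  qed
  define C' where "C' = C + 8 ^ ?n * ?n * 2 ^ ?n"
  have C: "C > 0" by (simp add: C_def)
  show ?thesis
  proof (intro exI[of _ C'] conjI allI impI)
    show "C' > 0" unfolding C'_def by (rule add_pos_nonneg[OF C]) simp
    fix e :: "complex ^ 'n" and d :: real
    assume e: "norm e = 1" and d: "0 < d"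
    have nn: "0 \<le> cap_measure e d" by (simp add: cap_measure_def)
    show "cap_measure e (2 * d) \<le> C' * cap_measure e d"
    proof (cases "d \<le> 1 / 2")
      case True
      show ?thesis using small[OF e d True] nn by (simp add: C'_def algebra_simps add_increasing2)
    next
      case False
      \<comment> \<open>Caps have measure at most 1, so for radii above 1/2 a lower bound uniform in
        e is enough. It is anchored at scale 1, where the dilation is the identity, and carried to
        1/2 by the doubling of \<open>dil_vol\<close>.\<close>
      have "dil_vol e 1 = 1"
      proof -
        have "measure unif_ball (ellipsoid e 1 1 0) = 1 ^ ?n * dil_vol e 1"
          by (rule measure_unif_ball_ellipsoid) (auto simp: e ellipsoid_def dil_1)
        moreover have "ellipsoid e 1 1 0 = ball 0 1" by (auto simp: ellipsoid_def dil_1)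
        moreover have "measure unif_ball (ball (0 :: complex ^ 'n) 1) = 1"
          using content_ball_pos[of 1 "0 :: complex ^ 'n"] by (simp add: measure_unif_ball_eq)
        ultimately show ?thesis by simp
      qed
      then have "1 \<le> 2 ^ ?n * dil_vol e (1 / 2)" using dil_vol_double_le[OF e, of "1 / 2"] by simp
      moreover have "dil_vol e (1 / 2) \<le> 8 ^ ?n * (cap_measure e (1 / 2) * (real ?n * (1 / 2)))"
        using cap_measure_lower[OF e, of "1 / 2"] by (simp add: power_divide divide_simps mult_ac)
      ultimately have "1 \<le> 2 ^ ?n * (8 ^ ?n * (cap_measure e (1 / 2) * (real ?n * (1 / 2))))"
        by (smt (verit, best) mult_left_mono zero_le_power)
      also have "\<dots> \<le> 2 ^ ?n * (8 ^ ?n * (cap_measure e d * (real ?n * 1)))"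
        using False by (intro mult_left_mono mult_mono cap_measure_mono) (auto simp: nn)
      also have "\<dots> \<le> C' * cap_measure e d" using C nn by (simp add: C'_def algebra_simps)
      finally show ?thesis using cap_measure_le_1[of e "2 * d"] by simp
    qed
  qed
qed

section \<open>Spherical means and point evaluation\<close>

text \<open>Extension by zero makes \<open>\<bar>F\<bar> powr s\<close> Borel measurable on the whole space.\<close>

definition ball_powr :: "real \<Rightarrow> (complex ^ 'n::finite \<Rightarrow> complex) \<Rightarrow> complex ^ 'n \<Rightarrow> ennreal" where
  "ball_powr s F w = ennreal (cmod (F w) powr s) * indicator (ball 0 1) w"

lemma holomorphic_on_ball_continuous: "holomorphic_on_ball F \<Longrightarrow> continuous_on (ball 0 1) F"
  unfolding holomorphic_on_ball_def
  by (intro differentiable_imp_continuous_on) (metis differentiable_def differentiable_on_def has_derivative_at_withinI)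

lemma borel_measurable_ball_powr [measurable]:
  fixes F :: "complex ^ 'n::finite \<Rightarrow> complex"
  assumes "holomorphic_on_ball F"
  shows "ball_powr s F \<in> borel_measurable borel"
proof -
  have [measurable]: "ball (0 :: complex ^ 'n) 1 \<in> sets borel" by simp
  define g where "g = (\<lambda>w. indicat_real (ball 0 1) w *\<^sub>R F w)"
  have [measurable]: "g \<in> borel_measurable borel"
    unfolding g_def using borel_measurable_continuous_on_indicator[OF _ holomorphic_on_ball_continuous[OF assms]] by simp
  have "ball_powr s F = (\<lambda>w. ennreal (cmod (g w) powr s) * indicator (ball 0 1) w)"
    by (auto simp: ball_powr_def g_def fun_eq_iff indicator_def)
  moreover have "(\<lambda>w. ennreal (cmod (g w) powr s) * indicator (ball 0 1) w) \<in> borel_measurable borel"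
    by measurable
  ultimately show ?thesis by simp
qed

lemma continuous_on_smult_vec [continuous_intros]:
  fixes g :: "'a::topological_space \<Rightarrow> complex ^ 'n::finite"
  shows "continuous_on A f \<Longrightarrow> continuous_on A g \<Longrightarrow> continuous_on A (\<lambda>x. f x *s g x)"
  unfolding vector_scalar_mult_def by (intro continuous_intros continuous_on_vec_lambda)

lemma norm_smult_vec: "norm (c *s z) = cmod c * norm z" for z :: "complex ^ 'n::finite"
  by (simp add: norm_vec_def L2_set_def norm_mult power_mult_distrib sum_distrib_left[symmetric] real_sqrt_mult)

lemma has_derivative_smult_line: "((\<lambda>l. l *s w) has_derivative (\<lambda>l. l *s w)) F" for w :: "complex ^ 'n::finite"
proof (rule bounded_linear_imp_has_derivative)
  show "bounded_linear (\<lambda>l. l *s w)"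
    by (intro linear_conv_bounded_linear[THEN iffD1] linearI) (simp_all add: vec_eq_iff algebra_simps)
qed

lemma holomorphic_on_line:
  fixes F :: "complex ^ 'n::finite \<Rightarrow> complex"
  assumes F: "holomorphic_on_ball F" and S: "open S" "\<And>l. l \<in> S \<Longrightarrow> norm (a + l *s b) < 1"
  shows "(\<lambda>l. F (a + l *s b)) holomorphic_on S"
proof (subst holomorphic_on_open[OF S(1)], safe)
  fix l assume l: "l \<in> S"
  have "a + l *s b \<in> ball 0 1" using S(2)[OF l] by simp
  then obtain F' where F': "(F has_derivative F') (at (a + l *s b))" "\<And>c v. F' (c *s v) = c * F' v"
    using F unfolding holomorphic_on_ball_def by blast
  have "((\<lambda>l. a + l *s b) has_derivative (\<lambda>l. 0 + l *s b)) (at l)"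
    by (intro has_derivative_add has_derivative_const has_derivative_smult_line)
  from diff_chain_at[OF this F'(1)] have "((\<lambda>l. F (a + l *s b)) has_derivative (\<lambda>l. F' b * l)) (at l)"
    by (simp add: o_def F'(2) mult.commute)
  then show "\<exists>f'. ((\<lambda>l. F (a + l *s b)) has_field_derivative f') (at l)"
    unfolding has_field_derivative_def by blast
qed

lemma holomorphic_on_ball_dil:
  fixes F :: "complex ^ 'n::finite \<Rightarrow> complex"
  assumes F: "holomorphic_on_ball F" and sub: "ellipsoid e d c z \<subseteq> ball 0 1"
  shows "holomorphic_on_ball (\<lambda>v. F (z + c *\<^sub>R dil e d v))"
  unfolding holomorphic_on_ball_def
proof
  fix v :: "complex ^ 'n" assume "v \<in> ball 0 1"
  then have "z + c *\<^sub>R dil e d v \<in> ball 0 1" using sub unfolding ellipsoid_def image_subset_iff by blast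
  then obtain F' where F': "(F has_derivative F') (at (z + c *\<^sub>R dil e d v))" "\<And>c v. F' (c *s v) = c * F' v"
    using F unfolding holomorphic_on_ball_def by blast
  have "((\<lambda>v. z + c *\<^sub>R dil e d v) has_derivative (\<lambda>v. 0 + c *\<^sub>R dil e d v)) (at v)"
    by (intro has_derivative_add has_derivative_const has_derivative_scaleR_right bounded_linear_imp_has_derivative
        linear_conv_bounded_linear[THEN iffD1] linear_dil)
  from diff_chain_at[OF this F'(1)]
  show "\<exists>f'. ((\<lambda>v. F (z + c *\<^sub>R dil e d v)) has_derivative f') (at v) \<and> (\<forall>c v. f' (c *s v) = c * f' v)"
    by (intro exI[of _ "F' \<circ> (\<lambda>v. 0 + c *\<^sub>R dil e d v)"]) (auto simp: o_def dil_smult F'(2) smult_scaleR_swap[symmetric])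
qed

lemma nn_integral_poisson_le:
  assumes "h holomorphic_on ball 0 R" "1 < R" "0 \<le> t" "t < 1" "0 < s"
  shows "ennreal (cmod (h (of_real t)) powr s)
    \<le> (\<integral>\<^sup>+x. indicator {0..1} x * ennreal (poisson_kernel t x) * ennreal (cmod (h (cis (2 * pi * x))) powr s) \<partial>lborel)"
proof -
  have conts: "continuous_on (sphere 0 1) h"
    using assms by (intro holomorphic_on_imp_continuous_on holomorphic_on_subset[OF assms(1)]) auto
  have contc: "continuous_on A (\<lambda>x::real. h (cis (2 * pi * x)))" for A
    by (rule continuous_on_compose2[OF conts]) (auto intro!: continuous_intros)
  let ?g = "\<lambda>x. poisson_kernel t x * cmod (h (cis (2 * pi * x))) powr s"
  have "continuous_on {0..1} (\<lambda>x. cmod (h (cis (2 * pi * x))) powr s)"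
    by (rule continuous_on_powr') (use assms(5) in \<open>auto intro!: continuous_intros contc\<close>)
  then have "?g integrable_on {0..1}"
    by (intro integrable_continuous_real continuous_on_mult continuous_on_poisson_kernel assms)
  then have "(?g has_integral integral {0..1} ?g) {0..1}" by (rule integrable_integral)
  then have "(\<integral>\<^sup>+x. indicator {0..1} x * ennreal (?g x) \<partial>lborel) = ennreal (integral {0..1} ?g)"
    using nn_integral_has_integral_lebesgue[of "{0..1}" ?g]
    by (simp add: poisson_kernel_nonneg[OF assms(3,4)] ennreal_mult' ennreal_indicator)
  then show ?thesis
    using powr_cmod_le_poisson_integral[OF assms] poisson_kernel_nonneg[OF assms(3,4)]
    by (simp add: ennreal_mult mult.assoc ennreal_leI)
qed

lemma nn_integral_poisson_kernel:
  assumes "0 \<le> t" "t < 1"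
  shows "(\<integral>\<^sup>+x. indicator {0..1} x * ennreal (poisson_kernel t x) \<partial>lborel) = 1"
  using nn_integral_has_integral_lebesgue[OF _ has_integral_poisson_kernel[OF assms]] poisson_kernel_nonneg[OF assms]
  by (simp add: ennreal_mult' ennreal_indicator)

lemma borel_measurable_poisson_kernel [measurable]: "poisson_kernel t \<in> borel_measurable borel"
proof -
  have "(\<lambda>x. cmod (1 - t * cis (2 * pi * x))) \<in> borel_measurable borel"
    by (intro borel_measurable_continuous_onI continuous_intros)
  then show ?thesis unfolding poisson_kernel_def[abs_def] by measurable
qed

lemma distr_sphere_measure_rotation:
  "distr sphere_measure borel (\<lambda>z. cis y *s z) = (sphere_measure :: (complex ^ 'n::finite) measure)"
proof (rule isometry_distr_sphere_measure)
  show "linear (\<lambda>z::complex ^ 'n. cis y *s z)"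
    by (rule linearI) (simp_all add: vec_eq_iff algebra_simps)
  show "bij (\<lambda>z::complex ^ 'n. cis y *s z)"
    by (rule o_bij[of "\<lambda>z. cis (- y) *s z"]) (auto simp: fun_eq_iff cis_mult vector_smult_assoc)
qed (simp add: norm_smult_vec)

text \<open>Rotation invariance turns the Poisson inequality on each disc through the origin into monotonicity of the
  spherical means.\<close>

lemma sphere_mean_mono:
  fixes F :: "complex ^ 'n::finite \<Rightarrow> complex"
  assumes F: "holomorphic_on_ball F" and s: "0 < s" and t: "0 \<le> t" "t \<le> r" "r < 1"
  shows "(\<integral>\<^sup>+z. ball_powr s F (t *\<^sub>R z) \<partial>sphere_measure) \<le> (\<integral>\<^sup>+z. ball_powr s F (r *\<^sub>R z) \<partial>sphere_measure)"
proof (cases "t = r")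
  case False
  \<comment> \<open>On the disc l -> l (r z) the point t z has parameter q < 1, and the closed unit
    disc of parameters stays inside the ball because r < 1.\<close>
  define q where "q = t / r"
  have q: "0 \<le> q" "q < 1" "t = q * r" and r: "0 < r" using False t by (auto simp: q_def)
  let ?u = "ball_powr s F"
  let ?K = "\<lambda>x. indicator {0..1} x * ennreal (poisson_kernel q x)"
  note [measurable] = borel_measurable_ball_powr[OF F]
  have [measurable]: "(\<lambda>p. cis (2 * pi * snd p) *s fst p) \<in> borel_measurable (borel \<Otimes>\<^sub>M borel :: ((complex ^ 'n) \<times> real) measure)"
    unfolding borel_prod by (intro borel_measurable_continuous_onI continuous_intros)
  have [measurable]: "(\<lambda>z. cis y *s z) \<in> borel_measurable (borel :: (complex ^ 'n) measure)" for y
    by (intro borel_measurable_continuous_onI continuous_intros)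
  have [measurable]: "(\<lambda>p. ?K (snd p) * ?u (r *\<^sub>R (cis (2 * pi * snd p) *s fst p))) \<in> borel_measurable (borel \<Otimes>\<^sub>M borel)"
    by measurable
  have "(\<integral>\<^sup>+z. ?u (t *\<^sub>R z) \<partial>sphere_measure) \<le> (\<integral>\<^sup>+z. \<integral>\<^sup>+x. ?K x * ?u (r *\<^sub>R (cis (2 * pi * x) *s z)) \<partial>lborel \<partial>sphere_measure)"
  proof (rule nn_integral_mono_AE, use AE_sphere_measure_norm in eventually_elim)
    fix z :: "complex ^ 'n" assume z: "norm z = 1"
    define h where "h l = F (0 + l *s (r *\<^sub>R z))" for l
    have "h holomorphic_on ball 0 (1 / r)"
      unfolding h_def by (rule holomorphic_on_line[OF F]) (use z r in \<open>auto simp: norm_smult_vec field_simps\<close>)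
    from nn_integral_poisson_le[OF this _ q(1,2) s]
    have "ennreal (cmod (h (of_real q)) powr s) \<le> (\<integral>\<^sup>+x. ?K x * ennreal (cmod (h (cis (2 * pi * x))) powr s) \<partial>lborel)"
      using t r by simp
    moreover have "of_real q *s (r *\<^sub>R z) = t *\<^sub>R z"
      by (simp add: q(3) vec_eq_iff scaleR_conv_of_real[where 'a=complex])
    moreover have "ball_powr s F (t *\<^sub>R z) = ennreal (cmod (F (t *\<^sub>R z)) powr s)"
      using z t by (simp add: ball_powr_def)
    moreover have "ball_powr s F (r *\<^sub>R (cis y *s z)) = ennreal (cmod (h (cis y)) powr s)" for y
      using z t r by (simp add: ball_powr_def h_def norm_smult_vec smult_scaleR_swap)
    ultimately show "?u (t *\<^sub>R z) \<le> (\<integral>\<^sup>+x. ?K x * ?u (r *\<^sub>R (cis (2 * pi * x) *s z)) \<partial>lborel)"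
      by (simp add: h_def)
  qed
  also have "\<dots> = (\<integral>\<^sup>+x. \<integral>\<^sup>+z. ?K x * ?u (r *\<^sub>R (cis (2 * pi * x) *s z)) \<partial>sphere_measure \<partial>lborel)"
  proof -
    interpret pair_sigma_finite "sphere_measure :: (complex ^ 'n) measure" "lborel :: real measure" ..
    show ?thesis by (rule Fubini'[symmetric]) (simp add: case_prod_beta)
  qed
  also have "\<dots> = (\<integral>\<^sup>+x. ?K x * (\<integral>\<^sup>+z. ?u (r *\<^sub>R z) \<partial>sphere_measure) \<partial>lborel)"
  proof (rule nn_integral_cong)
    fix x :: real
    have "(\<integral>\<^sup>+z. ?u (r *\<^sub>R z) \<partial>sphere_measure) = (\<integral>\<^sup>+z. ?u (r *\<^sub>R z) \<partial>distr sphere_measure borel (\<lambda>z. cis (2 * pi * x) *s z))"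
      by (simp add: distr_sphere_measure_rotation)
    also have "\<dots> = (\<integral>\<^sup>+z. ?u (r *\<^sub>R (cis (2 * pi * x) *s z)) \<partial>sphere_measure)"
      by (subst nn_integral_distr) auto
    finally show "(\<integral>\<^sup>+z. ?K x * ?u (r *\<^sub>R (cis (2 * pi * x) *s z)) \<partial>sphere_measure) = ?K x * (\<integral>\<^sup>+z. ?u (r *\<^sub>R z) \<partial>sphere_measure)"
      by (simp add: nn_integral_cmult)
  qed
  also have "\<dots> = (\<integral>\<^sup>+z. ?u (r *\<^sub>R z) \<partial>sphere_measure)"
    by (subst nn_integral_multc) (auto simp: nn_integral_poisson_kernel[OF q(1,2)])
  finally show ?thesis .
qed simp

text \<open>Spherical means increase from the value at the centre; averaging them over the law of
  the norm gives the solid mean. The right side may be infinite.\<close>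

lemma sub_mean_ball:
  fixes F :: "complex ^ 'n::finite \<Rightarrow> complex"
  assumes F: "holomorphic_on_ball F" and s: "0 < s"
  shows "ennreal (cmod (F 0) powr s) \<le> (\<integral>\<^sup>+w. ball_powr s F w \<partial>unif_ball)"
proof -
  note [measurable] = borel_measurable_ball_powr[OF F]
  have "ennreal (cmod (F 0) powr s) = (\<integral>\<^sup>+r. ennreal (cmod (F 0) powr s) \<partial>norm_law TYPE(complex ^ 'n))"
    using norm_law.emeasure_space_1[of "TYPE(complex ^ 'n)"] by simp
  also have "\<dots> \<le> (\<integral>\<^sup>+r. \<integral>\<^sup>+z. ball_powr s F (r *\<^sub>R z) \<partial>sphere_measure \<partial>norm_law TYPE(complex ^ 'n))"
  proof (rule nn_integral_mono_AE, use AE_norm_law in eventually_elim)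
    fix r :: real assume r: "0 < r \<and> r < 1"
    have "ennreal (cmod (F 0) powr s) = (\<integral>\<^sup>+z. ball_powr s F (0 *\<^sub>R z) \<partial>sphere_measure)"
      using sphere_measure.emeasure_space_1[where 'a="complex ^ 'n"] by (simp add: ball_powr_def)
    also have "\<dots> \<le> (\<integral>\<^sup>+z. ball_powr s F (r *\<^sub>R z) \<partial>sphere_measure)"
      using r by (intro sphere_mean_mono F s) auto
    finally show "ennreal (cmod (F 0) powr s) \<le> (\<integral>\<^sup>+z. ball_powr s F (r *\<^sub>R z) \<partial>sphere_measure)" .
  qed
  finally show ?thesis by (simp add: nn_integral_polar)
qed

lemma emeasure_norm_law_tail:
  assumes "0 \<le> d"
  shows "emeasure (norm_law TYPE('a::euclidean_space)) {1 - d<..} \<le> ennreal (real DIM('a) * d)"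
  unfolding emeasure_norm_law_greaterThan using clamp_pow_upper[OF assms, of "DIM('a)"] by (simp add: ennreal_leI)

lemma nn_integral_unif_ball:
  fixes f :: "'a::euclidean_space \<Rightarrow> ennreal"
  assumes "f \<in> borel_measurable borel"
  shows "(\<integral>\<^sup>+x. f x \<partial>unif_ball) = (\<integral>\<^sup>+x. f x * indicator (ball 0 1) x \<partial>lborel) / emeasure lborel (ball (0::'a) 1)"
  unfolding unif_ball_def using assms by (subst nn_integral_uniform_measure) auto

text \<open>The outer bound 1 - d/2 allows comparison with all spheres of radius r \<ge> 1 - d/2;
  the inner bound keeps the thickness of the annulus of order d.\<close>

lemma ellipsoid_annulus:
  assumes e: "norm e = 1" and d: "0 < d" "d \<le> 1" and w: "w \<in> ellipsoid e d (1 / 8) ((1 - d) *\<^sub>R e)"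
  shows "1 - 2 * d < norm w" "norm w \<le> 1 - d / 2"
proof -
  have 1: "cmod (1 - hinner w e) \<le> d + 1 / 8 * d" "(norm w)\<^sup>2 \<le> (1 - d + 1 / 8 * d)\<^sup>2 + (1 / 8)\<^sup>2 * d"
    using ellipsoid_bounds[OF e d(1) _ _ _ w] d by auto
  show "1 - 2 * d < norm w" using 1(1) one_minus_norm_le[OF e, of w] d by linarith
  have "d * d \<le> d * 1" using d by (intro mult_left_mono) auto
  then have "(1 - d + 1 / 8 * d)\<^sup>2 + (1 / 8)\<^sup>2 * d \<le> (1 - d / 2)\<^sup>2"
    using d by (simp add: power2_eq_square algebra_simps)
  then have "(norm w)\<^sup>2 \<le> (1 - d / 2)\<^sup>2" using 1 by simp
  then show "norm w \<le> 1 - d / 2" by (rule power2_le_imp_le) (use d in simp)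
qed

text \<open>The ellipsoid around (1 - d) e has volume at least of order d times the cap, and it lies
  in an annulus of thickness of order d on which every spherical mean is at most the one at r. The
  two factors d cancel and the cap measure remains.\<close>

lemma point_evaluation_sphere:
  fixes F :: "complex ^ 'n::finite \<Rightarrow> complex"
  assumes F: "holomorphic_on_ball F" and s: "0 < s" and e: "norm e = 1" and d: "0 < d" "d \<le> 1"
    and r: "1 - d / 2 \<le> r" "r < 1"
  shows "ennreal (cmod (F ((1 - d) *\<^sub>R e)) powr s) * ennreal (cap_measure e d)
    \<le> ennreal (3 ^ DIM(complex ^ 'n) * 8 ^ DIM(complex ^ 'n) * (2 * real DIM(complex ^ 'n)))
       * (\<integral>\<^sup>+z. ball_powr s F (r *\<^sub>R z) \<partial>sphere_measure)"
proof -
  let ?n = "DIM(complex ^ 'n)" and ?z = "(1 - d) *\<^sub>R e"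
  let ?L = "ellipsoid e d (1 / 8) ?z"
  let ?u = "ball_powr s F" and ?v = "emeasure lborel (ball (0 :: complex ^ 'n) 1)"
  let ?M = "\<integral>\<^sup>+z. ?u (r *\<^sub>R z) \<partial>sphere_measure"
  note [measurable] = borel_measurable_ball_powr[OF F]
  have [measurable]: "?L \<in> sets borel" using e d by (intro sets_ellipsoid) auto
  note ann = ellipsoid_annulus[OF e d]
  have sub: "?L \<subseteq> ball 0 1" using ann(2) d by force
  \<comment> \<open>Pulling F back by the dilation turns the mean over the ellipsoid into the mean
    over the unit ball, where the value at 0 is F at the centre of the ellipsoid.\<close>
  define G where "G v = F (?z + (1 / 8) *\<^sub>R dil e d v)" for v
  have G: "holomorphic_on_ball G" unfolding G_def by (rule holomorphic_on_ball_dil[OF F sub])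
  note [measurable] = borel_measurable_ball_powr[OF G] borel_measurable_linear[OF linear_dil]
  have Gu: "ball_powr s G v * indicator (ball 0 1) v = ?u (?z + (1 / 8) *\<^sub>R dil e d v) * indicator (ball 0 1) v" for v
    using sub unfolding ellipsoid_def image_subset_iff by (cases "v \<in> ball 0 1") (auto simp: ball_powr_def G_def)
  let ?k = "(1 / 8) ^ ?n * dil_vol e d"
  have k: "0 < ?k" using dil_vol(1)[OF e d(1)] by simp
  have "ennreal (cmod (F ?z) powr s) \<le> (\<integral>\<^sup>+v. ball_powr s G v \<partial>unif_ball)"
    using sub_mean_ball[OF G s] by (simp add: G_def linear_0[OF linear_dil])
  also have "\<dots> = (\<integral>\<^sup>+v. ?u (?z + (1 / 8) *\<^sub>R dil e d v) * indicator (ball 0 1) v \<partial>lborel) / ?v"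
    by (simp add: nn_integral_unif_ball Gu)
  finally have "ennreal ?k * ennreal (cmod (F ?z) powr s)
    \<le> ennreal ?k * ((\<integral>\<^sup>+v. ?u (?z + (1 / 8) *\<^sub>R dil e d v) * indicator (ball 0 1) v \<partial>lborel) / ?v)"
    by (intro mult_left_mono) auto
  also have "\<dots> = (\<integral>\<^sup>+w. ?u w * indicator ?L w \<partial>lborel) / ?v"
    using e d by (subst nn_integral_ellipsoid) (auto simp: ennreal_times_divide)
  also have "\<dots> \<le> (\<integral>\<^sup>+w. ?u w * indicator {w. 1 - 2 * d < norm w \<and> norm w \<le> 1 - d / 2} w * indicator (ball 0 1) w \<partial>lborel) / ?v"
    using ann sub by (intro divide_right_mono_ennreal nn_integral_mono) (auto simp: indicator_def split: if_splits)
  also have "\<dots> = (\<integral>\<^sup>+w. ?u w * indicator {w. 1 - 2 * d < norm w \<and> norm w \<le> 1 - d / 2} w \<partial>unif_ball)"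
    by (subst nn_integral_unif_ball) auto
  also have "\<dots> = (\<integral>\<^sup>+t. \<integral>\<^sup>+z. ?u (t *\<^sub>R z) * indicator {w. 1 - 2 * d < norm w \<and> norm w \<le> 1 - d / 2} (t *\<^sub>R z) \<partial>sphere_measure \<partial>norm_law TYPE(complex ^ 'n))"
    by (subst nn_integral_polar) auto
  also have "\<dots> \<le> (\<integral>\<^sup>+t. ?M * indicator {1 - 2 * d<..} t \<partial>norm_law TYPE(complex ^ 'n))"
  proof (rule nn_integral_mono_AE, use AE_norm_law in eventually_elim)
    fix t :: real assume t: "0 < t \<and> t < 1"
    show "(\<integral>\<^sup>+z. ?u (t *\<^sub>R z) * indicator {w. 1 - 2 * d < norm w \<and> norm w \<le> 1 - d / 2} (t *\<^sub>R z) \<partial>sphere_measure) \<le> ?M * indicator {1 - 2 * d<..} t"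
    proof (cases "1 - 2 * d < t \<and> t \<le> 1 - d / 2")
      case True
      have "(\<integral>\<^sup>+z. ?u (t *\<^sub>R z) * indicator {w. 1 - 2 * d < norm w \<and> norm w \<le> 1 - d / 2} (t *\<^sub>R z) \<partial>sphere_measure)
        \<le> (\<integral>\<^sup>+z. ?u (t *\<^sub>R z) \<partial>sphere_measure)"
        by (intro nn_integral_mono) (auto simp: indicator_def)
      also have "\<dots> \<le> ?M" using t True r by (intro sphere_mean_mono F s) auto
      finally show ?thesis using True by simp
    next
      case False
      have "(\<integral>\<^sup>+z. ?u (t *\<^sub>R z) * indicator {w. 1 - 2 * d < norm w \<and> norm w \<le> 1 - d / 2} (t *\<^sub>R z) \<partial>sphere_measure)
        = (\<integral>\<^sup>+z. 0 \<partial>(sphere_measure :: (complex ^ 'n) measure))"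
        by (rule nn_integral_cong_AE, use AE_sphere_measure_norm in eventually_elim) (use False t in \<open>auto simp: indicator_def\<close>)
      then show ?thesis by simp
    qed
  qed
  also have "\<dots> = ?M * emeasure (norm_law TYPE(complex ^ 'n)) {1 - 2 * d<..}"
    by (simp add: nn_integral_cmult)
  also have "\<dots> \<le> ?M * ennreal (real ?n * (2 * d))"
    using d by (intro mult_left_mono emeasure_norm_law_tail) auto
  finally have main: "ennreal ?k * ennreal (cmod (F ?z) powr s) \<le> ?M * ennreal (real ?n * (2 * d))" .
  have cu: "cap_measure e d \<le> 3 ^ ?n * 8 ^ ?n / d * ?k"
    using cap_measure_upper[OF e d] d by (simp add: power_divide field_simps)
  have "ennreal (cmod (F ?z) powr s) * ennreal (cap_measure e d)
    \<le> ennreal (cmod (F ?z) powr s) * ennreal (3 ^ ?n * 8 ^ ?n / d * ?k)"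
    using cu by (intro mult_left_mono ennreal_leI) auto
  also have "\<dots> = ennreal (3 ^ ?n * 8 ^ ?n / d) * (ennreal ?k * ennreal (cmod (F ?z) powr s))"
    using d k by (subst ennreal_mult) (auto simp: mult_ac)
  also have "\<dots> \<le> ennreal (3 ^ ?n * 8 ^ ?n / d) * (?M * ennreal (real ?n * (2 * d)))"
    by (intro mult_left_mono main) auto
  also have "\<dots> = (ennreal (3 ^ ?n * 8 ^ ?n / d) * ennreal (real ?n * (2 * d))) * ?M"
    by (simp only: mult_ac)
  also have "ennreal (3 ^ ?n * 8 ^ ?n / d) * ennreal (real ?n * (2 * d)) = ennreal (3 ^ ?n * 8 ^ ?n * (2 * real ?n))"
    using d by (subst ennreal_mult[symmetric]) (auto simp: field_simps)
  finally show ?thesis .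
qed

section \<open>The measure of a doubling weight\<close>

abbreviation powr_integral :: "'a measure \<Rightarrow> real \<Rightarrow> ('a \<Rightarrow> complex) \<Rightarrow> ennreal" where
  "powr_integral \<mu> p f \<equiv> \<integral>\<^sup>+z. ennreal (cmod (f z) powr p) \<partial>\<mu>"

text \<open>The interface between weight and embedding: the weight enters the embedding theorem
  through doubling on tents and a point evaluation. The latter bounds by an integral over the whole
  ball; localisation comes with the kernel powers.\<close>

locale tent_doubling_measure = finite_measure m for m :: "(complex ^ 'n::finite) measure" +
  fixes L C :: real
  assumes sets_m: "sets m = sets (restrict_space borel (ball 0 1))"
    and m_ball_pos: "0 < measure m (ball 0 1)"
    and L_pos: "0 < L"
    and tent_double: "norm e = 1 \<Longrightarrow> 0 < d \<Longrightarrow> measure m (tent e (2 * d)) \<le> L * measure m (tent e d)"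
    and C_pos: "0 < C"
    and point_evaluation: "holomorphic_on_ball F \<Longrightarrow> 0 < s \<Longrightarrow> norm e = 1 \<Longrightarrow> 0 < d \<Longrightarrow> d \<le> 1 \<Longrightarrow>
       ennreal (cmod (F ((1 - d) *\<^sub>R e)) powr s) * ennreal (measure m (tent e d))
         \<le> ennreal C * powr_integral m s F"

text \<open>The weight is only known to be Lebesgue measurable as a function on the ball; by Fubini its profile agrees
  almost everywhere with a Borel function, its restriction to almost every ray.\<close>

lemma radial_weight_borel_version:
  assumes "radial_weight TYPE('n::finite) \<omega>"
  shows "\<exists>g\<in>borel_measurable borel. AE t in norm_law TYPE(complex ^ 'n). \<omega> t = g t"
proof -
  let ?B = "ball (0 :: complex ^ 'n) 1"
  have "(\<lambda>z::complex ^ 'n. \<omega> (norm z)) \<in> borel_measurable ball_volume"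
    using assms unfolding radial_weight_def by auto
  then have "(\<lambda>z. \<omega> (norm z)) \<in> borel_measurable (lebesgue_on ?B)"
    unfolding ball_volume_def by simp
  then have "(\<lambda>z. if z \<in> ?B then \<omega> (norm z) else 0) \<in> borel_measurable lebesgue"
    by (subst borel_measurable_if) auto
  from completion_ex_borel_measurable_real[OF this] obtain h :: "complex ^ 'n \<Rightarrow> real"
    where h: "h \<in> borel_measurable lborel" "AE z in lborel. (if z \<in> ?B then \<omega> (norm z) else 0) = h z" by blast
  from AE_E[OF h(2)] obtain N where N: "{z \<in> space lborel. \<not> (if z \<in> ?B then \<omega> (norm z) else 0) = h z} \<subseteq> N"
    "emeasure lborel N = 0" "N \<in> sets lborel" by blast
  have N': "\<omega> (norm z) = h z" if "z \<notin> N" "z \<in> ?B" for z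
  proof -
    have "\<not> \<not> (if z \<in> ?B then \<omega> (norm z) else 0) = h z" using N(1)[unfolded space_lborel space_borel] that(1) by blast
    then show ?thesis using that(2) by simp
  qed
  have [measurable]: "N \<in> sets borel" "h \<in> borel_measurable borel" using N(3) h(1) by auto
  have "N \<in> null_sets unif_ball" using N by (intro null_unif_ball) auto
  then have "0 = (\<integral>\<^sup>+z. indicator N z \<partial>unif_ball)" by auto
  also have "\<dots> = (\<integral>\<^sup>+r. \<integral>\<^sup>+z. indicator N (r *\<^sub>R z) \<partial>sphere_measure \<partial>norm_law TYPE(complex ^ 'n))"
    by (subst nn_integral_polar) auto
  also have "\<dots> = (\<integral>\<^sup>+z. \<integral>\<^sup>+r. indicator N (r *\<^sub>R z) \<partial>norm_law TYPE(complex ^ 'n) \<partial>sphere_measure)"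
  proof -
    interpret pair_sigma_finite "norm_law TYPE(complex ^ 'n)" "sphere_measure :: (complex ^ 'n) measure" ..
    show ?thesis by (rule Fubini'[symmetric]) measurable
  qed
  finally have "(\<integral>\<^sup>+z. \<integral>\<^sup>+r. indicator N (r *\<^sub>R z) \<partial>norm_law TYPE(complex ^ 'n) \<partial>sphere_measure) = 0" by simp
  then have "AE z in sphere_measure. (\<integral>\<^sup>+r. indicator N (r *\<^sub>R z) \<partial>norm_law TYPE(complex ^ 'n)) = 0"
    by (subst (asm) nn_integral_0_iff_AE) auto
  with AE_sphere_measure_norm[where 'a="complex ^ 'n"]
  have AEz: "AE z in sphere_measure. norm (z::complex ^ 'n) = 1 \<and> (\<integral>\<^sup>+r. indicator N (r *\<^sub>R z) \<partial>norm_law TYPE(complex ^ 'n)) = 0"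
    by eventually_elim auto
  \<comment> \<open>Almost every direction meets N in a null set of radii. The sphere measure is a
    probability, so one unit vector z with this property exists, and r -> h (r z) is the required
    Borel function.\<close>
  have "\<exists>z::complex ^ 'n. norm z = 1 \<and> (\<integral>\<^sup>+r. indicator N (r *\<^sub>R z) \<partial>norm_law TYPE(complex ^ 'n)) = 0"
  proof (rule ccontr)
    assume no: "\<not> ?thesis"
    have "AE z in (sphere_measure :: (complex ^ 'n) measure). False"
      using AEz by eventually_elim (use no in blast)
    then show False by simp
  qed
  then obtain z :: "complex ^ 'n" where z: "norm z = 1" "(\<integral>\<^sup>+r. indicator N (r *\<^sub>R z) \<partial>norm_law TYPE(complex ^ 'n)) = 0"
    by blast
  from z(2) have "AE r in norm_law TYPE(complex ^ 'n). indicator N (r *\<^sub>R z) = (0::ennreal)"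
    by (subst (asm) nn_integral_0_iff_AE) auto
  with AE_norm_law[where 'a="complex ^ 'n"] have "AE r in norm_law TYPE(complex ^ 'n). \<omega> r = h (r *\<^sub>R z)"
  proof eventually_elim
    case (elim r)
    then have "r *\<^sub>R z \<notin> N" "r *\<^sub>R z \<in> ?B" "norm (r *\<^sub>R z) = r" using z(1) by (auto simp: indicator_def split: if_splits)
    then show ?case using N'[of "r *\<^sub>R z"] by simp
  qed
  then show ?thesis by (intro bexI[of _ "\<lambda>r. h (r *\<^sub>R z)"]) auto
qed

text \<open>A Borel measure whose space is the ball, so that the admissible measures are exactly
  those with the same measurable sets.\<close>

definition weight_measure :: "(real \<Rightarrow> real) \<Rightarrow> (complex ^ 'n::finite) measure" where
  "weight_measure g = restrict_space (density unif_ball (\<lambda>z. ennreal (g (norm z)))) (ball 0 1)"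

lemma sets_weight_measure: "sets (weight_measure g) = sets (restrict_space borel (ball 0 1))"
  unfolding weight_measure_def by (intro sets_restrict_space_cong) simp

lemma space_weight_measure: "space (weight_measure g) = ball 0 1"
  by (simp add: weight_measure_def space_restrict_space)

lemma nn_integral_weight_measure:
  fixes f :: "complex ^ 'n::finite \<Rightarrow> ennreal"
  assumes [measurable]: "g \<in> borel_measurable borel" and f: "f \<in> borel_measurable (restrict_space borel (ball 0 1))"
  shows "(\<integral>\<^sup>+z. f z \<partial>weight_measure g) = (\<integral>\<^sup>+z. ennreal (g (norm z)) * (f z * indicator (ball 0 1) z) \<partial>unif_ball)"
proof -
  have [measurable]: "(\<lambda>z. f z * indicator (ball 0 1) z) \<in> borel_measurable borel"
    using f by (subst (asm) borel_measurable_restrict_space_iff_ennreal) auto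
  have "(\<integral>\<^sup>+z. f z \<partial>weight_measure g) = (\<integral>\<^sup>+z. f z * indicator (ball 0 1) z \<partial>density unif_ball (\<lambda>z. ennreal (g (norm z))))"
    unfolding weight_measure_def by (subst nn_integral_restrict_space) auto
  also have "\<dots> = (\<integral>\<^sup>+z. ennreal (g (norm z)) * (f z * indicator (ball 0 1) z) \<partial>unif_ball)"
    by (subst nn_integral_density) auto
  finally show ?thesis .
qed

text \<open>Integrals over \<open>ball_volume\<close> refer to Lebesgue measurable sets and to omega
  itself, while later arguments use Borel sets and g. For Borel f both give the same integral,
  because omega and g differ only on a null set of radii.\<close>

lemma radial_weight_measure_link:
  fixes f :: "complex ^ 'n::finite \<Rightarrow> real"
  assumes rw: "radial_weight TYPE('n) \<omega>" and g [measurable]: "g \<in> borel_measurable borel"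
    and ae: "AE t in norm_law TYPE(complex ^ 'n). \<omega> t = g t"
    and f: "f \<in> borel_measurable (restrict_space borel (ball 0 1))" "\<And>z. 0 \<le> f z"
  shows "(\<lambda>z. f z * \<omega> (norm z)) \<in> borel_measurable ball_volume"
    and "(\<integral>\<^sup>+z. ennreal (f z * \<omega> (norm z)) \<partial>ball_volume) = (\<integral>\<^sup>+z. ennreal (f z) \<partial>weight_measure g)"
proof -
  let ?B = "ball (0 :: complex ^ 'n) 1"
  have w: "(\<lambda>z::complex ^ 'n. \<omega> (norm z)) \<in> borel_measurable (lebesgue_on ?B)"
    using rw unfolding radial_weight_def ball_volume_def by auto
  have fB: "(\<lambda>z. f z * indicator ?B z) \<in> borel_measurable borel"
    using f by (subst (asm) borel_measurable_restrict_space_iff) (auto simp: mult.commute)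
  then have fB': "(\<lambda>z. f z * indicator ?B z) \<in> borel_measurable lebesgue"
    by (simp add: measurable_completion)
  have fl: "f \<in> borel_measurable (lebesgue_on ?B)"
    by (rule measurable_cong[THEN iffD1, OF _ measurable_restrict_space1[OF fB']]) (auto simp: space_restrict_space)
  have "borel_measurable ball_volume = (borel_measurable (lebesgue_on ?B) :: (_ \<Rightarrow> real) set)"
    unfolding ball_volume_def by (rule measurable_cong_sets) simp_all
  then show meas: "(\<lambda>z. f z * \<omega> (norm z)) \<in> borel_measurable ball_volume"
    using borel_measurable_times[OF fl w] by blast
  have v: "emeasure (lebesgue_on ?B) ?B = emeasure lborel ?B"
    by (subst emeasure_restrict_space) (auto simp: emeasure_completion)
  have "AE z in (unif_ball :: (complex ^ 'n) measure). \<omega> (norm z) = g (norm z)"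
    using ae unfolding norm_law_def by (rule AE_distrD[rotated]) auto
  then have ae2: "AE z in lborel. z \<in> ?B \<longrightarrow> \<omega> (norm z) = g (norm z)"
    unfolding unif_ball_def using emeasure_lborel_unit_ball[where 'a="complex ^ 'n"] by (subst (asm) AE_uniform_measure) auto
  have "(\<integral>\<^sup>+z. ennreal (f z * \<omega> (norm z)) \<partial>ball_volume)
    = (\<integral>\<^sup>+z. ennreal (f z * \<omega> (norm z)) * indicator ?B z \<partial>lebesgue_on ?B) / emeasure lborel ?B"
    using fl w unfolding ball_volume_def by (subst nn_integral_uniform_measure) (auto simp: v sets_restrict_space_iff)
  also have "(\<integral>\<^sup>+z. ennreal (f z * \<omega> (norm z)) * indicator ?B z \<partial>lebesgue_on ?B)
    = (\<integral>\<^sup>+z. ennreal (f z * \<omega> (norm z)) * indicator ?B z * indicator ?B z \<partial>lborel)"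
    by (subst nn_integral_restrict_space) (auto simp: nn_integral_completion)
  also have "\<dots> = (\<integral>\<^sup>+z. ennreal (g (norm z)) * (ennreal (f z) * indicator ?B z) * indicator ?B z \<partial>lborel)"
    by (rule nn_integral_cong_AE, use ae2 in eventually_elim) (auto simp: indicator_def ennreal_mult' f mult.commute)
  also have "\<dots> / emeasure lborel ?B = (\<integral>\<^sup>+z. ennreal (g (norm z)) * (ennreal (f z) * indicator ?B z) \<partial>unif_ball)"
  proof (rule nn_integral_unif_ball[symmetric])
    have [measurable]: "(\<lambda>z. ennreal (f z) * indicator ?B z) \<in> borel_measurable borel"
      using measurable_compose[OF fB measurable_ennreal]
      by (rule measurable_cong[THEN iffD1, rotated]) (auto simp: indicator_def)
    show "(\<lambda>z. ennreal (g (norm z)) * (ennreal (f z) * indicator ?B z)) \<in> borel_measurable borel" by measurable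
  qed
  also have "\<dots> = (\<integral>\<^sup>+z. ennreal (f z) \<partial>weight_measure g)"
    using f by (subst nn_integral_weight_measure) auto
  finally show "(\<integral>\<^sup>+z. ennreal (f z * \<omega> (norm z)) \<partial>ball_volume) = (\<integral>\<^sup>+z. ennreal (f z) \<partial>weight_measure g)" .
qed

text \<open>The tail of the weight with the polar density of real dimension n: the mass beyond
  radius x, which multiplies with the measure of a cap to give that of a sector.\<close>

definition radial_tail :: "nat \<Rightarrow> (real \<Rightarrow> real) \<Rightarrow> real \<Rightarrow> ennreal" where
  "radial_tail n g x = (\<integral>\<^sup>+t. ennreal (real n * t ^ (n - 1)) * indicator {0<..<1} t * (ennreal (g t) * indicator {x<..} t) \<partial>lborel)"

lemma radial_tail_norm_law:
  assumes [measurable]: "g \<in> borel_measurable borel"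
  shows "radial_tail (DIM('a::euclidean_space)) g x = (\<integral>\<^sup>+t. ennreal (g t) * indicator {x<..} t \<partial>norm_law TYPE('a))"
  unfolding radial_tail_def by (subst nn_integral_norm_law) auto

lemma radial_tail_neg: "x \<le> 0 \<Longrightarrow> radial_tail n g x = radial_tail n g 0"
  unfolding radial_tail_def by (intro nn_integral_cong) (auto simp: indicator_def)

lemma radial_tail_antimono: "x \<le> y \<Longrightarrow> radial_tail n g y \<le> radial_tail n g x"
  unfolding radial_tail_def by (intro nn_integral_mono) (auto simp: indicator_def)

lemma weight_tail_bounds:
  assumes g [measurable]: "g \<in> borel_measurable borel"
    and ae: "AE t in lborel. 0 < t \<and> t < 1 \<longrightarrow> \<omega> t = g t" and n: "0 < n" and x: "0 \<le> x"
  shows "radial_tail n g x \<le> ennreal (real n) * weight_tail \<omega> x"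
    and "1 / 2 \<le> x \<Longrightarrow> ennreal (real n * (1 / 2) ^ (n - 1)) * weight_tail \<omega> x \<le> radial_tail n g x"
proof -
  have wt: "weight_tail \<omega> x = (\<integral>\<^sup>+t. ennreal (g t) * indicator {x<..<1} t \<partial>lborel)"
    unfolding weight_tail_def nn_integral_completion
    by (rule nn_integral_cong_AE, use ae in eventually_elim) (use x in \<open>auto simp: indicator_def\<close>)
  have "radial_tail n g x \<le> (\<integral>\<^sup>+t. ennreal (real n) * (ennreal (g t) * indicator {x<..<1} t) \<partial>lborel)"
    unfolding radial_tail_def using x
    by (intro nn_integral_mono) (auto simp: indicator_def power_le_one mult_left_le intro!: mult_right_mono ennreal_leI)
  then show "radial_tail n g x \<le> ennreal (real n) * weight_tail \<omega> x"
    unfolding wt by (subst (asm) nn_integral_cmult) auto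
  assume x2: "1 / 2 \<le> x"
  have "ennreal (real n * (1 / 2) ^ (n - 1)) * weight_tail \<omega> x
    = (\<integral>\<^sup>+t. ennreal (real n * (1 / 2) ^ (n - 1)) * (ennreal (g t) * indicator {x<..<1} t) \<partial>lborel)"
    unfolding wt by (subst nn_integral_cmult) auto
  also have "\<dots> \<le> radial_tail n g x"
    unfolding radial_tail_def using x2
    by (intro nn_integral_mono) (auto simp: indicator_def intro!: mult_right_mono mult_left_mono power_mono ennreal_leI)
  finally show "ennreal (real n * (1 / 2) ^ (n - 1)) * weight_tail \<omega> x \<le> radial_tail n g x" .
qed

text \<open>For d \<le> 1 the midpoint 1 - d/2 is at least 1/2, where the polar density is bounded
  below, so the doubling of \<open>weight_tail\<close> passes to \<open>radial_tail\<close>. For 1 <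
  d \<le> 2 the left side is the tail at 0 and compares with the case d = 1; for d > 2 both tails
  equal the tail at 0.\<close>

lemma radial_tail_doubling:
  assumes dw: "doubling_weight TYPE('n::finite) \<omega>" and g: "g \<in> borel_measurable borel"
    and ae: "AE t in lborel. 0 < t \<and> t < 1 \<longrightarrow> \<omega> t = g t" and n: "0 < n"
  shows "radial_tail n g 0 < \<infinity>" and "0 < radial_tail n g 0"
    and "\<exists>K>0. \<forall>d>0. radial_tail n g (1 - d) \<le> ennreal K * radial_tail n g (1 - d / 2)"
proof -
  note b = weight_tail_bounds[OF g ae n]
  obtain C where C: "C > 0" "\<And>r. 0 \<le> r \<Longrightarrow> r < 1 \<Longrightarrow> weight_tail \<omega> r < ennreal C * weight_tail \<omega> ((1 + r) / 2)"
    using dw unfolding doubling_weight_def by blast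
  \<comment> \<open>Strictness of the doubling inequality at r = 0 excludes an infinite left side;
    read from the other end, it makes the tail at 1/2 positive.\<close>
  have "weight_tail \<omega> 0 < \<infinity>" using C(2)[of 0] by (auto intro: order_less_le_trans)
  then show fin: "radial_tail n g 0 < \<infinity>"
    using b(1)[of 0] by (auto simp: ennreal_mult_less_top intro: le_less_trans)
  let ?c = "real n * (1 / 2) ^ (n - 1)"
  have c: "?c > 0" using n by simp
  have "0 < weight_tail \<omega> (1 / 2)" using C(2)[of 0] by (auto simp: zero_less_iff_neq_zero)
  then have "0 < ennreal ?c * weight_tail \<omega> (1 / 2)" using c by (simp add: ennreal_zero_less_mult_iff)
  also have "\<dots> \<le> radial_tail n g (1 / 2)" by (rule b(2)) auto
  also have "\<dots> \<le> radial_tail n g 0" by (rule radial_tail_antimono) simp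
  finally show "0 < radial_tail n g 0" .
  define K where "K = real n * C / ?c"
  have K: "K > 0" using n C c by (simp add: K_def)
  have main: "radial_tail n g (1 - d) \<le> ennreal K * radial_tail n g (1 - d / 2)" if d: "0 < d" "d \<le> 1" for d
  proof -
    have "radial_tail n g (1 - d) \<le> ennreal (real n) * weight_tail \<omega> (1 - d)" using d by (intro b(1)) auto
    also have "\<dots> \<le> ennreal (real n) * (ennreal C * weight_tail \<omega> ((1 + (1 - d)) / 2))"
      using d by (intro mult_left_mono less_imp_le[OF C(2)]) auto
    also have "(1 + (1 - d)) / 2 = 1 - d / 2" by (simp add: field_simps)
    also have "ennreal (real n) * (ennreal C * weight_tail \<omega> (1 - d / 2)) = ennreal (K * ?c) * weight_tail \<omega> (1 - d / 2)"
    proof -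
      have "K * ?c = real n * C" unfolding K_def by (rule nonzero_eq_divide_eq[THEN iffD1]) (use c n in auto)
      then show ?thesis using C by (simp only:) (simp add: ennreal_mult' mult.assoc)
    qed
    also have "\<dots> = ennreal K * (ennreal ?c * weight_tail \<omega> (1 - d / 2))"
      using K c by (simp add: ennreal_mult'' mult.assoc)
    also have "\<dots> \<le> ennreal K * radial_tail n g (1 - d / 2)"
      using d by (intro mult_left_mono b(2)) auto
    finally show ?thesis .
  qed
  show "\<exists>K>0. \<forall>d>0. radial_tail n g (1 - d) \<le> ennreal K * radial_tail n g (1 - d / 2)"
  proof (intro exI[of _ "max K 1"] conjI allI impI)
    fix d :: real assume d: "0 < d"
    show "radial_tail n g (1 - d) \<le> ennreal (max K 1) * radial_tail n g (1 - d / 2)"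
    proof (cases "d \<le> 1")
      case True
      show ?thesis by (rule order_trans[OF main[OF d True]]) (intro mult_right_mono ennreal_leI, auto)
    next
      case False
      show ?thesis
      proof (cases "d \<le> 2")
        case True
        have "radial_tail n g (1 - d) = radial_tail n g (1 - 1)" using False radial_tail_neg[of "1 - d" n g] by simp
        also have "\<dots> \<le> ennreal K * radial_tail n g (1 - 1 / 2)" by (rule main) auto
        also have "\<dots> \<le> ennreal (max K 1) * radial_tail n g (1 - d / 2)"
          using False by (intro mult_mono ennreal_leI radial_tail_antimono) auto
        finally show ?thesis .
      next
        case False
        then have "radial_tail n g (1 - d) = 1 * radial_tail n g (1 - d / 2)"
            using radial_tail_neg[of "1 - d" n g] radial_tail_neg[of "1 - d / 2" n g] by simp
        also have "\<dots> \<le> ennreal (max K 1) * radial_tail n g (1 - d / 2)"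
          by (intro mult_right_mono) (auto simp: max_def)
        finally show ?thesis .
      qed
    qed
  qed simp
qed


section \<open>Weighted measure of sectors and tents\<close>

lemma nn_integral_sector:
  fixes E :: "(complex ^ 'n::finite) set"
  assumes g [measurable]: "g \<in> borel_measurable borel" and [measurable]: "E \<in> sets borel"
  shows "(\<integral>\<^sup>+z. ennreal (g (norm z)) * indicator {x<..} (norm z) * indicator E (sgn z) \<partial>unif_ball)
    = radial_tail (DIM(complex ^ 'n)) g x * ennreal (measure sphere_measure E)"
proof -
  have "(\<integral>\<^sup>+z. ennreal (g (norm z)) * indicator {x<..} (norm z) * indicator E (sgn z) \<partial>unif_ball)
    = (\<integral>\<^sup>+t. \<integral>\<^sup>+z. ennreal (g (norm (t *\<^sub>R z))) * indicator {x<..} (norm (t *\<^sub>R z)) * indicator E (sgn (t *\<^sub>R z)) \<partial>sphere_measure \<partial>norm_law TYPE(complex ^ 'n))"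
    by (subst nn_integral_polar) auto
  also have "\<dots> = (\<integral>\<^sup>+t. ennreal (g t) * indicator {x<..} t * emeasure sphere_measure E \<partial>norm_law TYPE(complex ^ 'n))"
  proof (rule nn_integral_cong_AE, use AE_norm_law in eventually_elim)
    fix t :: real assume t: "0 < t \<and> t < 1"
    have "(\<integral>\<^sup>+z. ennreal (g (norm (t *\<^sub>R z))) * indicator {x<..} (norm (t *\<^sub>R z)) * indicator E (sgn (t *\<^sub>R z)) \<partial>sphere_measure)
      = (\<integral>\<^sup>+z. ennreal (g t) * indicator {x<..} t * indicator E z \<partial>sphere_measure)"
      by (rule nn_integral_cong_AE, use AE_sphere_measure_norm in eventually_elim)
         (use t in \<open>simp add: sgn_scaleR sgn_div_norm\<close>)
    then show "(\<integral>\<^sup>+z. ennreal (g (norm (t *\<^sub>R z))) * indicator {x<..} (norm (t *\<^sub>R z)) * indicator E (sgn (t *\<^sub>R z)) \<partial>sphere_measure)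
      = ennreal (g t) * indicator {x<..} t * emeasure sphere_measure E"
      by (simp add: nn_integral_cmult)
  qed
  also have "\<dots> = radial_tail (DIM(complex ^ 'n)) g x * emeasure sphere_measure E"
    by (subst nn_integral_multc) (auto simp: radial_tail_norm_law[OF g, where 'a="complex ^ 'n", simplified])
  finally show ?thesis by (simp add: sphere_measure.emeasure_eq_measure)
qed

lemma emeasure_weight_measure:
  fixes E :: "(complex ^ 'n::finite) set"
  assumes "g \<in> borel_measurable borel" "E \<in> sets borel" "E \<subseteq> ball 0 1"
  shows "emeasure (weight_measure g) E = (\<integral>\<^sup>+z. ennreal (g (norm z)) * indicator E z \<partial>unif_ball)"
proof -
  have E: "E \<in> sets (restrict_space borel (ball 0 1))" using assms by (simp add: sets_restrict_space_iff)
  have "emeasure (weight_measure g) E = (\<integral>\<^sup>+z. indicator E z \<partial>weight_measure g)"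
    using E by (simp add: sets_weight_measure)
  also have "\<dots> = (\<integral>\<^sup>+z. ennreal (g (norm z)) * (indicator E z * indicator (ball 0 1) z) \<partial>unif_ball)"
    using E assms by (intro nn_integral_weight_measure) auto
  also have "\<dots> = (\<integral>\<^sup>+z. ennreal (g (norm z)) * indicator E z \<partial>unif_ball)"
    using assms(3) by (intro nn_integral_cong) (auto simp: indicator_def)
  finally show ?thesis .
qed

lemma tent_sector_upper:
  fixes e :: "complex ^ 'n::finite"
  assumes g: "g \<in> borel_measurable borel" and e: "norm e = 1"
  shows "emeasure (weight_measure g) (tent e d)
    \<le> radial_tail (DIM(complex ^ 'n)) g (1 - d) * ennreal (cap_measure e (2 * d))"
proof -
  let ?E = "{z. cmod (1 - hinner z e) < 2 * d}"
  have "emeasure (weight_measure g) (tent e d) = (\<integral>\<^sup>+z. ennreal (g (norm z)) * indicator (tent e d) z \<partial>unif_ball)"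
    by (rule emeasure_weight_measure[OF g _ tent_subset_ball]) simp
  also have "\<dots> \<le> (\<integral>\<^sup>+z. ennreal (g (norm z)) * indicator {1 - d<..} (norm z) * indicator ?E (sgn z) \<partial>unif_ball)"
  proof (rule nn_integral_mono_AE, use AE_unif_ball_nonzero in eventually_elim)
    fix z :: "complex ^ 'n" assume "z \<noteq> 0"
    then show "ennreal (g (norm z)) * indicator (tent e d) z
      \<le> ennreal (g (norm z)) * indicator {1 - d<..} (norm z) * indicator ?E (sgn z)"
      using tentD_polar[of z e d] e by (auto simp: indicator_def)
  qed
  finally show ?thesis unfolding cap_measure_def by (subst (asm) nn_integral_sector[OF g]) measurable
qed

lemma tent_sector_lower:
  fixes e :: "complex ^ 'n::finite"
  assumes g: "g \<in> borel_measurable borel" and e: "norm e = 1"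
  shows "radial_tail (DIM(complex ^ 'n)) g (1 - d / 2) * ennreal (cap_measure e (d / 2))
    \<le> emeasure (weight_measure g) (tent e d)"
proof -
  let ?E = "{z. cmod (1 - hinner z e) < d / 2}"
  have "radial_tail (DIM(complex ^ 'n)) g (1 - d / 2) * ennreal (cap_measure e (d / 2))
    = (\<integral>\<^sup>+z. ennreal (g (norm z)) * indicator {1 - d / 2<..} (norm z) * indicator ?E (sgn z) \<partial>unif_ball)"
    unfolding cap_measure_def by (rule nn_integral_sector[OF g, symmetric]) measurable
  also have "\<dots> \<le> (\<integral>\<^sup>+z. ennreal (g (norm z)) * indicator (tent e d) z \<partial>unif_ball)"
  proof (rule nn_integral_mono_AE, use AE_unif_ball_nonzero AE_unif_ball_in_ball in eventually_elim)
    fix z :: "complex ^ 'n" assume "z \<noteq> 0" "z \<in> ball 0 1"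
    then show "ennreal (g (norm z)) * indicator {1 - d / 2<..} (norm z) * indicator ?E (sgn z)
      \<le> ennreal (g (norm z)) * indicator (tent e d) z"
      using tentI_polar[of z d e] e by (auto simp: indicator_def)
  qed
  also have "\<dots> = emeasure (weight_measure g) (tent e d)"
    by (rule emeasure_weight_measure[OF g _ tent_subset_ball, symmetric]) simp
  finally show ?thesis .
qed

lemma emeasure_weight_measure_ball:
  assumes g [measurable]: "g \<in> borel_measurable borel"
  shows "emeasure (weight_measure g :: (complex ^ 'n::finite) measure) (ball 0 1) = radial_tail (DIM(complex ^ 'n)) g 0"
proof -
  have "emeasure (weight_measure g :: (complex ^ 'n) measure) (ball 0 1) = (\<integral>\<^sup>+z. 1 \<partial>(weight_measure g :: (complex ^ 'n) measure))"
    by (simp add: space_weight_measure)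
  also have "\<dots> = (\<integral>\<^sup>+z. ennreal (g (norm z)) * (1 * indicator (ball 0 1) z) \<partial>(unif_ball :: (complex ^ 'n) measure))"
    by (intro nn_integral_weight_measure) auto
  also have "\<dots> = (\<integral>\<^sup>+z. ennreal (g (norm z)) * indicator {0<..} (norm z) \<partial>(unif_ball :: (complex ^ 'n) measure))"
    by (rule nn_integral_cong_AE, use AE_unif_ball_nonzero AE_unif_ball_in_ball in eventually_elim) (simp add: indicator_def)
  also have "\<dots> = (\<integral>\<^sup>+t. ennreal (g t) * indicator {0<..} t \<partial>norm_law TYPE(complex ^ 'n))"
    unfolding norm_law_def by (subst nn_integral_distr) auto
  finally show ?thesis by (simp add: radial_tail_norm_law[OF g, where 'a="complex ^ 'n", simplified])
qed

text \<open>Up to constants a tent of size d has measure tail(1 - d/2) times cap(d), and both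
  factors double. For the point evaluation, the sphere estimate at radius t is multiplied by g t and
  integrated over t > 1 - d/2: the left side produces this product, the right side an integral over
  part of the ball.\<close>

lemma doubling_weight_tent_doubling:
  assumes dw: "doubling_weight TYPE('n::finite) \<omega>" and g [measurable]: "g \<in> borel_measurable borel"
    and ae: "AE t in norm_law TYPE(complex ^ 'n). \<omega> t = g t"
  shows "\<exists>L C. tent_doubling_measure (weight_measure g :: (complex ^ 'n) measure) L C"
proof -
  let ?n = "DIM(complex ^ 'n)" and ?m = "weight_measure g :: (complex ^ 'n) measure"
  let ?T = "radial_tail ?n g"
  have ae': "AE t in lborel. 0 < t \<and> t < 1 \<longrightarrow> \<omega> t = g t"
    using ae unfolding norm_law_density
    by (subst (asm) AE_density) (auto simp: indicator_def elim!: eventually_mono)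
  have n: "0 < ?n" by simp
  note T = radial_tail_doubling[OF dw g ae' n]
  obtain K where K: "K > 0" "\<And>d. d > 0 \<Longrightarrow> ?T (1 - d) \<le> ennreal K * ?T (1 - d / 2)" using T(3) by blast
  obtain A where A: "A > 0" "\<And>(e :: complex ^ 'n) d. norm e = 1 \<Longrightarrow> 0 < d \<Longrightarrow> cap_measure e (2 * d) \<le> A * cap_measure e d"
    using cap_measure_double[where 'n='n] by blast
  have A': "ennreal (cap_measure e (2 * d)) \<le> ennreal A * ennreal (cap_measure e d)"
    if "norm e = 1" "0 < d" for e :: "complex ^ 'n" and d
    using A(2)[OF that] A(1) by (simp add: ennreal_mult'[symmetric] cap_measure_def ennreal_leI)
  have fin: "emeasure ?m (space ?m) < \<infinity>"
    using T(1) by (simp add: space_weight_measure emeasure_weight_measure_ball)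
  interpret m: finite_measure ?m by (rule finite_measureI) (use fin in auto)
  \<comment> \<open>\<open>upper\<close> at 2 d costs one K and one A; moving the tail from 1 - d to
    1 - d/2 costs another K, and shrinking the cap from 2 d to d/2 two more A.\<close>
  define L where "L = K * K * (A * (A * A))"
  define B where "B = 3 ^ ?n * 8 ^ ?n * (2 * real ?n)"
  have B: "B > 0" by (simp add: B_def)
  have upper: "emeasure ?m (tent e d) \<le> ennreal (K * A) * (?T (1 - d / 2) * ennreal (cap_measure e d))"
    if e: "norm e = 1" and d: "0 < d" for e :: "complex ^ 'n" and d
  proof -
    have "emeasure ?m (tent e d) \<le> ?T (1 - d) * ennreal (cap_measure e (2 * d))"
      by (rule tent_sector_upper[OF g e])
    also have "\<dots> \<le> (ennreal K * ?T (1 - d / 2)) * (ennreal A * ennreal (cap_measure e d))"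
      using e d by (intro mult_mono K(2) A') auto
    also have "\<dots> = ennreal (K * A) * (?T (1 - d / 2) * ennreal (cap_measure e d))"
      using K(1) A(1) by (simp add: ennreal_mult mult_ac)
    finally show ?thesis .
  qed
  have "tent_doubling_measure ?m L (K * A * B)"
  proof (unfold_locales)
    show "sets ?m = sets (restrict_space borel (ball 0 1))" by (rule sets_weight_measure)
    have "0 < emeasure ?m (ball 0 1)" using T(2) by (simp only: emeasure_weight_measure_ball[OF g])
    then show "0 < measure ?m (ball 0 1)" by (simp add: m.emeasure_eq_measure)
    show "0 < L" "0 < K * A * B" using K A B by (simp_all add: L_def)
  next
    fix e :: "complex ^ 'n" and d :: real assume e: "norm e = 1" and d: "0 < d"
    have "emeasure ?m (tent e (2 * d)) \<le> ennreal (K * A) * (?T (1 - (2 * d) / 2) * ennreal (cap_measure e (2 * d)))"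
      by (rule upper) (use e d in auto)
    also have "\<dots> = ennreal (K * A) * (?T (1 - d) * ennreal (cap_measure e (2 * d)))" by simp
    also have "\<dots> \<le> ennreal (K * A) * ((ennreal K * ?T (1 - d / 2)) * (ennreal A * (ennreal A * ennreal (cap_measure e (d / 2)))))"
      using A'[OF e, of "d / 2"] d
      by (intro mult_mono K(2) order_trans[OF A'[OF e]] order_refl) auto
    also have "\<dots> = ennreal L * (?T (1 - d / 2) * ennreal (cap_measure e (d / 2)))"
      using K(1) A(1) unfolding L_def by (simp add: ennreal_mult mult_ac)
    also have "\<dots> \<le> ennreal L * emeasure ?m (tent e d)"
      by (intro mult_left_mono tent_sector_lower g e) auto
    finally have "ennreal (measure ?m (tent e (2 * d))) \<le> ennreal (L * measure ?m (tent e d))"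
      using K A by (simp add: m.emeasure_eq_measure ennreal_mult' L_def)
    then show "measure ?m (tent e (2 * d)) \<le> L * measure ?m (tent e d)"
      using K A by (subst (asm) ennreal_le_iff) (auto simp: L_def)
  next
    fix F :: "complex ^ 'n \<Rightarrow> complex" and s d :: real and e :: "complex ^ 'n"
    assume F: "holomorphic_on_ball F" and s: "0 < s" and e: "norm e = 1" and d: "0 < d" "d \<le> 1"
    note [measurable] = borel_measurable_ball_powr[OF F]
    let ?u = "ball_powr s F" and ?f = "ennreal (cmod (F ((1 - d) *\<^sub>R e)) powr s)"
    have "?f * ennreal (measure ?m (tent e d)) \<le> ?f * (ennreal (K * A) * (?T (1 - d / 2) * ennreal (cap_measure e d)))"
      using upper[OF e d(1)] by (intro mult_left_mono) (simp_all add: m.emeasure_eq_measure)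
    also have "\<dots> = ennreal (K * A) * ((?f * ennreal (cap_measure e d)) * ?T (1 - d / 2))" by (simp only: mult_ac)
    also have "(?f * ennreal (cap_measure e d)) * ?T (1 - d / 2)
      = (\<integral>\<^sup>+t. (?f * ennreal (cap_measure e d)) * (ennreal (g t) * indicator {1 - d / 2<..} t) \<partial>norm_law TYPE(complex ^ 'n))"
      by (subst nn_integral_cmult) (auto simp: radial_tail_norm_law[OF g, where 'a="complex ^ 'n", simplified])
    also have "\<dots> \<le> (\<integral>\<^sup>+t. ennreal B * (\<integral>\<^sup>+z. ennreal (g (norm (t *\<^sub>R z))) * ?u (t *\<^sub>R z) \<partial>sphere_measure) \<partial>norm_law TYPE(complex ^ 'n))"
    proof (rule nn_integral_mono_AE, use AE_norm_law in eventually_elim)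
      fix t :: real assume t: "0 < t \<and> t < 1"
      have eq: "(\<integral>\<^sup>+z. ennreal (g (norm (t *\<^sub>R z))) * ?u (t *\<^sub>R z) \<partial>sphere_measure)
        = ennreal (g t) * (\<integral>\<^sup>+z. ?u (t *\<^sub>R z) \<partial>sphere_measure)"
      proof -
        have "(\<integral>\<^sup>+z. ennreal (g (norm (t *\<^sub>R z))) * ?u (t *\<^sub>R z) \<partial>sphere_measure)
          = (\<integral>\<^sup>+z. ennreal (g t) * ?u (t *\<^sub>R z) \<partial>sphere_measure)"
          by (rule nn_integral_cong_AE, use AE_sphere_measure_norm in eventually_elim) (use t in simp)
        then show ?thesis by (simp add: nn_integral_cmult)
      qed
      show "(?f * ennreal (cap_measure e d)) * (ennreal (g t) * indicator {1 - d / 2<..} t)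
        \<le> ennreal B * (\<integral>\<^sup>+z. ennreal (g (norm (t *\<^sub>R z))) * ?u (t *\<^sub>R z) \<partial>sphere_measure)"
      proof (cases "1 - d / 2 < t")
        case True
        have "(?f * ennreal (cap_measure e d)) * ennreal (g t) \<le> (ennreal B * (\<integral>\<^sup>+z. ?u (t *\<^sub>R z) \<partial>sphere_measure)) * ennreal (g t)"
          using True t unfolding B_def by (intro mult_right_mono point_evaluation_sphere F s e d) auto
        then show ?thesis unfolding eq using True by (simp add: mult_ac)
      qed simp
    qed
    also have "\<dots> = ennreal B * (\<integral>\<^sup>+t. \<integral>\<^sup>+z. ennreal (g (norm (t *\<^sub>R z))) * ?u (t *\<^sub>R z) \<partial>sphere_measure \<partial>norm_law TYPE(complex ^ 'n))"
      by (subst nn_integral_cmult) auto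
    also have "(\<integral>\<^sup>+t. \<integral>\<^sup>+z. ennreal (g (norm (t *\<^sub>R z))) * ?u (t *\<^sub>R z) \<partial>sphere_measure \<partial>norm_law TYPE(complex ^ 'n))
      = (\<integral>\<^sup>+z. ennreal (g (norm z)) * ?u z \<partial>unif_ball)"
      by (subst nn_integral_polar) auto
    also have "\<dots> = powr_integral ?m s F"
    proof -
      have "F \<in> borel_measurable (restrict_space borel (ball 0 1))"
        by (intro borel_measurable_continuous_on_restrict holomorphic_on_ball_continuous F)
      then show ?thesis by (subst nn_integral_weight_measure) (auto simp: ball_powr_def)
    qed
    finally show "?f * ennreal (measure ?m (tent e d)) \<le> ennreal (K * A * B) * powr_integral ?m s F"
      using K A B by (simp add: ennreal_mult mult.assoc mult_left_mono)
  qed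
  then show ?thesis by blast
qed

section \<open>Covering by tents\<close>

text \<open>Superadditivity of powers with exponent at least 1. With \<alpha> = q/p this is how the
  condition p \<le> q moves a sum over disjoint tents, or over levels, inside the power.\<close>

lemma sum_powr_le_powr_sum:
  fixes x :: "'i \<Rightarrow> real"
  assumes "finite A" "\<And>i. i \<in> A \<Longrightarrow> 0 \<le> x i" "1 \<le> \<alpha>"
  shows "(\<Sum>i\<in>A. x i powr \<alpha>) \<le> (\<Sum>i\<in>A. x i) powr \<alpha>"
proof -
  let ?S = "\<Sum>i\<in>A. x i"
  have S: "0 \<le> ?S" using assms by (intro sum_nonneg) auto
  have "(\<Sum>i\<in>A. x i powr \<alpha>) \<le> (\<Sum>i\<in>A. x i * ?S powr (\<alpha> - 1))"
  proof (rule sum_mono)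
    fix i assume i: "i \<in> A"
    have "x i powr \<alpha> = x i * x i powr (\<alpha> - 1)" using powr_mult_base[OF assms(2)[OF i], of "\<alpha> - 1"] by simp
    also have "\<dots> \<le> x i * ?S powr (\<alpha> - 1)"
      using assms i by (intro mult_left_mono powr_mono2 member_le_sum) auto
    finally show "x i powr \<alpha> \<le> x i * ?S powr (\<alpha> - 1)" .
  qed
  also have "\<dots> = ?S * ?S powr (\<alpha> - 1)" by (simp add: sum_distrib_right)
  also have "\<dots> = ?S powr \<alpha>" using powr_mult_base[OF S, of "\<alpha> - 1"] by simp
  finally show ?thesis .
qed

text \<open>Geometric growth: the sum of the active terms is at most twice the last active one,
  which is below 2 x.\<close>

lemma sum_dyadic_le:
  fixes c x :: real
  assumes "0 < c" "0 \<le> x"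
  shows "(\<Sum>i<n. if c * 2 ^ i < 2 * x then c * 2 ^ i else 0) \<le> 4 * x"
proof (induction n)
  case (Suc n)
  show ?case
  proof (cases "c * 2 ^ n < 2 * x")
    case True
    have "(\<Sum>i<Suc n. if c * 2 ^ i < 2 * x then c * 2 ^ i else 0) \<le> (\<Sum>i<Suc n. c * 2 ^ i)"
      using assms by (intro sum_mono) auto
    also have "\<dots> = c * (2 ^ Suc n - 1)"
      by (simp only: sum_distrib_left[symmetric]) (simp add: geometric_sum)
    also have "\<dots> \<le> 2 * (c * 2 ^ n)" using assms by (simp add: algebra_simps)
    also have "\<dots> \<le> 4 * x" using True by simp
    finally show ?thesis .
  next
    case False
    then show ?thesis using Suc by simp
  qed
qed (use assms in simp)

text \<open>Greedy selection: a tent of largest size is kept, the induction runs on the tents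
  disjoint from it, and the discarded ones meet a tent at least as large and are absorbed by its
  enlargement.\<close>

lemma finite_vitali_tents:
  assumes "finite P" "\<And>e d. (e, d) \<in> P \<Longrightarrow> norm e = 1 \<and> 0 < d"
  shows "\<exists>P'\<subseteq>P. disjoint_family_on (\<lambda>(e, d). tent e d) P' \<and>
    (\<Union>(e, d)\<in>P. tent e d) \<subseteq> (\<Union>(e, d)\<in>P'. tent e (64 * d))"
  using assms
proof (induction P rule: finite_psubset_induct)
  case (psubset P)
  show ?case
  proof (cases "P = {}")
    case False
    define M where "M = Max (snd ` P)"
    have fin: "finite (snd ` P)" "snd ` P \<noteq> {}" using psubset False by auto
    then have "M \<in> snd ` P" unfolding M_def by (rule Max_in)
    then obtain e where eM: "(e, M) \<in> P" by force
    have le: "d \<le> M" if "(e', d) \<in> P" for e' d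
      unfolding M_def using fin(1) that by (intro Max_ge) (auto simp: rev_image_eqI)
    define P1 where "P1 = {(e', d) \<in> P - {(e, M)}. tent e' d \<inter> tent e M = {}}"
    have "P1 \<subset> P" using eM by (auto simp: P1_def)
    from psubset.IH[OF this] psubset.prems obtain P1' where P1': "P1' \<subseteq> P1"
      "disjoint_family_on (\<lambda>(e, d). tent e d) P1'" "(\<Union>(e, d)\<in>P1. tent e d) \<subseteq> (\<Union>(e, d)\<in>P1'. tent e (64 * d))"
      using \<open>P1 \<subset> P\<close> by (metis (no_types, lifting) psubset_imp_subset subsetD)
    have nM: "norm e = 1" "0 < M" using psubset.prems[OF eM] by auto
    have sub: "tent e' d \<subseteq> (\<Union>(e, d)\<in>insert (e, M) P1'. tent e (64 * d))" if p: "(e', d) \<in> P" for e' d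
    proof (cases "(e', d) \<in> P1")
      case True
      then show ?thesis using P1'(3) by fastforce
    next
      case False
      have "tent e' d \<subseteq> tent e (64 * M)"
      proof (cases "(e', d) = (e, M)")
        case True
        then show ?thesis using nM by (auto intro!: tent_mono)
      next
        case ne: False
        then have "tent e' d \<inter> tent e M \<noteq> {}" using False p by (auto simp: P1_def)
        then obtain w where "w \<in> tent e M" "w \<in> tent e' d" by blast
        then show ?thesis using p psubset.prems nM le by (intro tent_absorb[of e e' d M w]) auto
      qed
      then show ?thesis by auto
    qed
    show ?thesis
    proof (intro exI[of _ "insert (e, M) P1'"] conjI)
      show "insert (e, M) P1' \<subseteq> P" using eM P1'(1) by (auto simp: P1_def)
      show "disjoint_family_on (\<lambda>(e, d). tent e d) (insert (e, M) P1')"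
        using P1'(1,2) unfolding disjoint_family_on_def P1_def by fastforce
      show "(\<Union>(e, d)\<in>P. tent e d) \<subseteq> (\<Union>(e, d)\<in>insert (e, M) P1'. tent e (64 * d))"
        using sub by blast
    qed
  qed (auto simp: disjoint_family_on_def)
qed

context tent_doubling_measure
begin

lemma space_m: "space m = ball 0 1"
  using sets_eq_imp_space_eq[OF sets_m] by (simp add: space_restrict_space)

lemma sets_tent [measurable, simp]: "tent e d \<in> sets m"
  by (simp add: sets_m sets_restrict_space_iff tent_subset_ball)

lemma tent_double_power:
  assumes "norm e = 1" "0 < d"
  shows "measure m (tent e (2 ^ k * d)) \<le> L ^ k * measure m (tent e d)"
proof (induction k)
  case (Suc k)
  have "measure m (tent e (2 * (2 ^ k * d))) \<le> L * measure m (tent e (2 ^ k * d))"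
    using assms by (intro tent_double) auto
  also have "\<dots> \<le> L * (L ^ k * measure m (tent e d))" using Suc L_pos by (intro mult_left_mono) auto
  finally show ?case by (simp add: mult_ac)
qed simp

text \<open>Finitely many doublings reach the whole ball, which has positive measure.\<close>

lemma tent_measure_pos:
  assumes "norm e = 1" "0 < d"
  shows "0 < measure m (tent e d)"
proof -
  obtain k where "2 / d < 2 ^ k" using real_arch_pow[of 2 "2 / d"] by auto
  then have "2 \<le> 2 ^ k * d" using assms by (simp add: field_simps)
  then have "tent e (2 ^ k * d) = ball 0 1" by (intro tent_eq_ball assms)
  then have "0 < L ^ k * measure m (tent e d)" using tent_double_power[OF assms, of k] m_ball_pos by simp
  then show ?thesis using L_pos by (simp add: zero_less_mult_iff)
qed

text \<open>The auxiliary measure \<nu> majorises m on the given tents; in the applications it is a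
  restriction of m or a density built from f. Disjointness sums \<nu> over the selected tents, and
  L^6 pays for the 64-fold enlargement.\<close>

lemma covering_estimate_finite:
  assumes sets_\<mu>: "sets \<mu> = sets m" and "finite P" and P: "\<And>e d. (e, d) \<in> P \<Longrightarrow> norm e = 1 \<and> 0 < d"
    and \<nu>: "finite_measure \<nu>" "sets \<nu> = sets m" "\<And>e d. (e, d) \<in> P \<Longrightarrow> measure m (tent e d) \<le> measure \<nu> (tent e d)"
    and \<mu>: "\<And>e d. (e, d) \<in> P \<Longrightarrow> emeasure \<mu> (tent e (64 * d)) \<le> ennreal (N * measure m (tent e (64 * d)) powr \<alpha>)"
    and N: "0 \<le> N" "1 \<le> \<alpha>"
  shows "emeasure \<mu> (\<Union>(e, d)\<in>P. tent e d) \<le> ennreal (N * (L ^ 6 * measure \<nu> (space \<nu>)) powr \<alpha>)"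
proof -
  interpret \<nu>: finite_measure \<nu> by fact
  obtain P' where P': "P' \<subseteq> P" "disjoint_family_on (\<lambda>(e, d). tent e d) P'"
    "(\<Union>(e, d)\<in>P. tent e d) \<subseteq> (\<Union>(e, d)\<in>P'. tent e (64 * d))"
    using finite_vitali_tents[OF \<open>finite P\<close> P] by blast
  have fin: "finite P'" using P'(1) \<open>finite P\<close> finite_subset by blast
  have [simp]: "tent e d \<in> sets \<mu>" "tent e d \<in> sets \<nu>" for e d using sets_\<mu> \<nu>(2) by auto
  have "emeasure \<mu> (\<Union>(e, d)\<in>P. tent e d) \<le> emeasure \<mu> (\<Union>x\<in>P'. tent (fst x) (64 * snd x))"
    using P'(3) fin by (intro emeasure_mono) (auto simp: case_prod_beta)
  also have "\<dots> \<le> (\<Sum>x\<in>P'. emeasure \<mu> (tent (fst x) (64 * snd x)))"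
    using fin by (intro emeasure_subadditive_finite) auto
  also have "\<dots> \<le> (\<Sum>x\<in>P'. ennreal (N * (L ^ 6 * measure \<nu> (tent (fst x) (snd x))) powr \<alpha>))"
  proof (rule sum_mono)
    fix x assume "x \<in> P'"
    then have x: "(fst x, snd x) \<in> P" using P'(1) by auto
    have "measure m (tent (fst x) (2 ^ 6 * snd x)) \<le> L ^ 6 * measure m (tent (fst x) (snd x))"
      using P[OF x] by (intro tent_double_power) auto
    also have "\<dots> \<le> L ^ 6 * measure \<nu> (tent (fst x) (snd x))"
      using L_pos \<nu>(3)[OF x] by (intro mult_left_mono) auto
    finally have "N * measure m (tent (fst x) (64 * snd x)) powr \<alpha> \<le> N * (L ^ 6 * measure \<nu> (tent (fst x) (snd x))) powr \<alpha>"
      using N by (intro mult_left_mono powr_mono2) auto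
    then show "emeasure \<mu> (tent (fst x) (64 * snd x)) \<le> ennreal (N * (L ^ 6 * measure \<nu> (tent (fst x) (snd x))) powr \<alpha>)"
      using \<mu>[OF x] by (meson ennreal_leI order_trans)
  qed
  also have "\<dots> = ennreal (\<Sum>x\<in>P'. N * (L ^ 6 * measure \<nu> (tent (fst x) (snd x))) powr \<alpha>)"
    using N by (intro sum_ennreal) auto
  also have "\<dots> \<le> ennreal (N * (L ^ 6 * measure \<nu> (space \<nu>)) powr \<alpha>)"
  proof (rule ennreal_leI)
    have "(\<Sum>x\<in>P'. N * (L ^ 6 * measure \<nu> (tent (fst x) (snd x))) powr \<alpha>)
      \<le> N * (\<Sum>x\<in>P'. L ^ 6 * measure \<nu> (tent (fst x) (snd x))) powr \<alpha>"
      unfolding sum_distrib_left[symmetric, of N] using fin N L_pos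
      by (intro mult_left_mono sum_powr_le_powr_sum) auto
    also have "(\<Sum>x\<in>P'. measure \<nu> (tent (fst x) (snd x))) = measure \<nu> (\<Union>x\<in>P'. tent (fst x) (snd x))"
      using P'(2) fin by (intro \<nu>.finite_measure_finite_Union[symmetric]) (auto simp: case_prod_unfold)
    then have "(\<Sum>x\<in>P'. L ^ 6 * measure \<nu> (tent (fst x) (snd x))) \<le> L ^ 6 * measure \<nu> (space \<nu>)"
      unfolding sum_distrib_left[symmetric] using L_pos by (simp add: \<nu>.bounded_measure)
    then have "N * (\<Sum>x\<in>P'. L ^ 6 * measure \<nu> (tent (fst x) (snd x))) powr \<alpha> \<le> N * (L ^ 6 * measure \<nu> (space \<nu>)) powr \<alpha>"
      using N L_pos by (intro mult_left_mono powr_mono2 sum_nonneg) auto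
    finally show "(\<Sum>x\<in>P'. N * (L ^ 6 * measure \<nu> (tent (fst x) (snd x))) powr \<alpha>) \<le> N * (L ^ 6 * measure \<nu> (space \<nu>)) powr \<alpha>" .
  qed
  finally show ?thesis .
qed

text \<open>The finite bound does not depend on the number of tents. Tents are open, so Lindelof
  leaves a countable family with the same union, and continuity from below reduces that to finite
  ones.\<close>

lemma covering_estimate:
  assumes sets_\<mu>: "sets \<mu> = sets m" and P: "\<And>e d. (e, d) \<in> P \<Longrightarrow> norm e = 1 \<and> 0 < d"
    and \<nu>: "finite_measure \<nu>" "sets \<nu> = sets m" "\<And>e d. (e, d) \<in> P \<Longrightarrow> measure m (tent e d) \<le> measure \<nu> (tent e d)"
    and \<mu>: "\<And>e d. (e, d) \<in> P \<Longrightarrow> emeasure \<mu> (tent e (64 * d)) \<le> ennreal (N * measure m (tent e (64 * d)) powr \<alpha>)"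
    and N: "0 \<le> N" "1 \<le> \<alpha>"
  shows "emeasure \<mu> (\<Union>(e, d)\<in>P. tent e d) \<le> ennreal (N * (L ^ 6 * measure \<nu> (space \<nu>)) powr \<alpha>)"
proof -
  let ?t = "\<lambda>(e, d). tent e d"
  have "\<And>S. S \<in> ?t ` P \<Longrightarrow> open S" by auto
  then obtain F where F: "F \<subseteq> ?t ` P" "countable F" "\<Union>F = \<Union>(?t ` P)" by (rule Lindelof)
  obtain P0 where P0: "P0 \<subseteq> P" "countable P0" "F = ?t ` P0"
    using F(1,2) by (metis countable_subset_image)
  show ?thesis
  proof (cases "P0 = {}")
    case True
    then show ?thesis using F(3) P0(3) by simp
  next
    case False
    define Q where "Q k = from_nat_into P0 ` {..k}" for k :: nat
    have Q: "finite (Q k)" "Q k \<subseteq> P" for k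
      using P0(1) from_nat_into[OF False] by (auto simp: Q_def)
    have inc: "incseq (\<lambda>k. \<Union>(?t ` Q k))" unfolding incseq_def Q_def by (intro allI impI Union_mono image_mono) auto
    have un: "(\<Union>k. \<Union>(?t ` Q k)) = \<Union>(?t ` P)"
    proof -
      have "(\<Union>k. Q k) = P0"
      proof -
        have "(\<Union>k. Q k) = range (from_nat_into P0)" by (auto simp: Q_def)
        then show ?thesis using range_from_nat_into[OF False P0(2)] by simp
      qed
      then have "\<Union>(?t ` P0) = (\<Union>k. \<Union>(?t ` Q k))" by blast
      then show ?thesis using F(3) P0(3) by simp
    qed
    have st: "?t x \<in> sets \<mu>" for x using sets_\<mu> by (auto simp: case_prod_beta)
    have "emeasure \<mu> (\<Union>(?t ` P)) = (SUP k. emeasure \<mu> (\<Union>(?t ` Q k)))"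
      unfolding un[symmetric] using inc Q(1) st by (intro SUP_emeasure_incseq[symmetric]) auto
    also have "\<dots> \<le> ennreal (N * (L ^ 6 * measure \<nu> (space \<nu>)) powr \<alpha>)"
    proof (rule SUP_least)
      fix k
      have sub: "\<And>e d. (e, d) \<in> Q k \<Longrightarrow> (e, d) \<in> P" using Q(2) by blast
      show "emeasure \<mu> (\<Union>(?t ` Q k)) \<le> ennreal (N * (L ^ 6 * measure \<nu> (space \<nu>)) powr \<alpha>)"
        by (rule covering_estimate_finite[OF sets_\<mu> Q(1) _ \<nu>(1,2)]) (use sub P \<nu>(3) \<mu> N in blast)+
    qed
    finally show ?thesis .
  qed
qed

text \<open>Tents larger than the collar \<open>1 - h < \<bar>z\<bar>\<close> are covered by tents of size comparable to \<open>h\<close>.\<close>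

lemma tent_collar_estimate:
  assumes sets_\<mu>: "sets \<mu> = sets m" and h: "0 < h"
    and \<mu>: "\<And>e d. norm e = 1 \<Longrightarrow> 0 < d \<Longrightarrow> d \<le> 128 * h \<Longrightarrow> emeasure \<mu> (tent e d) \<le> ennreal (N * measure m (tent e d) powr \<alpha>)"
    and N: "0 \<le> N" "1 \<le> \<alpha>" and e: "norm e = 1" "0 < d"
  shows "emeasure \<mu> (tent e d \<inter> {z. 1 - h < norm z}) \<le> ennreal (N * (max 1 (L ^ 12)) powr \<alpha> * measure m (tent e d) powr \<alpha>)"
proof (cases "d \<le> 128 * h")
  case True
  have c: "1 \<le> max 1 (L ^ 12) powr \<alpha>" using N(2) by (intro ge_one_powr_ge_zero) auto
  have "emeasure \<mu> (tent e d \<inter> {z. 1 - h < norm z}) \<le> emeasure \<mu> (tent e d)"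
    using sets_\<mu> by (intro emeasure_mono) auto
  also have "\<dots> \<le> ennreal (N * measure m (tent e d) powr \<alpha>)" by (rule \<mu>[OF e True])
  also have "\<dots> \<le> ennreal (N * (max 1 (L ^ 12)) powr \<alpha> * measure m (tent e d) powr \<alpha>)"
    using N c by (intro ennreal_leI mult_right_mono) (auto simp: mult_le_cancel_left1)
  finally show ?thesis .
next
  case False
  \<comment> \<open>A point z of the collar lies in the tent of size 2 h at its own direction e',
    since |1 - <z,e'>| = 1 - |z| < h. Enlarging by 64 gives 128 h, the range of the hypothesis. All
    these tents lie in the tent of size 64 d, to which m is restricted; L^12 is L^6 for the covering
    and L^6 for returning from 64 d to d.\<close>
  define P where "P = {(e', 2 * h) | e'. norm e' = 1 \<and> tent e' (2 * h) \<inter> tent e d \<noteq> {}}"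
  let ?T = "tent e (64 * d)"
  let ?\<nu> = "density m (indicator ?T)"
  have em\<nu>: "emeasure ?\<nu> A = emeasure m (?T \<inter> A)" if "A \<in> sets m" for A
    using that by (subst emeasure_restricted) auto
  have fin: "finite_measure ?\<nu>"
    by (rule finite_measureI) (auto simp: em\<nu>[OF sets.top, simplified] emeasure_eq_measure)
  have sub: "tent e' (2 * h) \<subseteq> ?T" if e': "norm e' = 1" "tent e' (2 * h) \<inter> tent e d \<noteq> {}" for e'
  proof -
    from e' obtain w where "w \<in> tent e d" "w \<in> tent e' (2 * h)" by blast
    then show ?thesis using e e' h False by (intro tent_absorb[of e e' "2 * h" d w]) auto
  qed
  have "tent e d \<inter> {z. 1 - h < norm z} \<subseteq> (\<Union>(e', d')\<in>P. tent e' d')"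
  proof
    fix z assume z: "z \<in> tent e d \<inter> {z. 1 - h < norm z}"
    obtain e' where e': "norm e' = 1" "z = norm z *\<^sub>R e'"
      by (rule obtain_direction)
    have "hinner z e' = of_real (norm z)" by (subst e'(2)) (simp add: hinner_scaleR_left hinner_self e'(1))
    then have "cmod (1 - hinner z e') = \<bar>1 - norm z\<bar>" by (metis norm_of_real of_real_1 of_real_diff)
    moreover have "norm z < 1" using z by (simp add: tent_def)
    ultimately have "z \<in> tent e' (2 * h)" using z h by (simp add: tent_def)
    then show "z \<in> (\<Union>(e', d')\<in>P. tent e' d')" using z e' unfolding P_def by blast
  qed
  then have "emeasure \<mu> (tent e d \<inter> {z. 1 - h < norm z}) \<le> emeasure \<mu> (\<Union>(e', d')\<in>P. tent e' d')"
  proof (rule emeasure_mono)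
    have "open (\<Union>(e', d')\<in>P. tent e' d')" by auto
    moreover have "(\<Union>(e', d')\<in>P. tent e' d') \<subseteq> ball 0 1" using tent_subset_ball by fastforce
    ultimately show "(\<Union>(e', d')\<in>P. tent e' d') \<in> sets \<mu>"
      by (simp add: sets_\<mu> sets_m sets_restrict_space_iff)
  qed
  also have "\<dots> \<le> ennreal (N * (L ^ 6 * measure ?\<nu> (space ?\<nu>)) powr \<alpha>)"
  proof (rule covering_estimate[OF sets_\<mu> _ fin])
    fix e' d' assume p: "(e', d') \<in> P"
    then have p': "norm e' = 1" "d' = 2 * h" "tent e' (2 * h) \<inter> tent e d \<noteq> {}" by (auto simp: P_def)
    then show "norm e' = 1 \<and> 0 < d'" using h by simp
    have "?T \<inter> tent e' d' = tent e' d'" using sub[OF p'(1,3)] p'(2) by auto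
    then show "measure m (tent e' d') \<le> measure ?\<nu> (tent e' d')" by (simp add: measure_def em\<nu>)
    show "emeasure \<mu> (tent e' (64 * d')) \<le> ennreal (N * measure m (tent e' (64 * d')) powr \<alpha>)"
      using p' h by (intro \<mu>) auto
  qed (use N in auto)
  also have "\<dots> \<le> ennreal (N * (max 1 (L ^ 12)) powr \<alpha> * measure m (tent e d) powr \<alpha>)"
  proof (rule ennreal_leI)
    have "measure ?\<nu> (space ?\<nu>) = measure m ?T" by (simp add: measure_def em\<nu>[OF sets.top])
    also have "\<dots> \<le> L ^ 6 * measure m (tent e d)" using tent_double_power[OF e, of 6] by simp
    finally have "L ^ 6 * measure ?\<nu> (space ?\<nu>) \<le> L ^ 6 * (L ^ 6 * measure m (tent e d))"
      using L_pos by (intro mult_left_mono) auto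
    also have "\<dots> = L ^ 12 * measure m (tent e d)" by (simp add: mult.assoc[symmetric] power_add[symmetric])
    also have "\<dots> \<le> max 1 (L ^ 12) * measure m (tent e d)" by (intro mult_right_mono) auto
    finally have "N * (L ^ 6 * measure ?\<nu> (space ?\<nu>)) powr \<alpha> \<le> N * (max 1 (L ^ 12) * measure m (tent e d)) powr \<alpha>"
      using N L_pos by (intro mult_left_mono powr_mono2) auto
    then show "N * (L ^ 6 * measure ?\<nu> (space ?\<nu>)) powr \<alpha> \<le> N * (max 1 (L ^ 12)) powr \<alpha> * measure m (tent e d) powr \<alpha>"
      by (simp add: powr_mult mult.assoc)
  qed
  finally show ?thesis .
qed

end

section \<open>Test functions\<close>

lemma holomorphic_on_ball_mult:
  fixes f g :: "complex ^ 'n::finite \<Rightarrow> complex"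
  assumes "holomorphic_on_ball f" "holomorphic_on_ball g"
  shows "holomorphic_on_ball (\<lambda>z. f z * g z)"
  unfolding holomorphic_on_ball_def
proof
  fix z :: "complex ^ 'n" assume z: "z \<in> ball 0 1"
  obtain f' where f': "(f has_derivative f') (at z)" "\<forall>c v. f' (c *s v) = c * f' v"
    using assms(1) z unfolding holomorphic_on_ball_def by blast
  obtain g' where g': "(g has_derivative g') (at z)" "\<forall>c v. g' (c *s v) = c * g' v"
    using assms(2) z unfolding holomorphic_on_ball_def by blast
  show "\<exists>h. ((\<lambda>z. f z * g z) has_derivative h) (at z) \<and> (\<forall>c v. h (c *s v) = c * h v)"
    using has_derivative_mult[OF f'(1) g'(1)] f'(2) g'(2)
    by (intro exI[of _ "\<lambda>h. f z * g' h + f' h * g z"]) (auto simp: algebra_simps)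
qed

lemma holomorphic_on_ball_diff:
  fixes f g :: "complex ^ 'n::finite \<Rightarrow> complex"
  assumes "holomorphic_on_ball f" "holomorphic_on_ball g"
  shows "holomorphic_on_ball (\<lambda>z. f z - g z)"
  unfolding holomorphic_on_ball_def
proof
  fix z :: "complex ^ 'n" assume z: "z \<in> ball 0 1"
  obtain f' where f': "(f has_derivative f') (at z)" "\<forall>c v. f' (c *s v) = c * f' v"
    using assms(1) z unfolding holomorphic_on_ball_def by blast
  obtain g' where g': "(g has_derivative g') (at z)" "\<forall>c v. g' (c *s v) = c * g' v"
    using assms(2) z unfolding holomorphic_on_ball_def by blast
  show "\<exists>h. ((\<lambda>z. f z - g z) has_derivative h) (at z) \<and> (\<forall>c v. h (c *s v) = c * h v)"
    using has_derivative_diff[OF f'(1) g'(1)] f'(2) g'(2)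
    by (intro exI[of _ "\<lambda>h. f' h - g' h"]) (auto simp: algebra_simps)
qed

lemma holomorphic_on_ball_const: "holomorphic_on_ball (\<lambda>_. c)"
  unfolding holomorphic_on_ball_def by (auto intro!: exI[of _ "\<lambda>_. 0"])

lemma holomorphic_on_ball_power: "holomorphic_on_ball f \<Longrightarrow> holomorphic_on_ball (\<lambda>z. f z ^ k)"
  by (induction k) (auto intro: holomorphic_on_ball_const holomorphic_on_ball_mult)

lemma one_minus_hinner_lower:
  assumes "norm e = 1" "0 < d" "d \<le> 1" "norm w < 1"
  shows "d \<le> cmod (1 - hinner w ((1 - d) *\<^sub>R e))"
    and "cmod (1 - hinner w e) \<le> 2 * cmod (1 - hinner w ((1 - d) *\<^sub>R e))"
proof -
  let ?a = "(1 - d) *\<^sub>R e"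
  have na: "norm ?a = 1 - d" using assms by simp
  have "cmod (hinner w ?a) \<le> norm w * (1 - d)" using hinner_Cauchy_Schwarz[of w ?a] na by simp
  also have "\<dots> \<le> 1 * (1 - d)" using assms by (intro mult_right_mono) auto
  finally have "cmod (hinner w ?a) \<le> 1 - d" by simp
  moreover have "1 - cmod (hinner w ?a) \<le> cmod (1 - hinner w ?a)" using norm_triangle_ineq2[of 1 "hinner w ?a"] by simp
  ultimately show 1: "d \<le> cmod (1 - hinner w ?a)" by linarith
  have "hinner w e = hinner w ?a + of_real d * hinner w e" by (simp only: hinner_scaleR_right) (simp add: algebra_simps)
  then have "1 - hinner w e = (1 - hinner w ?a) - of_real d * hinner w e" by (simp add: algebra_simps)
  then have "cmod (1 - hinner w e) \<le> cmod (1 - hinner w ?a) + cmod (of_real d * hinner w e)" by (metis norm_triangle_ineq4)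
  moreover have "cmod (of_real d * hinner w e) \<le> d"
  proof -
    have "cmod (hinner w e) \<le> 1" using hinner_Cauchy_Schwarz[of w e] assms by simp
    then have "d * cmod (hinner w e) \<le> d * 1" using assms by (intro mult_left_mono) auto
    then show ?thesis using assms by (simp add: norm_mult)
  qed
  ultimately show "cmod (1 - hinner w e) \<le> 2 * cmod (1 - hinner w ?a)" using 1 by linarith
qed

text \<open>A kernel with pole outside the ball on the axis of e, scaled so that for 0 < d \<le> 1
  its modulus is at most 1 on the ball and at least 1/3 on the tent of size 2 d. Only integer powers
  are taken, so no branch has to be chosen.\<close>

definition test_fun :: "complex ^ 'n::finite \<Rightarrow> real \<Rightarrow> complex ^ 'n \<Rightarrow> complex" where
  "test_fun e d w = of_real d / (1 - hinner w ((1 - d) *\<^sub>R e))"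

lemma holomorphic_test_fun:
  fixes e :: "complex ^ 'n::finite"
  assumes e: "norm e = 1" "0 < d" "d \<le> 1"
  shows "holomorphic_on_ball (test_fun e d)"
  unfolding holomorphic_on_ball_def
proof
  fix z :: "complex ^ 'n" assume z: "z \<in> ball 0 1"
  let ?a = "(1 - d) *\<^sub>R e" and ?q = "1 - hinner z ((1 - d) *\<^sub>R e)"
  have nz: "?q \<noteq> 0"
    using one_minus_hinner_lower(1)[OF e, of z] z e by auto
  have "linear (\<lambda>w. hinner w ?a)"
    by (rule linearI) (simp_all add: hinner_add_left hinner_scaleR_left scaleR_conv_of_real[where 'a=complex])
  then have "((\<lambda>w. hinner w ?a) has_derivative (\<lambda>w. hinner w ?a)) (at z)"
    by (intro bounded_linear_imp_has_derivative linear_conv_bounded_linear[THEN iffD1])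
  then have "((\<lambda>w. 1 - hinner w ?a) has_derivative (\<lambda>h. 0 - hinner h ?a)) (at z)"
    by (intro has_derivative_diff has_derivative_const)
  from has_derivative_divide[OF has_derivative_const[of "complex_of_real d"] this nz]
  have "((\<lambda>w. of_real d / (1 - hinner w ?a)) has_derivative (\<lambda>h. - of_real d * (inverse ?q * (0 - hinner h ?a) * inverse ?q) + 0 / ?q)) (at z)"
    by simp
  then show "\<exists>f'. (test_fun e d has_derivative f') (at z) \<and> (\<forall>c v. f' (c *s v) = c * f' v)"
    unfolding test_fun_def[abs_def]
    by (intro exI[of _ "\<lambda>h. - of_real d * (inverse ?q * (0 - hinner h ?a) * inverse ?q) + 0 / ?q"])
       (auto simp: hinner_smult_left)
qed

lemma cmod_test_fun: "0 < d \<Longrightarrow> cmod (test_fun e d w) = d / cmod (1 - hinner w ((1 - d) *\<^sub>R e))"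
  by (simp add: test_fun_def norm_divide)

lemma cmod_test_fun_le_1:
  assumes "norm e = 1" "0 < d" "d \<le> 1" "norm w < 1"
  shows "cmod (test_fun e d w) \<le> 1"
  using one_minus_hinner_lower(1)[OF assms] assms by (simp add: cmod_test_fun divide_le_eq)

lemma test_fun_nonzero:
  assumes "norm e = 1" "0 < d" "d \<le> 1" "norm w < 1"
  shows "test_fun e d w \<noteq> 0"
  using one_minus_hinner_lower(1)[OF assms] assms by (auto simp: test_fun_def)

lemma cmod_test_fun_power_powr:
  fixes M :: nat and s :: real
  assumes "norm e = 1" "0 < d" "d \<le> 1" "norm w < 1"
  shows "cmod (test_fun e d w ^ M) powr s = cmod (test_fun e d w) powr (M * s)"
  using test_fun_nonzero[OF assms] by (simp add: norm_power powr_powr powr_realpow[symmetric])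

lemma test_fun_center:
  assumes "norm e = 1" "0 < d" "d \<le> 1"
  shows "1 / 2 \<le> cmod (test_fun e d ((1 - d) *\<^sub>R e))"
proof -
  have "1 - hinner ((1 - d) *\<^sub>R e) ((1 - d) *\<^sub>R e) = of_real (d * (2 - d))"
    by (simp only: hinner_self norm_scaleR assms mult_1_right power2_abs) (simp add: power2_eq_square algebra_simps)
  then have "cmod (1 - hinner ((1 - d) *\<^sub>R e) ((1 - d) *\<^sub>R e)) = d * (2 - d)"
    using assms by (simp only: norm_of_real) simp
  then have "cmod (test_fun e d ((1 - d) *\<^sub>R e)) = 1 / (2 - d)" using assms by (simp add: cmod_test_fun)
  moreover have "1 / 2 \<le> 1 / (2 - d)" using assms by (simp add: divide_simps)
  ultimately show ?thesis by simp
qed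

text \<open>Let k0 be the first k with w in the tent of size 2^(k+1) d. Lying outside the previous
  tent forces |1 - <w,(1-d)e>| \<ge> 2^(k0-1) d, so the kernel is at most 2 times 2^(-k0); for k0 =
  0 the bound 1 serves.\<close>

lemma test_fun_le_tent_sum:
  assumes e: "norm e = 1" "0 < d" "d \<le> 1" and w: "norm w < 1" and b: "0 \<le> b"
  shows "ennreal (cmod (test_fun e d w) powr b)
    \<le> (\<Sum>k. ennreal (2 powr b * (2 powr - b) ^ k) * indicator (tent e (2 ^ Suc k * d)) w)"
proof -
  let ?t = "\<lambda>k. ennreal (2 powr b * (2 powr - b) ^ k) * indicator (tent e (2 ^ Suc k * d)) w"
  let ?x = "cmod (test_fun e d w)"
  obtain k where "2 / d < 2 ^ k" using real_arch_pow[of 2 "2 / d"] by auto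
  then have "2 \<le> 2 ^ Suc k * d" using e by (simp add: field_simps)
  then have "tent e (2 ^ Suc k * d) = ball 0 1" by (intro tent_eq_ball e)
  then have ex: "w \<in> tent e (2 ^ Suc k * d)" using w by simp
  define k0 where "k0 = (LEAST k. w \<in> tent e (2 ^ Suc k * d))"
  have k0: "w \<in> tent e (2 ^ Suc k0 * d)" unfolding k0_def by (rule LeastI[where k=k]) (rule ex)
  have "?x powr b \<le> 2 powr b * (2 powr - b) ^ k0"
  proof (cases k0)
    case 0
    have "?x powr b \<le> 1 powr b" using cmod_test_fun_le_1[OF e w] b by (intro powr_mono2) auto
    also have "\<dots> \<le> 2 powr b" using b by (simp add: ge_one_powr_ge_zero)
    finally show ?thesis using 0 by simp
  next
    case (Suc j)
    have "w \<notin> tent e (2 ^ Suc j * d)" using not_less_Least[of j "\<lambda>k. w \<in> tent e (2 ^ Suc k * d)"] Suc by (simp add: k0_def)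
    then have "2 ^ Suc j * d \<le> cmod (1 - hinner w e)" using w by (simp add: tent_def)
    also have "\<dots> \<le> 2 * cmod (1 - hinner w ((1 - d) *\<^sub>R e))" by (rule one_minus_hinner_lower(2)[OF e w])
    finally have "2 ^ j * d \<le> cmod (1 - hinner w ((1 - d) *\<^sub>R e))" by simp
    moreover have "0 < 2 ^ j * d" using e by simp
    ultimately have "?x \<le> d / (2 ^ j * d)" unfolding cmod_test_fun[OF e(2)] using e
      by (intro frac_le) auto
    then have "?x \<le> 2 * (1 / 2) ^ k0" using e Suc by (simp add: power_divide)
    then have "?x powr b \<le> (2 * (1 / 2) ^ k0) powr b" using b by (intro powr_mono2) auto
    also have "\<dots> = 2 powr b * (2 powr - b) ^ k0"
    proof -
      have "((1 / 2) ^ k0) powr b = (2 powr - b) ^ k0"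
        by (simp add: powr_minus powr_power powr_realpow[symmetric] powr_powr powr_divide divide_simps mult.commute)
      then show ?thesis by (simp add: powr_mult)
    qed
    finally show ?thesis .
  qed
  then have "ennreal (?x powr b) \<le> ?t k0" using k0 by (simp add: ennreal_leI)
  also have "f k0 \<le> (\<Sum>k. f k)" for f :: "nat \<Rightarrow> ennreal"
    using sum_le_suminf[of f "{k0}"] by simp
  then have "?t k0 \<le> (\<Sum>k. ?t k)" .
  finally show ?thesis .
qed

context tent_doubling_measure
begin

lemma borel_measurable_m:
  assumes "continuous_on (ball 0 1) f" shows "f \<in> borel_measurable m"
  using borel_measurable_continuous_on_restrict[OF assms] measurable_cong_sets[OF sets_m refl] by blast

lemma borel_measurable_holomorphic [measurable]: "holomorphic_on_ball f \<Longrightarrow> f \<in> borel_measurable m"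
  by (intro borel_measurable_m holomorphic_on_ball_continuous)

text \<open>Each doubling of the tent raises its measure by at most the factor L, while the kernel
  power drops by 2^(-b). The condition 2 L \<le> 2^b makes the ratio at most 1/2, so the tents sum
  geometrically to a multiple of the smallest one.\<close>

lemma kernel_integral:
  assumes e: "norm e = 1" "0 < d" "d \<le> 1" and b: "0 \<le> b" "2 * L \<le> 2 powr b" and \<Lambda>: "0 \<le> \<Lambda>"
    and [measurable]: "\<psi> \<in> borel_measurable m"
    and avg: "\<And>k. (\<integral>\<^sup>+w. \<psi> w * indicator (tent e (2 ^ Suc k * d)) w \<partial>m) \<le> ennreal (\<Lambda> * measure m (tent e (2 ^ Suc k * d)))"
  shows "(\<integral>\<^sup>+w. \<psi> w * ennreal (cmod (test_fun e d w) powr b) \<partial>m) \<le> ennreal (\<Lambda> * (2 powr b * L * 2) * measure m (tent e d))"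
proof -
  let ?c = "\<lambda>k. 2 powr b * (2 powr - b) ^ k"
  have "(\<integral>\<^sup>+w. \<psi> w * ennreal (cmod (test_fun e d w) powr b) \<partial>m)
    \<le> (\<integral>\<^sup>+w. (\<Sum>k. ennreal (?c k) * (\<psi> w * indicator (tent e (2 ^ Suc k * d)) w)) \<partial>m)"
  proof (rule nn_integral_mono)
    fix w assume "w \<in> space m"
    then have w: "norm w < 1" by (simp add: space_m)
    have "\<psi> w * ennreal (cmod (test_fun e d w) powr b)
      \<le> \<psi> w * (\<Sum>k. ennreal (?c k) * indicator (tent e (2 ^ Suc k * d)) w)"
      by (intro mult_left_mono test_fun_le_tent_sum e w b) auto
    also have "\<dots> = (\<Sum>k. ennreal (?c k) * (\<psi> w * indicator (tent e (2 ^ Suc k * d)) w))"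
      by (subst ennreal_suminf_cmult[symmetric]) (simp add: mult_ac)
    finally show "\<psi> w * ennreal (cmod (test_fun e d w) powr b)
      \<le> (\<Sum>k. ennreal (?c k) * (\<psi> w * indicator (tent e (2 ^ Suc k * d)) w))" .
  qed
  also have "\<dots> = (\<Sum>k. ennreal (?c k) * (\<integral>\<^sup>+w. \<psi> w * indicator (tent e (2 ^ Suc k * d)) w \<partial>m))"
    by (subst nn_integral_suminf) (auto simp: nn_integral_cmult)
  also have "\<dots> \<le> (\<Sum>k. ennreal (\<Lambda> * (2 powr b * L) * measure m (tent e d) * (1 / 2) ^ k))"
  proof (intro suminf_le summableI)
    fix k
    have "L * 2 powr - b \<le> 1 / 2" using b(2) by (simp add: powr_minus field_simps)
    then have lk: "(L * 2 powr - b) ^ k \<le> (1 / 2) ^ k" using L_pos by (intro power_mono) auto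
    have "ennreal (?c k) * (\<integral>\<^sup>+w. \<psi> w * indicator (tent e (2 ^ Suc k * d)) w \<partial>m)
      \<le> ennreal (?c k) * ennreal (\<Lambda> * measure m (tent e (2 ^ Suc k * d)))"
      by (intro mult_left_mono avg) auto
    also have "\<dots> = ennreal (?c k * (\<Lambda> * measure m (tent e (2 ^ Suc k * d))))"
      using \<Lambda> by (simp add: ennreal_mult)
    also have "\<dots> \<le> ennreal (?c k * (\<Lambda> * (L ^ Suc k * measure m (tent e d))))"
      using \<Lambda> by (intro ennreal_leI mult_left_mono tent_double_power e) auto
    also have "?c k * (\<Lambda> * (L ^ Suc k * measure m (tent e d)))
      = \<Lambda> * (2 powr b * L) * measure m (tent e d) * (L * 2 powr - b) ^ k"
      by (simp add: power_mult_distrib)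
    also have "ennreal \<dots> \<le> ennreal (\<Lambda> * (2 powr b * L) * measure m (tent e d) * (1 / 2) ^ k)"
      using \<Lambda> L_pos lk by (intro ennreal_leI mult_left_mono) auto
    finally show "ennreal (?c k) * (\<integral>\<^sup>+w. \<psi> w * indicator (tent e (2 ^ Suc k * d)) w \<partial>m)
      \<le> ennreal (\<Lambda> * (2 powr b * L) * measure m (tent e d) * (1 / 2) ^ k)" .
  qed
  also have "\<dots> = ennreal (\<Lambda> * (2 powr b * L) * measure m (tent e d) * 2)"
    using \<Lambda> L_pos sums_mult[OF geometric_sums[of "1 / 2 :: real"], of "\<Lambda> * (2 powr b * L) * measure m (tent e d)"]
    by (intro suminf_ennreal_eq) auto
  finally show ?thesis by (simp add: mult_ac)
qed

lemma test_fun_integral: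
  assumes e: "norm e = 1" "0 < d" "d \<le> 1" and b: "0 \<le> b" "2 * L \<le> 2 powr b"
  shows "(\<integral>\<^sup>+w. ennreal (cmod (test_fun e d w) powr b) \<partial>m) \<le> ennreal ((2 powr b * L * 2) * measure m (tent e d))"
  using kernel_integral[OF e b, of 1 "\<lambda>_. 1"] by (simp add: emeasure_eq_measure)

text \<open>Applying point evaluation to the product of \<open>f\<close> and a power of the test function peaking at the point
  bounds \<open>f\<close> by its averages over the tents above that point.\<close>

lemma tent_average_large:
  fixes M :: nat and s b \<Lambda> :: real
  assumes f: "holomorphic_on_ball f" and s: "0 < s" and b: "b = M * s" "2 * L \<le> 2 powr b" and \<Lambda>: "0 \<le> \<Lambda>"
    and z: "z \<in> ball 0 1" and large: "\<Lambda> * (C * 4 powr b * (2 * L)) < cmod (f z) powr s"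
  shows "\<exists>e d. norm e = 1 \<and> 0 < d \<and> z \<in> tent e d \<and>
    ennreal (\<Lambda> * measure m (tent e d)) < (\<integral>\<^sup>+w. ennreal (cmod (f w) powr s) * indicator (tent e d) w \<partial>m)"
proof -
  obtain e where e: "norm e = 1" "z = norm z *\<^sub>R e"
    by (rule obtain_direction)
  define d where "d = 1 - norm z"
  have d: "0 < d" "d \<le> 1" "z = (1 - d) *\<^sub>R e" using z e(2) by (auto simp: d_def)
  have hz: "hinner z e = of_real (1 - d)" by (subst d(3)) (simp add: hinner_scaleR_left hinner_self e(1))
  then have "1 - hinner z e = of_real d" by simp
  then have ze: "cmod (1 - hinner z e) = d" using d by simp
  have zt: "z \<in> tent e (2 ^ Suc k * d)" for k
  proof -
    have "1 * d < 2 ^ Suc k * d" using d(1) by (intro mult_strict_right_mono one_less_power) auto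
    then show ?thesis using z ze by (simp add: tent_def)
  qed
  \<comment> \<open>Otherwise all averages over the tents of size 2^(k+1) d are at most \<Lambda>,
    and point evaluation at z of f times the kernel power contradicts \<open>large\<close>.\<close>
  have "\<exists>k. \<not> (\<integral>\<^sup>+w. ennreal (cmod (f w) powr s) * indicator (tent e (2 ^ Suc k * d)) w \<partial>m) \<le> ennreal (\<Lambda> * measure m (tent e (2 ^ Suc k * d)))"
  proof (rule ccontr)
    assume "\<not> ?thesis"
    then have avg: "(\<integral>\<^sup>+w. ennreal (cmod (f w) powr s) * indicator (tent e (2 ^ Suc k * d)) w \<partial>m)
      \<le> ennreal (\<Lambda> * measure m (tent e (2 ^ Suc k * d)))" for k by blast
    note [measurable] = borel_measurable_holomorphic[OF f]
    define F where "F w = f w * test_fun e d w ^ M" for w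
    have F: "holomorphic_on_ball F" unfolding F_def
      by (intro holomorphic_on_ball_mult holomorphic_on_ball_power f holomorphic_test_fun e d)
    have Fp: "cmod (F w) powr s = cmod (f w) powr s * cmod (test_fun e d w) powr b" if "norm w < 1" for w
      using cmod_test_fun_power_powr[OF e(1) d(1,2) that] by (simp add: F_def norm_mult powr_mult b(1))
    let ?t = "measure m (tent e d)"
    have "ennreal (cmod (F z) powr s) * ennreal ?t \<le> ennreal C * powr_integral m s F"
      unfolding d(3) by (rule point_evaluation[OF F s e(1) d(1,2)])
    also have "powr_integral m s F = (\<integral>\<^sup>+w. ennreal (cmod (f w) powr s) * ennreal (cmod (test_fun e d w) powr b) \<partial>m)"
      by (intro nn_integral_cong) (simp add: Fp ennreal_mult space_m)
    also have "\<dots> \<le> ennreal (\<Lambda> * (2 powr b * L * 2) * ?t)"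
      using b s by (intro kernel_integral e d \<Lambda> avg) auto
    finally have "ennreal (cmod (F z) powr s) * ennreal ?t \<le> ennreal C * ennreal (\<Lambda> * (2 powr b * L * 2) * ?t)"
      by (simp add: mult_left_mono)
    then have "ennreal (cmod (F z) powr s * ?t) \<le> ennreal (C * (\<Lambda> * (2 powr b * L * 2) * ?t))"
      using C_pos by (simp add: ennreal_mult'[symmetric] ennreal_mult''[symmetric])
    then have "cmod (F z) powr s * ?t \<le> C * (\<Lambda> * (2 powr b * L * 2) * ?t)"
      using C_pos L_pos \<Lambda> by (subst (asm) ennreal_le_iff) auto
    then have "cmod (F z) powr s * ?t \<le> (C * \<Lambda> * (2 powr b * L * 2)) * ?t" by (simp add: mult_ac)
    then have Fz: "cmod (F z) powr s \<le> C * \<Lambda> * (2 powr b * L * 2)"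
      using tent_measure_pos[OF e(1) d(1)] by (rule mult_right_le_imp_le)
    \<comment> \<open>At z the kernel is only known to be at least 1/2, which loses 2^b; together
      with the 2^b from \<open>kernel_integral\<close> this makes the factor 4^b in
      \<open>large\<close>.\<close>
    have "cmod (f z) powr s * (1 / 2) powr b \<le> cmod (f z) powr s * cmod (test_fun e d z) powr b"
      using test_fun_center[OF e(1) d(1,2)] b(1) s unfolding d(3)[symmetric] by (intro mult_left_mono powr_mono2) auto
    also have "\<dots> \<le> C * \<Lambda> * (2 powr b * L * 2)" using Fz z by (simp add: Fp)
    finally have "cmod (f z) powr s * (1 / 2) powr b * 2 powr b \<le> C * \<Lambda> * (2 powr b * L * 2) * 2 powr b"
      by (intro mult_right_mono) auto
    moreover have "(1 / 2) powr b * 2 powr b = (1::real)" by (simp add: powr_mult[symmetric])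
    moreover have "2 powr b * 2 powr b = (4::real) powr b" by (simp add: powr_mult[symmetric])
    ultimately have "cmod (f z) powr s \<le> \<Lambda> * (C * 4 powr b * (2 * L))"
      by (simp add: mult.assoc) (simp add: mult_ac)
    then show False using large by simp
  qed
  then obtain k where "ennreal (\<Lambda> * measure m (tent e (2 ^ Suc k * d))) < (\<integral>\<^sup>+w. ennreal (cmod (f w) powr s) * indicator (tent e (2 ^ Suc k * d)) w \<partial>m)"
    by (auto simp: not_le)
  then show ?thesis using zt[of k] e d by (intro exI[of _ e] exI[of _ "2 ^ Suc k * d"]) auto
qed

end

section \<open>The embedding theorem\<close>

lemma dyadic_level:
  fixes a x :: real
  assumes "a < x" "x \<le> a * 2 ^ k"
  shows "\<exists>i<k. a * 2 ^ i < x \<and> x \<le> 2 * (a * 2 ^ i)"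
  using assms(2)
proof (induction k)
  case 0
  then show ?case using assms(1) by simp
next
  case (Suc k)
  show ?case
  proof (cases "x \<le> a * 2 ^ k")
    case True
    then show ?thesis using Suc.IH less_SucI by blast
  next
    case False
    then show ?thesis using Suc.prems by (intro exI[of _ k]) (auto simp: mult_ac)
  qed
qed

context tent_doubling_measure
begin

text \<open>On a tent where |f|^s has average above y, the part with |f|^s \<le> y/2 accounts for at
  most half of y times its measure. The truncated density, multiplied by 2/y, therefore still
  majorises m there and serves as \<nu> in the covering estimate. Keeping only large values is what
  makes the later sum over levels bounded by the square integral.\<close>

lemma weak_type:
  fixes M :: nat and s b y N \<alpha> :: real
  assumes sets_\<mu>: "sets \<mu> = sets m" and N: "0 \<le> N" "1 \<le> \<alpha>"
    and \<mu>: "\<And>e d. norm e = 1 \<Longrightarrow> 0 < d \<Longrightarrow> emeasure \<mu> (tent e d) \<le> ennreal (N * measure m (tent e d) powr \<alpha>)"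
    and f: "holomorphic_on_ball f" and s: "0 < s" and b: "b = M * s" "2 * L \<le> 2 powr b" and l: "0 < y"
    and fin: "(\<integral>\<^sup>+w. ennreal ((cmod (f w) powr s)\<^sup>2) \<partial>m) < \<infinity>"
  shows "(\<integral>\<^sup>+w. ennreal (cmod (f w) powr s) * indicator {w. y < 2 * cmod (f w) powr s} w \<partial>m) < \<infinity>"
    and "emeasure \<mu> {z \<in> ball 0 1. y * (C * 4 powr b * (2 * L)) < cmod (f z) powr s}
    \<le> ennreal (N * (L ^ 6 * (2 / y * enn2real (\<integral>\<^sup>+w. ennreal (cmod (f w) powr s) * indicator {w. y < 2 * cmod (f w) powr s} w \<partial>m))) powr \<alpha>)"
proof -
  note [measurable] = borel_measurable_holomorphic[OF f]
  let ?\<phi> = "\<lambda>w. cmod (f w) powr s"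
  let ?\<psi> = "\<lambda>w. ennreal (?\<phi> w) * indicator {w. y < 2 * ?\<phi> w} w"
  have [measurable]: "?\<psi> \<in> borel_measurable m"
  proof -
    have "?\<psi> = (\<lambda>w. if y < 2 * ?\<phi> w then ennreal (?\<phi> w) else 0)" by (auto simp: indicator_def)
    then show ?thesis by simp
  qed
  have "(\<integral>\<^sup>+w. ?\<psi> w \<partial>m) \<le> (\<integral>\<^sup>+w. ennreal (2 / y) * ennreal ((?\<phi> w)\<^sup>2) \<partial>m)"
  proof (intro nn_integral_mono)
    fix w
    show "?\<psi> w \<le> ennreal (2 / y) * ennreal ((?\<phi> w)\<^sup>2)"
    proof (cases "y < 2 * ?\<phi> w")
      case True
      have "?\<phi> w * y \<le> ?\<phi> w * (2 * ?\<phi> w)" using True by (intro mult_left_mono) auto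
      then have "?\<phi> w \<le> 2 / y * (?\<phi> w)\<^sup>2" using l by (simp add: field_simps power2_eq_square)
      then show ?thesis using True l by (simp add: ennreal_mult[symmetric] ennreal_leI)
    qed simp
  qed
  also have "\<dots> = ennreal (2 / y) * (\<integral>\<^sup>+w. ennreal ((?\<phi> w)\<^sup>2) \<partial>m)" by (rule nn_integral_cmult) measurable
  also have "\<dots> < \<infinity>" using fin by (simp add: ennreal_mult_less_top)
  finally show fin\<psi>: "(\<integral>\<^sup>+w. ?\<psi> w \<partial>m) < \<infinity>" .
  let ?\<nu> = "density m (\<lambda>w. ennreal (2 / y) * ?\<psi> w)"
  have em\<nu>: "emeasure ?\<nu> A = ennreal (2 / y) * (\<integral>\<^sup>+w. ?\<psi> w * indicator A w \<partial>m)" if [measurable]: "A \<in> sets m" for A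
    by (subst emeasure_density) (auto simp: mult.assoc nn_integral_cmult)
  have top\<nu>: "emeasure ?\<nu> (space m) = ennreal (2 / y) * (\<integral>\<^sup>+w. ?\<psi> w \<partial>m)"
  proof -
    have "(\<integral>\<^sup>+w. ?\<psi> w * indicator (space m) w \<partial>m) = (\<integral>\<^sup>+w. ?\<psi> w \<partial>m)" by (intro nn_integral_cong) simp
    then show ?thesis by (simp only: em\<nu>[OF sets.top])
  qed
  have fin\<nu>: "finite_measure ?\<nu>"
    by (rule finite_measureI) (use fin\<psi> in \<open>auto simp: top\<nu> ennreal_mult_eq_top_iff\<close>)
  interpret \<nu>: finite_measure ?\<nu> by (rule fin\<nu>)
  define P where "P = {(e, d). norm e = 1 \<and> 0 < d \<and> ennreal (y * measure m (tent e d)) < (\<integral>\<^sup>+w. ennreal (?\<phi> w) * indicator (tent e d) w \<partial>m)}"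
  have "{z \<in> ball 0 1. y * (C * 4 powr b * (2 * L)) < ?\<phi> z} \<subseteq> (\<Union>(e, d)\<in>P. tent e d)"
  proof
    fix z assume "z \<in> {z \<in> ball 0 1. y * (C * 4 powr b * (2 * L)) < ?\<phi> z}"
    then obtain e d where "norm e = 1" "0 < d" "z \<in> tent e d"
      "ennreal (y * measure m (tent e d)) < (\<integral>\<^sup>+w. ennreal (?\<phi> w) * indicator (tent e d) w \<partial>m)"
      using tent_average_large[OF f s b less_imp_le[OF l]] by blast
    then show "z \<in> (\<Union>(e, d)\<in>P. tent e d)" unfolding P_def by blast
  qed
  then have "emeasure \<mu> {z \<in> ball 0 1. y * (C * 4 powr b * (2 * L)) < ?\<phi> z} \<le> emeasure \<mu> (\<Union>(e, d)\<in>P. tent e d)"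
  proof (rule emeasure_mono)
    have "open (\<Union>(e, d)\<in>P. tent e d)" by auto
    moreover have "(\<Union>(e, d)\<in>P. tent e d) \<subseteq> ball 0 1" using tent_subset_ball by fastforce
    ultimately show "(\<Union>(e, d)\<in>P. tent e d) \<in> sets \<mu>"
      by (simp add: sets_\<mu> sets_m sets_restrict_space_iff)
  qed
  also have "\<dots> \<le> ennreal (N * (L ^ 6 * measure ?\<nu> (space ?\<nu>)) powr \<alpha>)"
  proof (rule covering_estimate[OF sets_\<mu> _ fin\<nu>])
    fix e :: "complex ^ 'n" and d assume p: "(e, d) \<in> P"
    then have ed: "norm e = 1" "0 < d" and big: "ennreal (y * measure m (tent e d)) < (\<integral>\<^sup>+w. ennreal (?\<phi> w) * indicator (tent e d) w \<partial>m)"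
      by (auto simp: P_def)
    show "norm e = 1 \<and> 0 < d" using ed by simp
    show "emeasure \<mu> (tent e (64 * d)) \<le> ennreal (N * measure m (tent e (64 * d)) powr \<alpha>)"
      using ed by (intro \<mu>) auto
    define t where "t = measure m (tent e d)"
    define x where "x = enn2real (\<integral>\<^sup>+w. ?\<psi> w * indicator (tent e d) w \<partial>m)"
    have "(\<integral>\<^sup>+w. ?\<psi> w * indicator (tent e d) w \<partial>m) \<le> (\<integral>\<^sup>+w. ?\<psi> w \<partial>m)"
      by (intro nn_integral_mono) (simp add: indicator_def)
    then have x: "(\<integral>\<^sup>+w. ?\<psi> w * indicator (tent e d) w \<partial>m) = ennreal x"
      using fin\<psi> unfolding x_def by (subst ennreal_enn2real) (auto simp: less_top intro: le_less_trans)
    note big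
    also have "(\<integral>\<^sup>+w. ennreal (?\<phi> w) * indicator (tent e d) w \<partial>m)
      \<le> (\<integral>\<^sup>+w. ?\<psi> w * indicator (tent e d) w + ennreal (y / 2) * indicator (tent e d) w \<partial>m)"
      by (intro nn_integral_mono) (auto simp: indicator_def ennreal_leI)
    also have "\<dots> = ennreal x + ennreal (y / 2) * ennreal t"
      by (subst nn_integral_add) (auto simp: x nn_integral_cmult emeasure_eq_measure t_def)
    also have "\<dots> = ennreal (x + y / 2 * t)"
      using l by (simp add: t_def x_def ennreal_mult'[symmetric])
    finally have "y * t < x + y / 2 * t" using l by (simp add: ennreal_less_iff t_def)
    then have "t \<le> 2 / y * x" using l by (simp add: field_simps)
    moreover have "measure ?\<nu> (tent e d) = 2 / y * x"
    proof -
      have "ennreal (2 / y) * ennreal x = ennreal (2 / y * x)" using l by (subst ennreal_mult'[symmetric]) auto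
      then show ?thesis using l by (simp add: measure_def em\<nu>[OF sets_tent] x) (simp add: x_def)
    qed
    ultimately show "measure m (tent e d) \<le> measure ?\<nu> (tent e d)" by (simp add: t_def)
  qed (use N in auto)
  also have "measure ?\<nu> (space ?\<nu>) = 2 / y * enn2real (\<integral>\<^sup>+w. ?\<psi> w \<partial>m)"
    using l by (simp add: measure_def top\<nu> enn2real_mult)
  finally show "emeasure \<mu> {z \<in> ball 0 1. y * (C * 4 powr b * (2 * L)) < ?\<phi> z}
    \<le> ennreal (N * (L ^ 6 * (2 / y * enn2real (\<integral>\<^sup>+w. ?\<psi> w \<partial>m))) powr \<alpha>)" .
qed

lemma exponent_exists: "0 < s \<Longrightarrow> \<exists>M::nat. 2 * L \<le> 2 powr (M * s)" for s :: real
proof -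
  assume s: "0 < s"
  obtain M where "2 * L < (2 powr s) ^ M"
    using real_arch_pow[of "2 powr s" "2 * L"] s gr_one_powr[of 2 s] by auto
  moreover have "(2 powr s) ^ M = 2 powr (M * s)" by (simp add: powr_powr powr_realpow[symmetric] mult.commute)
  ultimately show "\<exists>M::nat. 2 * L \<le> 2 powr (M * s)" by (intro exI[of _ M]) simp
qed

text \<open>A Marcinkiewicz argument with discrete levels y. The level weight y^(2\<alpha>) times
  the weak bound is, up to constants, (y \<Phi>(y))^\<alpha>; superadditivity moves the sum inside
  the power, and pointwise the sum of y over levels y < 2 \<phi> is at most 4 \<phi>, which leaves
  the integral of \<phi>^2. The bound is uniform in n.\<close>

lemma strong_type_truncated:
  fixes M n :: nat and s b N \<alpha> K0 :: real
  assumes sets_\<mu>: "sets \<mu> = sets m" and N: "0 \<le> N" "1 \<le> \<alpha>"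
    and \<mu>: "\<And>e d. norm e = 1 \<Longrightarrow> 0 < d \<Longrightarrow> emeasure \<mu> (tent e d) \<le> ennreal (N * measure m (tent e d) powr \<alpha>)"
    and f: "holomorphic_on_ball f" and s: "0 < s" and b: "b = M * s" "2 * L \<le> 2 powr b"
    and fin: "(\<integral>\<^sup>+w. ennreal ((cmod (f w) powr s)\<^sup>2) \<partial>m) < \<infinity>"
    and K0: "K0 = C * 4 powr b * (2 * L)"
  shows "(\<integral>\<^sup>+z. ennreal ((cmod (f z) powr s) powr (2 * \<alpha>)) * indicator {z. K0 / 2 ^ n < cmod (f z) powr s \<and> cmod (f z) powr s \<le> K0 * 2 ^ n} z \<partial>\<mu>)
    \<le> ennreal (N * (32 * K0\<^sup>2 * L ^ 6 * enn2real (\<integral>\<^sup>+w. ennreal ((cmod (f w) powr s)\<^sup>2) \<partial>m)) powr \<alpha>)"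
proof -
  have K0p: "0 < K0" unfolding K0 using C_pos L_pos by simp
  have [measurable_cong]: "sets \<mu> = sets m" by fact
  have space_\<mu>: "space \<mu> = ball 0 1" using sets_eq_imp_space_eq[OF sets_\<mu>] by (simp add: space_m)
  note [measurable] = borel_measurable_holomorphic[OF f]
  let ?\<phi> = "\<lambda>w. cmod (f w) powr s"
  let ?A = "{z. K0 / 2 ^ n < ?\<phi> z \<and> ?\<phi> z \<le> K0 * 2 ^ n}"
  \<comment> \<open>The levels 2^(i-n) for i < 2 n. Multiplied by K0 they start at the lower end of
    the window, and 2 n doublings reach its upper end.\<close>
  define l :: "nat \<Rightarrow> real" where "l i = (1 / 2 ^ n) * 2 ^ i" for i
  have l: "0 < l i" for i by (simp add: l_def)
  define \<Phi> where "\<Phi> i = (\<integral>\<^sup>+w. ennreal (?\<phi> w) * indicator {w. l i < 2 * ?\<phi> w} w \<partial>m)" for i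
  have [measurable]: "(\<lambda>w. ennreal (?\<phi> w) * indicator {w. l i < 2 * ?\<phi> w} w) \<in> borel_measurable m" for i
  proof -
    have "(\<lambda>w. ennreal (?\<phi> w) * indicator {w. l i < 2 * ?\<phi> w} w) = (\<lambda>w. if l i < 2 * ?\<phi> w then ennreal (?\<phi> w) else 0)" by (auto simp: indicator_def)
    then show ?thesis by simp
  qed
  have \<Phi>fin: "\<Phi> i < \<infinity>" for i
    unfolding \<Phi>_def by (rule weak_type(1)[OF sets_\<mu> N \<mu> f s b l fin])
  have weak: "emeasure \<mu> {z \<in> ball 0 1. l i * K0 < ?\<phi> z} \<le> ennreal (N * (L ^ 6 * (2 / l i * enn2real (\<Phi> i))) powr \<alpha>)" for i
    unfolding \<Phi>_def K0 by (rule weak_type(2)[OF sets_\<mu> N \<mu> f s b l fin])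
  have [measurable]: "{z \<in> ball 0 1. l i * K0 < ?\<phi> z} \<in> sets \<mu>" for i
  proof -
    have "{z \<in> space \<mu>. l i * K0 < ?\<phi> z} \<in> sets \<mu>" by measurable
    then show ?thesis by (simp add: space_\<mu>)
  qed
  have "(\<integral>\<^sup>+z. ennreal (?\<phi> z powr (2 * \<alpha>)) * indicator ?A z \<partial>\<mu>)
    \<le> (\<integral>\<^sup>+z. (\<Sum>i<2 * n. ennreal ((2 * (K0 * l i)) powr (2 * \<alpha>)) * indicator {z \<in> ball 0 1. l i * K0 < ?\<phi> z} z) \<partial>\<mu>)"
  proof (rule nn_integral_mono)
    fix z assume z: "z \<in> space \<mu>"
    show "ennreal (?\<phi> z powr (2 * \<alpha>)) * indicator ?A z
      \<le> (\<Sum>i<2 * n. ennreal ((2 * (K0 * l i)) powr (2 * \<alpha>)) * indicator {z \<in> ball 0 1. l i * K0 < ?\<phi> z} z)"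
    proof (cases "z \<in> ?A")
      case True
      have "K0 / 2 ^ n * 2 ^ (2 * n) = K0 * 2 ^ n" by (simp add: mult_2 power_add)
      then obtain i where i: "i < 2 * n" "K0 / 2 ^ n * 2 ^ i < ?\<phi> z" "?\<phi> z \<le> 2 * (K0 / 2 ^ n * 2 ^ i)"
        using dyadic_level[of "K0 / 2 ^ n" "?\<phi> z" "2 * n"] True by auto
      have "?\<phi> z powr (2 * \<alpha>) \<le> (2 * (K0 * l i)) powr (2 * \<alpha>)"
        using i(3) N by (intro powr_mono2) (auto simp: l_def)
      then have "ennreal (?\<phi> z powr (2 * \<alpha>)) * indicator ?A z
        \<le> ennreal ((2 * (K0 * l i)) powr (2 * \<alpha>)) * indicator {z \<in> ball 0 1. l i * K0 < ?\<phi> z} z"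
      proof -
        have "z \<in> {z \<in> ball 0 1. l i * K0 < ?\<phi> z}" using i(2) z by (simp add: space_\<mu> l_def mult_ac)
        moreover have "indicator ?A z = (1::ennreal)" using True by simp
        ultimately show ?thesis using \<open>?\<phi> z powr (2 * \<alpha>) \<le> _\<close> by (simp only: indicator_simps mult_1_right ennreal_leI)
      qed
      also have "\<dots> \<le> (\<Sum>i<2 * n. ennreal ((2 * (K0 * l i)) powr (2 * \<alpha>)) * indicator {z \<in> ball 0 1. l i * K0 < ?\<phi> z} z)"
        using i(1) by (intro member_le_sum) auto
      finally show ?thesis .
    qed simp
  qed
  also have "\<dots> = (\<Sum>i<2 * n. ennreal ((2 * (K0 * l i)) powr (2 * \<alpha>)) * emeasure \<mu> {z \<in> ball 0 1. l i * K0 < ?\<phi> z})"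
  proof -
    have "(\<integral>\<^sup>+z. (\<Sum>i<2 * n. c i * indicator (G i) z) \<partial>\<mu>) = (\<Sum>i<2 * n. c i * emeasure \<mu> (G i))"
      if "\<And>i. G i \<in> sets \<mu>" for c G
      using that by (subst nn_integral_sum) (auto simp: nn_integral_cmult_indicator)
    then show ?thesis by this measurable
  qed
  also have "\<dots> \<le> (\<Sum>i<2 * n. ennreal (N * (8 * K0\<^sup>2 * L ^ 6 * (l i * enn2real (\<Phi> i))) powr \<alpha>))"
  proof (rule sum_mono)
    fix i
    have "ennreal ((2 * (K0 * l i)) powr (2 * \<alpha>)) * emeasure \<mu> {z \<in> ball 0 1. l i * K0 < ?\<phi> z}
      \<le> ennreal ((2 * (K0 * l i)) powr (2 * \<alpha>)) * ennreal (N * (L ^ 6 * (2 / l i * enn2real (\<Phi> i))) powr \<alpha>)"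
      by (intro mult_left_mono weak) auto
    also have "\<dots> = ennreal ((2 * (K0 * l i)) powr (2 * \<alpha>) * (N * (L ^ 6 * (2 / l i * enn2real (\<Phi> i))) powr \<alpha>))"
      using N by (simp add: ennreal_mult)
    \<comment> \<open>(2 K0 y)^2 from the level times 2/y from the weak bound leaves 8 K0^2 y; the
      factor 4 of the dyadic sum later turns 8 into 32.\<close>
    also have "(2 * (K0 * l i)) powr (2 * \<alpha>) * (N * (L ^ 6 * (2 / l i * enn2real (\<Phi> i))) powr \<alpha>)
      = N * (((2 * (K0 * l i))\<^sup>2 * (L ^ 6 * (2 / l i * enn2real (\<Phi> i)))) powr \<alpha>)"
    proof -
      have e1: "(2 * (K0 * l i)) powr (2 * \<alpha>) = ((2 * (K0 * l i))\<^sup>2) powr \<alpha>"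
        using K0p l[of i] by (simp add: powr_powr[symmetric] powr_numeral)
      show ?thesis unfolding e1 powr_mult[of "(2 * (K0 * l i))\<^sup>2"] by (rule mult.left_commute)
    qed
    also have "(2 * (K0 * l i))\<^sup>2 * (L ^ 6 * (2 / l i * enn2real (\<Phi> i))) = 8 * K0\<^sup>2 * L ^ 6 * (l i * enn2real (\<Phi> i))"
      using l[of i] by (simp add: power2_eq_square field_simps)
    finally show "ennreal ((2 * (K0 * l i)) powr (2 * \<alpha>)) * emeasure \<mu> {z \<in> ball 0 1. l i * K0 < ?\<phi> z}
      \<le> ennreal (N * (8 * K0\<^sup>2 * L ^ 6 * (l i * enn2real (\<Phi> i))) powr \<alpha>)" .
  qed
  also have "\<dots> = ennreal (\<Sum>i<2 * n. N * (8 * K0\<^sup>2 * L ^ 6 * (l i * enn2real (\<Phi> i))) powr \<alpha>)"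
    using N by (intro sum_ennreal) auto
  also have "\<dots> \<le> ennreal (N * (32 * K0\<^sup>2 * L ^ 6 * enn2real (\<integral>\<^sup>+w. ennreal ((?\<phi> w)\<^sup>2) \<partial>m)) powr \<alpha>)"
  proof (rule ennreal_leI)
    have "ennreal (\<Sum>i<2 * n. l i * enn2real (\<Phi> i)) = (\<Sum>i<2 * n. ennreal (l i) * \<Phi> i)"
      using l \<Phi>fin by (subst sum_ennreal[symmetric]) (auto simp: ennreal_mult less_imp_le intro!: sum.cong)
    also have "\<dots> = (\<integral>\<^sup>+w. (\<Sum>i<2 * n. ennreal (l i) * (ennreal (?\<phi> w) * indicator {w. l i < 2 * ?\<phi> w} w)) \<partial>m)"
      unfolding \<Phi>_def by (subst nn_integral_sum) (auto simp: nn_integral_cmult)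
    also have "\<dots> \<le> (\<integral>\<^sup>+w. ennreal 4 * ennreal ((?\<phi> w)\<^sup>2) \<partial>m)"
    proof (rule nn_integral_mono)
      fix w
      have "(\<Sum>i<2 * n. ennreal (l i) * (ennreal (?\<phi> w) * indicator {w. l i < 2 * ?\<phi> w} w))
        = (\<Sum>i<2 * n. ennreal (?\<phi> w * (if 1 / 2 ^ n * 2 ^ i < 2 * ?\<phi> w then 1 / 2 ^ n * 2 ^ i else 0)))"
        using l by (intro sum.cong) (auto simp: l_def indicator_def ennreal_mult[symmetric] mult.commute)
      also have "\<dots> = ennreal (?\<phi> w * (\<Sum>i<2 * n. if 1 / 2 ^ n * 2 ^ i < 2 * ?\<phi> w then 1 / 2 ^ n * 2 ^ i else 0))"
        by (subst sum_distrib_left, rule sum_ennreal) auto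
      also have "\<dots> \<le> ennreal (?\<phi> w * (4 * ?\<phi> w))"
        by (intro ennreal_leI mult_left_mono sum_dyadic_le) auto
      also have "\<dots> = ennreal 4 * ennreal ((?\<phi> w)\<^sup>2)"
        by (subst ennreal_mult[symmetric]) (auto simp: power2_eq_square mult_ac)
      finally show "(\<Sum>i<2 * n. ennreal (l i) * (ennreal (?\<phi> w) * indicator {w. l i < 2 * ?\<phi> w} w)) \<le> ennreal 4 * ennreal ((?\<phi> w)\<^sup>2)" .
    qed
    also have "\<dots> = ennreal 4 * (\<integral>\<^sup>+w. ennreal ((?\<phi> w)\<^sup>2) \<partial>m)" by (rule nn_integral_cmult) measurable
    also have "\<dots> = ennreal (4 * enn2real (\<integral>\<^sup>+w. ennreal ((?\<phi> w)\<^sup>2) \<partial>m))"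
      using fin by (simp add: ennreal_mult)
    finally have le: "(\<Sum>i<2 * n. l i * enn2real (\<Phi> i)) \<le> 4 * enn2real (\<integral>\<^sup>+w. ennreal ((?\<phi> w)\<^sup>2) \<partial>m)"
      by (subst (asm) ennreal_le_iff) auto
    have "(\<Sum>i<2 * n. N * (8 * K0\<^sup>2 * L ^ 6 * (l i * enn2real (\<Phi> i))) powr \<alpha>)
      \<le> N * (\<Sum>i<2 * n. 8 * K0\<^sup>2 * L ^ 6 * (l i * enn2real (\<Phi> i))) powr \<alpha>"
      unfolding sum_distrib_left[symmetric, of N] using N L_pos l
      by (intro mult_left_mono sum_powr_le_powr_sum) (auto simp: less_imp_le)
    also have "\<dots> = N * (8 * K0\<^sup>2 * L ^ 6 * (\<Sum>i<2 * n. l i * enn2real (\<Phi> i))) powr \<alpha>"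
      by (simp only: sum_distrib_left)
    also have "\<dots> \<le> N * (8 * K0\<^sup>2 * L ^ 6 * (4 * enn2real (\<integral>\<^sup>+w. ennreal ((?\<phi> w)\<^sup>2) \<partial>m))) powr \<alpha>"
      using N L_pos l le
      by (intro mult_left_mono powr_mono2 mult_nonneg_nonneg sum_nonneg) (auto simp: less_imp_le)
    finally show "(\<Sum>i<2 * n. N * (8 * K0\<^sup>2 * L ^ 6 * (l i * enn2real (\<Phi> i))) powr \<alpha>)
      \<le> N * (32 * K0\<^sup>2 * L ^ 6 * enn2real (\<integral>\<^sup>+w. ennreal ((?\<phi> w)\<^sup>2) \<partial>m)) powr \<alpha>" by (simp add: mult_ac)
  qed
  finally show ?thesis .
qed

text \<open>With s = p/2 the square of |f|^s is |f|^p. The constant is fixed before \<mu>, N,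
  \<alpha> and f, so it also serves restrictions of \<mu> and yields norm estimates uniform in
  \<mu>.\<close>

theorem carleson_embedding:
  assumes p: "0 < p"
  shows "\<exists>K>0. \<forall>\<mu> N \<alpha> f. sets \<mu> = sets m \<longrightarrow> 0 \<le> N \<longrightarrow> 1 \<le> \<alpha> \<longrightarrow>
    (\<forall>e d. norm e = 1 \<longrightarrow> 0 < d \<longrightarrow> emeasure \<mu> (tent e d) \<le> ennreal (N * measure m (tent e d) powr \<alpha>)) \<longrightarrow>
    holomorphic_on_ball f \<longrightarrow> powr_integral m p f < \<infinity> \<longrightarrow>
    powr_integral \<mu> (p * \<alpha>) f
      \<le> ennreal (N * (K * enn2real (powr_integral m p f)) powr \<alpha>)"
proof -
  define s where "s = p / 2"
  have s: "0 < s" using p by (simp add: s_def)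
  obtain M :: nat where M: "2 * L \<le> 2 powr (M * s)" using exponent_exists[OF s] by blast
  define K0 where "K0 = C * 4 powr (M * s) * (2 * L)"
  have K0: "0 < K0" unfolding K0_def using C_pos L_pos by simp
  show ?thesis
  proof (intro exI[of _ "32 * K0\<^sup>2 * L ^ 6"] conjI allI impI)
    show "0 < 32 * K0\<^sup>2 * L ^ 6" using K0 L_pos by simp
  next
    fix \<mu> and N \<alpha> :: real and f :: "complex ^ 'n \<Rightarrow> complex"
    assume sets_\<mu>: "sets \<mu> = sets m" and N: "0 \<le> N" "1 \<le> \<alpha>"
      and \<mu>: "\<forall>e d. norm e = 1 \<longrightarrow> 0 < d \<longrightarrow> emeasure \<mu> (tent e d) \<le> ennreal (N * measure m (tent e d) powr \<alpha>)"
      and f: "holomorphic_on_ball f" and fin: "powr_integral m p f < \<infinity>"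
    have [measurable_cong]: "sets \<mu> = sets m" by fact
    note [measurable] = borel_measurable_holomorphic[OF f]
    let ?\<phi> = "\<lambda>w. cmod (f w) powr s"
    have sq: "(?\<phi> w)\<^sup>2 = cmod (f w) powr p" for w
      by (simp add: power2_eq_square powr_add[symmetric] s_def)
    have pa: "?\<phi> w powr (2 * \<alpha>) = cmod (f w) powr (p * \<alpha>)" for w
      by (simp add: powr_powr s_def)
    let ?A = "\<lambda>n. {z. K0 / 2 ^ n < ?\<phi> z \<and> ?\<phi> z \<le> K0 * 2 ^ n}"
    let ?I = "\<lambda>n z. ennreal (cmod (f z) powr (p * \<alpha>)) * indicator (?A n) z"
    have [measurable]: "?I n \<in> borel_measurable \<mu>" for n
    proof -
      have "?I n = (\<lambda>z. if K0 / 2 ^ n < ?\<phi> z \<and> ?\<phi> z \<le> K0 * 2 ^ n then ennreal (cmod (f z) powr (p * \<alpha>)) else 0)"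
        by (auto simp: indicator_def)
      then show ?thesis by simp
    qed
    have A_mono: "?A n \<subseteq> ?A n'" if "n \<le> n'" for n n'
    proof -
      have "K0 / 2 ^ n' \<le> K0 / 2 ^ n" "K0 * 2 ^ n \<le> K0 * 2 ^ n'"
        using that K0 by (auto intro!: divide_left_mono mult_left_mono power_increasing)
      then show ?thesis by auto
    qed
    \<comment> \<open>The windows exhaust the set where f is nonzero, and zeros of f contribute
      nothing, so monotone convergence removes the truncation.\<close>
    have "powr_integral \<mu> (p * \<alpha>) f = (\<integral>\<^sup>+z. (SUP n. ?I n z) \<partial>\<mu>)"
    proof (rule nn_integral_cong)
      fix z
      show "ennreal (cmod (f z) powr (p * \<alpha>)) = (SUP n. ?I n z)"
      proof (cases "f z = 0")
        case True
        then show ?thesis by simp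
      next
        case False
        then have pos: "0 < ?\<phi> z" by simp
        obtain n1 where n1: "K0 / ?\<phi> z < 2 ^ n1" using real_arch_pow[of 2] by auto
        obtain n2 where n2: "?\<phi> z / K0 < 2 ^ n2" using real_arch_pow[of 2] by auto
        have "(2::real) ^ n1 \<le> 2 ^ max n1 n2" "(2::real) ^ n2 \<le> 2 ^ max n1 n2" by (auto intro!: power_increasing)
        then have "K0 / ?\<phi> z < 2 ^ max n1 n2" "?\<phi> z / K0 < 2 ^ max n1 n2" using n1 n2 by linarith+
        then have "z \<in> ?A (max n1 n2)" using K0 pos by (simp add: field_simps less_imp_le)
        then have "ennreal (cmod (f z) powr (p * \<alpha>)) \<le> ?I (max n1 n2) z" by simp
        then show ?thesis
          by (intro antisym SUP_least SUP_upper2[where i="max n1 n2"]) (auto simp: indicator_def)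
      qed
    qed
    also have "\<dots> = (SUP n. \<integral>\<^sup>+z. ?I n z \<partial>\<mu>)"
    proof (rule nn_integral_monotone_convergence_SUP)
      show "incseq ?I"
      proof (intro incseq_SucI le_funI)
        fix n z
        show "?I n z \<le> ?I (Suc n) z" using A_mono[of n "Suc n"] by (intro mult_left_mono) (auto simp: indicator_def)
      qed
    qed measurable
    also have "\<dots> \<le> ennreal (N * (32 * K0\<^sup>2 * L ^ 6 * enn2real (powr_integral m p f)) powr \<alpha>)"
    proof (rule SUP_least)
      fix n
      show "(\<integral>\<^sup>+z. ?I n z \<partial>\<mu>) \<le> ennreal (N * (32 * K0\<^sup>2 * L ^ 6 * enn2real (powr_integral m p f)) powr \<alpha>)"
        using strong_type_truncated[OF sets_\<mu> N _ f s refl M _ K0_def, of n] \<mu> fin unfolding sq pa by blast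
    qed
    finally show "powr_integral \<mu> (p * \<alpha>) f
      \<le> ennreal (N * (32 * K0\<^sup>2 * L ^ 6 * enn2real (powr_integral m p f)) powr \<alpha>)" .
  qed
qed

end

section \<open>Carleson blocks and Bergman spaces\<close>

text \<open>Links the abstract measure m back to the definitions of weight and Bergman space, which
  integrate against omega over \<open>ball_volume\<close>.\<close>

locale weighted_ball = tent_doubling_measure m L C for m :: "(complex ^ 'n::finite) measure" and L C :: real +
  fixes \<omega> :: "real \<Rightarrow> real"
  assumes weight_pos: "z \<in> ball (0 :: complex ^ 'n) 1 \<Longrightarrow> 0 < \<omega> (norm z)"
    and weight_measurable: "f \<in> borel_measurable (restrict_space borel (ball 0 1)) \<Longrightarrow> (\<And>z. 0 \<le> f z) \<Longrightarrow>
      (\<lambda>z :: complex ^ 'n. f z * \<omega> (norm z)) \<in> borel_measurable ball_volume"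
    and weight_nn_integral: "f \<in> borel_measurable (restrict_space borel (ball 0 1)) \<Longrightarrow> (\<And>z. 0 \<le> f z) \<Longrightarrow>
      (\<integral>\<^sup>+z. ennreal (f z * \<omega> (norm z)) \<partial>ball_volume) = (\<integral>\<^sup>+z. ennreal (f z) \<partial>m)"

lemma doubling_weight_weighted_ball:
  assumes dw: "doubling_weight TYPE('n::finite) \<omega>"
  shows "\<exists>(m :: (complex ^ 'n) measure) L C. weighted_ball m L C \<omega>"
proof -
  have rw: "radial_weight TYPE('n) \<omega>" using dw by (simp add: doubling_weight_def)
  obtain g where g: "g \<in> borel_measurable borel" "AE t in norm_law TYPE(complex ^ 'n). \<omega> t = g t"
    using radial_weight_borel_version[OF rw] by blast
  obtain L C where "tent_doubling_measure (weight_measure g :: (complex ^ 'n) measure) L C"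
    using doubling_weight_tent_doubling[OF dw g] by blast
  then have "weighted_ball (weight_measure g :: (complex ^ 'n) measure) L C \<omega>"
    using rw radial_weight_measure_link[OF rw g]
    by (intro weighted_ball.intro weighted_ball_axioms.intro) (auto simp: radial_weight_def)
  then show ?thesis by blast
qed

context weighted_ball
begin

lemma borel_measurable_m_iff: "f \<in> borel_measurable m \<longleftrightarrow> f \<in> borel_measurable (restrict_space borel (ball 0 1))"
  using measurable_cong_sets[OF sets_m refl] by blast

lemma space_ball_volume: "space (ball_volume :: (complex ^ 'n) measure) = ball 0 1"
  by (simp add: ball_volume_def space_restrict_space)

lemma weight_integral:
  assumes f: "f \<in> borel_measurable m" "\<And>z. 0 \<le> f z"
  shows "integrable ball_volume (\<lambda>z. f z * \<omega> (norm z)) \<longleftrightarrow> (\<integral>\<^sup>+z. ennreal (f z) \<partial>m) < \<infinity>"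
    and "(LINT z|ball_volume. f z * \<omega> (norm z)) = enn2real (\<integral>\<^sup>+z. ennreal (f z) \<partial>m)"
proof -
  note f' = f(1)[unfolded borel_measurable_m_iff] f(2)
  have nonneg: "AE z in ball_volume. 0 \<le> f z * \<omega> (norm z)"
    by (rule AE_I2) (use weight_pos f(2) in \<open>auto simp: space_ball_volume less_imp_le\<close>)
  show "(LINT z|ball_volume. f z * \<omega> (norm z)) = enn2real (\<integral>\<^sup>+z. ennreal (f z) \<partial>m)"
    using integral_eq_nn_integral[OF weight_measurable[OF f'] nonneg] weight_nn_integral[OF f'] by simp
  have "(\<integral>\<^sup>+z. ennreal (norm (f z * \<omega> (norm z))) \<partial>ball_volume) = (\<integral>\<^sup>+z. ennreal (f z * \<omega> (norm z)) \<partial>ball_volume)"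
    by (rule nn_integral_cong_AE, use nonneg in eventually_elim) simp
  then show "integrable ball_volume (\<lambda>z. f z * \<omega> (norm z)) \<longleftrightarrow> (\<integral>\<^sup>+z. ennreal (f z) \<partial>m) < \<infinity>"
    using weight_measurable[OF f'] weight_nn_integral[OF f'] by (simp add: integrable_iff_bounded)
qed

lemma bergman_iff: "f \<in> bergman p \<omega> \<longleftrightarrow> holomorphic_on_ball f \<and> powr_integral m p f < \<infinity>"
proof -
  have "integrable ball_volume (\<lambda>z. cmod (f z) powr p * \<omega> (norm z)) \<longleftrightarrow> powr_integral m p f < \<infinity>"
    if [measurable]: "holomorphic_on_ball f"
    by (rule weight_integral) auto
  then show ?thesis by (auto simp: bergman_def)
qed

lemma bergman_norm_eq:
  assumes [measurable]: "holomorphic_on_ball f"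
  shows "bergman_norm p \<omega> f = enn2real (powr_integral m p f) powr (1 / p)"
  unfolding bergman_norm_def by (subst weight_integral(2)) auto

lemma weight_of_eq:
  assumes [measurable]: "E \<in> sets m"
  shows "weight_of \<omega> E = measure m E"
proof -
  have "weight_of \<omega> E = (LINT z|ball_volume. indicator E z * \<omega> (norm z))"
    by (simp add: weight_of_def set_lebesgue_integral_def)
  also have "\<dots> = enn2real (\<integral>\<^sup>+z. ennreal (indicator E z) \<partial>m)"
    by (rule weight_integral(2)) auto
  finally show ?thesis by (simp add: ennreal_indicator measure_def)
qed

lemma carleson_block_tents:
  fixes a :: "complex ^ 'n"
  assumes a: "a \<in> ball 0 1"
  obtains e where "norm e = 1" "a = (1 - (1 - norm a)) *\<^sub>R e" "carleson_block a \<in> sets m"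
    "tent e ((1 - norm a) / 2) \<subseteq> carleson_block a" "carleson_block a \<subseteq> tent e (2 * (1 - norm a))"
proof (cases "a = 0")
  case True
  let ?e = "axis undefined 1 :: complex ^ 'n"
  have "tent ?e 2 = ball 0 1" by (rule tent_eq_ball) auto
  then show ?thesis
    using that[of ?e] True tent_subset_ball[of ?e "1 / 2"] sets.top[of m]
    by (simp add: carleson_block_def space_m)
next
  case False
  let ?d = "1 - norm a"
  have e: "norm (sgn a) = 1" "a = (1 - ?d) *\<^sub>R sgn a" and d: "0 < ?d" "?d < 1"
    using False a by (auto simp: norm_sgn sgn_div_norm)
  have bl: "carleson_block a = {w. 1 - ?d < norm w \<and> norm w < 1 \<and> cmod (1 - hinner (sgn w) (sgn a)) \<le> ?d}"
    using carleson_block_eq[OF e(1) d] e(2) by simp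
  have "{w. 1 - ?d < norm w \<and> norm w < 1 \<and> cmod (1 - hinner (sgn w) (sgn a)) \<le> ?d} \<in> sets borel" by measurable
  then have "carleson_block a \<in> sets m" unfolding sets_m
    by (simp add: sets_restrict_space_iff bl) auto
  then show ?thesis
    using that[OF e] tent_subset_carleson_block[OF e(1) d] carleson_block_subset_tent[OF e(1) d] e(2) by simp
qed

lemma measure_carleson_block_pos:
  assumes a: "a \<in> ball (0 :: complex ^ 'n) 1"
  shows "0 < measure m (carleson_block a)"
proof -
  obtain e where e: "norm e = 1" "carleson_block a \<in> sets m" "tent e ((1 - norm a) / 2) \<subseteq> carleson_block a"
    using carleson_block_tents[OF a] by metis
  have "0 < measure m (tent e ((1 - norm a) / 2))" using a e by (intro tent_measure_pos) auto
  also have "\<dots> \<le> measure m (carleson_block a)" using e by (intro finite_measure_mono) auto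
  finally show ?thesis .
qed

text \<open>Blocks have positive measure because they contain a tent, and finite measure because m
  is finite, so the division in \<open>ennreal\<close> can be undone.\<close>

lemma carleson_ratio_le_iff:
  assumes a: "a \<in> ball (0 :: complex ^ 'n) 1" and N: "0 \<le> N"
  shows "carleson_ratio p q \<omega> \<mu> a \<le> ennreal N \<longleftrightarrow>
    emeasure \<mu> (carleson_block a) \<le> ennreal (N * measure m (carleson_block a) powr (q / p))"
proof -
  let ?w = "measure m (carleson_block a) powr (q / p)"
  have w: "0 < ?w" using measure_carleson_block_pos[OF a] by simp
  have "weight_of \<omega> (carleson_block a) = measure m (carleson_block a)"
    using carleson_block_tents[OF a] weight_of_eq by metis
  then have "carleson_ratio p q \<omega> \<mu> a \<le> ennreal N \<longleftrightarrow> emeasure \<mu> (carleson_block a) / ennreal ?w \<le> ennreal N"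
    by (simp add: carleson_ratio_def)
  also have "\<dots> \<longleftrightarrow> emeasure \<mu> (carleson_block a) \<le> ennreal N * ennreal ?w"
  proof
    assume "emeasure \<mu> (carleson_block a) / ennreal ?w \<le> ennreal N"
    then have "emeasure \<mu> (carleson_block a) / ennreal ?w * ennreal ?w \<le> ennreal N * ennreal ?w"
      by (rule mult_right_mono) simp
    then show "emeasure \<mu> (carleson_block a) \<le> ennreal N * ennreal ?w"
      using w by (simp add: ennreal_divide_times)
  next
    assume "emeasure \<mu> (carleson_block a) \<le> ennreal N * ennreal ?w"
    then have "emeasure \<mu> (carleson_block a) / ennreal ?w \<le> ennreal N * ennreal ?w / ennreal ?w"
      by (rule divide_right_mono_ennreal)
    then show "emeasure \<mu> (carleson_block a) / ennreal ?w \<le> ennreal N"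
      using w by (simp add: ennreal_mult_divide_eq)
  qed
  finally show ?thesis using N by (simp add: ennreal_mult)
qed

lemma Lq_iff: "f \<in> Lq q \<mu> \<longleftrightarrow> f \<in> borel_measurable \<mu> \<and> powr_integral \<mu> q f < \<infinity>"
  by (auto simp: Lq_def integrable_iff_bounded)

lemma Lq_norm_eq:
  assumes [measurable]: "f \<in> borel_measurable \<mu>"
  shows "Lq_norm q \<mu> f = enn2real (powr_integral \<mu> q f) powr (1 / q)"
  unfolding Lq_norm_def by (subst integral_eq_nn_integral) auto

text \<open>The point a sits at depth 2 d, so its block contains the tent of size d and lies in that
  of size 4 d, two doublings away; once 2 d \<ge> 1 the whole ball replaces the block. Only the
  ratio at this one a enters, which lets the bound be localised near the sphere.\<close>

lemma tent_bound_of_ratio: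
  fixes N p q :: real
  assumes sets_\<mu>: "sets \<mu> = sets m" and N: "0 \<le> N" and pq: "0 < p" "p \<le> q" and e: "norm e = 1" "0 < d"
    and a: "a = (if d < 1 / 2 then (1 - 2 * d) *\<^sub>R e else 0)" and ratio: "carleson_ratio p q \<omega> \<mu> a \<le> ennreal N"
  shows "emeasure \<mu> (tent e d) \<le> ennreal (N * (L\<^sup>2) powr (q / p) * measure m (tent e d) powr (q / p))"
proof -
  have \<alpha>: "0 \<le> q / p" using pq by simp
  have aB: "a \<in> ball 0 1" using a e by auto
  have "tent e d \<subseteq> carleson_block a \<and> carleson_block a \<subseteq> tent e (4 * d)"
  proof (cases "d < 1 / 2")
    case True
    then show ?thesis
      using tent_subset_carleson_block[OF e(1), of "2 * d"] carleson_block_subset_tent[OF e(1), of "2 * d"] e a by simp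
  next
    case False
    then have "tent e (4 * d) = ball 0 1" by (intro tent_eq_ball e) auto
    then show ?thesis using False a tent_subset_ball by (simp add: carleson_block_def)
  qed
  then have sub: "tent e d \<subseteq> carleson_block a" "carleson_block a \<subseteq> tent e (4 * d)" by auto
  have bs: "carleson_block a \<in> sets m" using carleson_block_tents[OF aB] by metis
  have "emeasure \<mu> (tent e d) \<le> emeasure \<mu> (carleson_block a)"
    using sub bs sets_\<mu> by (intro emeasure_mono) auto
  also have "\<dots> \<le> ennreal (N * measure m (carleson_block a) powr (q / p))"
    using ratio by (simp only: carleson_ratio_le_iff[OF aB N])
  also have "\<dots> \<le> ennreal (N * (L\<^sup>2 * measure m (tent e d)) powr (q / p))"
  proof (intro ennreal_leI mult_left_mono powr_mono2 \<alpha> N)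
    have "measure m (carleson_block a) \<le> measure m (tent e (4 * d))" using sub by (intro finite_measure_mono) auto
    also have "\<dots> \<le> L\<^sup>2 * measure m (tent e d)" using tent_double_power[OF e, of 2] by simp
    finally show "measure m (carleson_block a) \<le> L\<^sup>2 * measure m (tent e d)" .
  qed simp
  also have "N * (L\<^sup>2 * measure m (tent e d)) powr (q / p) = N * (L\<^sup>2) powr (q / p) * measure m (tent e d) powr (q / p)"
    by (simp add: powr_mult)
  finally show ?thesis .
qed

lemma test_fun_ge:
  assumes e: "norm e = 1" "0 < d" "d \<le> 1" and w: "w \<in> tent e (2 * d)"
  shows "1 / 3 \<le> cmod (test_fun e d w)"
proof -
  have w1: "norm w < 1" using w by (simp add: tent_def)
  let ?x = "cmod (1 - hinner w ((1 - d) *\<^sub>R e))"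
  have x: "0 < ?x" using one_minus_hinner_lower(1)[OF e w1] e by linarith
  have "hinner w e = hinner w ((1 - d) *\<^sub>R e) + of_real d * hinner w e"
    by (simp only: hinner_scaleR_right) (simp add: algebra_simps)
  then have "1 - hinner w ((1 - d) *\<^sub>R e) = (1 - hinner w e) + of_real d * hinner w e" by (simp add: algebra_simps)
  then have "?x \<le> cmod (1 - hinner w e) + cmod (of_real d * hinner w e)" by (metis norm_triangle_ineq)
  moreover have "cmod (of_real d * hinner w e) \<le> d"
  proof -
    have "cmod (hinner w e) \<le> 1" using hinner_Cauchy_Schwarz[of w e] e w1 by simp
    then have "d * cmod (hinner w e) \<le> d * 1" using e by (intro mult_left_mono) auto
    then show ?thesis using e by (simp add: norm_mult)
  qed
  moreover have "cmod (1 - hinner w e) < 2 * d" using w by (simp add: tent_def)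
  ultimately have "?x \<le> 3 * d" by linarith
  then show ?thesis using x e by (simp add: cmod_test_fun divide_simps)
qed

text \<open>Collects what both necessity proofs take from the kernels: their powers have p-integral
  of the order of a tent, that tent is controlled by the block of a, and on the block the kernel is
  bounded below.\<close>

lemma test_functions:
  fixes p q :: real
  assumes pq: "0 < p" "p \<le> q"
  obtains M :: nat and K :: real where "0 < K" "2 * L \<le> 2 powr (M * p)"
    "\<And>(e :: complex ^ 'n) d. norm e = 1 \<Longrightarrow> 0 < d \<Longrightarrow> d \<le> 1 \<Longrightarrow> (\<lambda>w. test_fun e d w ^ M) \<in> bergman p \<omega>"
    "\<And>(e :: complex ^ 'n) d. norm e = 1 \<Longrightarrow> 0 < d \<Longrightarrow> d \<le> 1 \<Longrightarrow>
       powr_integral m p (\<lambda>w. test_fun e d w ^ M) \<le> ennreal (K * measure m (tent e d))"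
    "\<And>\<mu> a. sets \<mu> = sets m \<Longrightarrow> a \<in> ball 0 1 \<Longrightarrow> \<exists>e. norm e = 1 \<and>
       (measure m (tent e (1 - norm a)) \<le> K * measure m (carleson_block a) \<and>
        emeasure \<mu> (carleson_block a) \<le> ennreal K * powr_integral \<mu> q (\<lambda>w. test_fun e (1 - norm a) w ^ M))"
proof -
  obtain M :: nat where M: "2 * L \<le> 2 powr (M * p)" using exponent_exists[OF pq(1)] by blast
  define K1 where "K1 = 2 powr (M * p) * L * 2"
  \<comment> \<open>K1 comes from the kernel integral, L from passing from the half-size tent inside
    the block to the full one, and 3^(M q) from the lower bound 1/3 of the kernel on the
    block.\<close>
  define K where "K = max K1 (max L (3 powr (M * q)))"
  have int: "powr_integral m p (\<lambda>w. test_fun e d w ^ M) \<le> ennreal (K * measure m (tent e d))"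
    if e: "norm e = 1" "0 < d" "d \<le> 1" for e :: "complex ^ 'n" and d
  proof -
    have "powr_integral m p (\<lambda>w. test_fun e d w ^ M) = (\<integral>\<^sup>+w. ennreal (cmod (test_fun e d w) powr (M * p)) \<partial>m)"
      by (intro nn_integral_cong arg_cong[where f=ennreal] cmod_test_fun_power_powr e) (simp add: space_m)
    also have "\<dots> \<le> ennreal (K1 * measure m (tent e d))"
      unfolding K1_def using M pq by (intro test_fun_integral e) auto
    also have "\<dots> \<le> ennreal (K * measure m (tent e d))"
      by (intro ennreal_leI mult_right_mono) (auto simp: K_def)
    finally show ?thesis .
  qed
  have berg: "(\<lambda>w. test_fun e d w ^ M) \<in> bergman p \<omega>"
    if e: "norm e = 1" "0 < d" "d \<le> 1" for e :: "complex ^ 'n" and d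
    using int[OF e] by (auto simp: bergman_iff intro!: holomorphic_on_ball_power holomorphic_test_fun e intro: le_less_trans)
  show thesis
  proof (rule that[of K M])
    show "0 < K" using L_pos by (simp add: K_def less_max_iff_disj)
  next
    fix \<mu> and a :: "complex ^ 'n" assume sets_\<mu>: "sets \<mu> = sets m" and a: "a \<in> ball 0 1"
    let ?d = "1 - norm a"
    have d: "0 < ?d" "?d \<le> 1" using a by auto
    have [measurable_cong]: "sets \<mu> = sets m" by fact
    obtain e where e: "norm e = 1" "carleson_block a \<in> sets m"
      "tent e (?d / 2) \<subseteq> carleson_block a" "carleson_block a \<subseteq> tent e (2 * ?d)"
      using carleson_block_tents[OF a] by metis
    have "measure m (tent e ?d) \<le> L * measure m (tent e (?d / 2))" proof -
      have "2 * (?d / 2) = ?d" by simp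
      then show ?thesis using tent_double[OF e(1), of "?d / 2"] d by (simp only: half_gt_zero_iff)
    qed
    also have "\<dots> \<le> K * measure m (carleson_block a)"
      using e L_pos by (intro mult_mono finite_measure_mono) (auto simp: K_def)
    finally have 1: "measure m (tent e ?d) \<le> K * measure m (carleson_block a)" .
    have [measurable]: "carleson_block a \<in> sets \<mu>" using e(2) sets_\<mu> by simp
    have hol: "holomorphic_on_ball (\<lambda>w. test_fun e ?d w ^ M)"
      by (intro holomorphic_on_ball_power holomorphic_test_fun e d)
    note [measurable] = borel_measurable_holomorphic[OF hol]
    have "emeasure \<mu> (carleson_block a) = (\<integral>\<^sup>+w. indicator (carleson_block a) w \<partial>\<mu>)" by simp
    also have "\<dots> \<le> (\<integral>\<^sup>+w. ennreal K * ennreal (cmod (test_fun e ?d w ^ M) powr q) \<partial>\<mu>)"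
    proof (rule nn_integral_mono)
      fix w
      show "indicator (carleson_block a) w \<le> ennreal K * ennreal (cmod (test_fun e ?d w ^ M) powr q)"
      proof (cases "w \<in> carleson_block a")
        case True
        then have w: "w \<in> tent e (2 * ?d)" using e by auto
        then have w1: "norm w < 1" by (simp add: tent_def)
        have "(1 / 3) powr (M * q) \<le> cmod (test_fun e ?d w) powr (M * q)"
          using test_fun_ge[OF e(1) d w] pq by (intro powr_mono2) auto
        then have "3 powr (M * q) * (1 / 3) powr (M * q) \<le> 3 powr (M * q) * cmod (test_fun e ?d w ^ M) powr q"
          unfolding cmod_test_fun_power_powr[OF e(1) d w1] by (intro mult_left_mono) auto
        moreover have "3 powr (M * q) * (1 / 3) powr (M * q) = (1 :: real)" by (simp add: powr_mult[symmetric])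
        moreover have "3 powr (M * q) * cmod (test_fun e ?d w ^ M) powr q \<le> K * cmod (test_fun e ?d w ^ M) powr q"
          by (intro mult_right_mono) (auto simp: K_def)
        ultimately have "1 \<le> K * cmod (test_fun e ?d w ^ M) powr q" by linarith
        then have "ennreal 1 \<le> ennreal (K * cmod (test_fun e ?d w ^ M) powr q)" by (rule ennreal_leI)
        then show ?thesis using True by (simp add: ennreal_mult'')
      qed simp
    qed
    also have "\<dots> = ennreal K * powr_integral \<mu> q (\<lambda>w. test_fun e ?d w ^ M)"
      by (rule nn_integral_cmult) measurable
    finally show "\<exists>e. norm e = 1 \<and> (measure m (tent e ?d) \<le> K * measure m (carleson_block a) \<and>
        emeasure \<mu> (carleson_block a) \<le> ennreal K * powr_integral \<mu> q (\<lambda>w. test_fun e ?d w ^ M))"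
      using e(1) 1 by blast
  next
    fix e :: "complex ^ 'n" and d :: real assume e: "norm e = 1" "0 < d" "d \<le> 1"
    show "(\<lambda>w. test_fun e d w ^ M) \<in> bergman p \<omega>" by (rule berg[OF e])
    show "powr_integral m p (\<lambda>w. test_fun e d w ^ M) \<le> ennreal (K * measure m (tent e d))"
      by (rule int[OF e])
  qed (rule M)
qed

end

section \<open>Carleson measures\<close>

context weighted_ball
begin

lemma nn_integral_powr_cmult:
  assumes [measurable]: "f \<in> borel_measurable \<mu>" and "0 \<le> r"
  shows "powr_integral \<mu> q (\<lambda>z. of_real r * f z) = ennreal (r powr q) * powr_integral \<mu> q f"
  using assms(2) by (simp add: norm_mult powr_mult ennreal_mult nn_integral_cmult)

lemma enn2real_powr_le:
  fixes A x q r :: real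
  assumes "X < \<infinity>" "0 < q" "enn2real X powr (1 / q) \<le> A * x powr r" "0 \<le> A" "0 \<le> x"
  shows "X \<le> ennreal (A powr q * x powr (r * q))"
proof -
  have "(enn2real X powr (1 / q)) powr q \<le> (A * x powr r) powr q"
    using assms by (intro powr_mono2) auto
  then have "enn2real X \<le> A powr q * x powr (r * q)"
    using assms by (simp add: powr_powr powr_mult)
  then show ?thesis using assms(1) by (metis ennreal_enn2real ennreal_leI infinity_ennreal_def)
qed

lemma le_powr_enn2real:
  fixes A x q r :: real
  assumes "0 < q" "X \<le> ennreal (A * x powr (r * q))" "0 \<le> A" "0 \<le> x"
  shows "enn2real X powr (1 / q) \<le> A powr (1 / q) * x powr r"
proof -
  have "enn2real X \<le> A * x powr (r * q)"
    using assms by (intro enn2real_leI) auto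
  then have "enn2real X powr (1 / q) \<le> (A * x powr (r * q)) powr (1 / q)"
    using assms by (intro powr_mono2) auto
  then show ?thesis using assms by (simp add: powr_powr powr_mult)
qed

lemma zero_in_bergman: "0 < p \<Longrightarrow> (\<lambda>_ :: complex ^ 'n. 0) \<in> bergman p \<omega>"
  by (simp add: bergman_iff holomorphic_on_ball_const)

text \<open>Homogeneity of the supremum that defines \<open>Id_norm\<close>, written for integrals.
  Boundedness of the identity makes this supremum over reals one of a set bounded above.\<close>

lemma carleson_measure_Id_norm:
  fixes p q :: real and f :: "complex ^ 'n \<Rightarrow> complex"
  assumes pq: "0 < p" "0 < q" and sets_\<mu>: "sets \<mu> = sets m" and cm: "carleson_measure p q \<omega> \<mu>"
  shows "0 \<le> Id_norm p q \<omega> \<mu>"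
    and "f \<in> bergman p \<omega> \<Longrightarrow> powr_integral \<mu> q f
      \<le> ennreal (Id_norm p q \<omega> \<mu> powr q * enn2real (powr_integral m p f) powr (q / p))"
proof -
  let ?S = "{f :: complex ^ 'n \<Rightarrow> complex. f \<in> bergman p \<omega> \<and> bergman_norm p \<omega> f \<le> 1}"
  have [measurable_cong]: "sets \<mu> = sets m" by fact
  obtain B where B: "\<And>f. f \<in> bergman p \<omega> \<Longrightarrow> Lq_norm q \<mu> f \<le> B * bergman_norm p \<omega> f"
    and sub: "bergman p \<omega> \<subseteq> Lq q \<mu>"
    using cm unfolding carleson_measure_def by blast
  have nn: "0 \<le> bergman_norm p \<omega> f" "0 \<le> Lq_norm q \<mu> f" for f :: "complex ^ 'n \<Rightarrow> complex"
    by (simp_all add: bergman_norm_def Lq_norm_def)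
  have bdd: "bdd_above (Lq_norm q \<mu> ` ?S)"
  proof (rule bdd_aboveI2[of _ _ "\<bar>B\<bar>"])
    fix f assume f: "f \<in> ?S"
    have "Lq_norm q \<mu> f \<le> B * bergman_norm p \<omega> f" using f B by blast
    also have "\<dots> \<le> \<bar>B\<bar> * 1" using f nn by (intro mult_mono) auto
    finally show "Lq_norm q \<mu> f \<le> \<bar>B\<bar>" by simp
  qed
  have upper: "Lq_norm q \<mu> f \<le> Id_norm p q \<omega> \<mu>" if "f \<in> ?S" for f
    unfolding Id_norm_def by (rule cSUP_upper[OF that bdd])
  have "(\<lambda>_. 0) \<in> ?S" using zero_in_bergman[OF pq(1)] by (simp add: bergman_norm_def)
  from upper[OF this] nn(2) show Id: "0 \<le> Id_norm p q \<omega> \<mu>" by (meson order_trans)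
  assume f: "f \<in> bergman p \<omega>"
  then have hol: "holomorphic_on_ball f" by (simp add: bergman_iff)
  note [measurable] = borel_measurable_holomorphic[OF hol]
  let ?b = "bergman_norm p \<omega> f"
  have le: "Lq_norm q \<mu> f \<le> Id_norm p q \<omega> \<mu> * ?b"
  \<comment> \<open>A function of norm 0 cannot be rescaled to norm 1; for it boundedness itself
    forces the L^q norm to vanish.\<close>
  proof (cases "?b = 0")
    case True
    then show ?thesis using B[OF f] by simp
  next
    case False
    then have b: "0 < ?b" using nn(1)[of f] by simp
    define r where "r = 1 / ?b"
    have r: "0 < r" using b by (simp add: r_def)
    let ?g = "\<lambda>z. of_real r * f z"
    have hg: "holomorphic_on_ball ?g" by (intro holomorphic_on_ball_mult holomorphic_on_ball_const hol)
    have gb: "?g \<in> bergman p \<omega>"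
      using f hg r by (simp add: bergman_iff nn_integral_powr_cmult ennreal_mult_less_top)
    have "bergman_norm p \<omega> ?g = r * ?b"
      using hg hol r pq by (simp add: bergman_norm_eq nn_integral_powr_cmult enn2real_mult powr_mult powr_powr)
    then have "?g \<in> ?S" using gb b by (simp add: r_def)
    from upper[OF this] have "Lq_norm q \<mu> ?g \<le> Id_norm p q \<omega> \<mu>" .
    moreover have "Lq_norm q \<mu> ?g = r * Lq_norm q \<mu> f"
      using r pq by (simp add: Lq_norm_eq nn_integral_powr_cmult enn2real_mult powr_mult powr_powr)
    ultimately have x: "r * Lq_norm q \<mu> f \<le> Id_norm p q \<omega> \<mu>" by simp
    have "Lq_norm q \<mu> f = (r * Lq_norm q \<mu> f) * ?b" using b by (simp add: r_def)
    also have "\<dots> \<le> Id_norm p q \<omega> \<mu> * ?b" by (rule mult_right_mono[OF x nn(1)])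
    finally show ?thesis .
  qed
  have fin: "powr_integral \<mu> q f < \<infinity>" using sub f by (auto simp: Lq_iff)
  have "enn2real (powr_integral \<mu> q f) powr (1 / q)
    \<le> Id_norm p q \<omega> \<mu> * enn2real (powr_integral m p f) powr (1 / p)"
    using le hol by (simp add: Lq_norm_eq bergman_norm_eq)
  from enn2real_powr_le[OF fin pq(2) this Id]
  show "powr_integral \<mu> q f
      \<le> ennreal (Id_norm p q \<omega> \<mu> powr q * enn2real (powr_integral m p f) powr (q / p))"
    by simp
qed

lemma carleson_measure_of_embedding:
  fixes p q A :: real
  assumes pq: "0 < p" "0 < q" and sets_\<mu>: "sets \<mu> = sets m" and A: "0 \<le> A"
    and emb: "\<And>f. f \<in> bergman p \<omega> \<Longrightarrow> powr_integral \<mu> q f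
      \<le> ennreal (A * enn2real (powr_integral m p f) powr (q / p))"
  shows "carleson_measure p q \<omega> \<mu>" and "Id_norm p q \<omega> \<mu> powr q \<le> A"
proof -
  have [measurable_cong]: "sets \<mu> = sets m" by fact
  have meas: "f \<in> borel_measurable \<mu>" if "f \<in> bergman p \<omega>" for f :: "complex ^ 'n \<Rightarrow> complex"
    using that borel_measurable_holomorphic[of f] by (simp add: bergman_iff)
  have Lq: "f \<in> Lq q \<mu>" if "f \<in> bergman p \<omega>" for f
    using emb[OF that] meas[OF that] by (auto simp: Lq_iff intro: le_less_trans)
  have le: "Lq_norm q \<mu> f \<le> A powr (1 / q) * bergman_norm p \<omega> f" if f: "f \<in> bergman p \<omega>" for f
  proof -
    have "enn2real (powr_integral \<mu> q f) powr (1 / q)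
      \<le> A powr (1 / q) * enn2real (powr_integral m p f) powr (1 / p)"
      using emb[OF f] pq A by (intro le_powr_enn2real) auto
    then show ?thesis using f meas[OF f] by (simp add: Lq_norm_eq bergman_norm_eq bergman_iff)
  qed
  show "carleson_measure p q \<omega> \<mu>" unfolding carleson_measure_def using Lq le by blast
  have "Id_norm p q \<omega> \<mu> \<le> A powr (1 / q)"
    unfolding Id_norm_def
  proof (rule cSUP_least)
    show "{f :: complex ^ 'n \<Rightarrow> complex. f \<in> bergman p \<omega> \<and> bergman_norm p \<omega> f \<le> 1} \<noteq> {}"
      using zero_in_bergman[OF pq(1)] by (auto simp: bergman_norm_def intro!: exI[of _ "\<lambda>_. 0"])
    fix f :: "complex ^ 'n \<Rightarrow> complex" assume f: "f \<in> {f \<in> bergman p \<omega>. bergman_norm p \<omega> f \<le> 1}"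
    then have "Lq_norm q \<mu> f \<le> A powr (1 / q) * bergman_norm p \<omega> f" by (intro le) auto
    also have "\<dots> \<le> A powr (1 / q) * 1" using f by (intro mult_left_mono) auto
    finally show "Lq_norm q \<mu> f \<le> A powr (1 / q)" by simp
  qed
  moreover have "0 \<le> Id_norm p q \<omega> \<mu>"
    by (rule carleson_measure_Id_norm(1)[OF pq sets_\<mu> \<open>carleson_measure p q \<omega> \<mu>\<close>])
  ultimately have "Id_norm p q \<omega> \<mu> powr q \<le> (A powr (1 / q)) powr q"
    using pq by (intro powr_mono2) auto
  then show "Id_norm p q \<omega> \<mu> powr q \<le> A" using pq A by (simp add: powr_powr)
qed

text \<open>The embedding is tested on kernel powers. Keeping A apart from K allows A to be the q-th
  power of the operator norm while K stays independent of \<mu>.\<close>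

lemma ratio_of_embedding:
  fixes p q :: real
  assumes pq: "0 < p" "p \<le> q"
  shows "\<exists>K>0. \<forall>\<mu> A. sets \<mu> = sets m \<longrightarrow> 0 \<le> A \<longrightarrow>
    (\<forall>f\<in>bergman p \<omega>. powr_integral \<mu> q f
      \<le> ennreal (A * enn2real (powr_integral m p f) powr (q / p))) \<longrightarrow>
    (\<forall>a\<in>ball 0 1. carleson_ratio p q \<omega> \<mu> a \<le> ennreal (K * A))"
proof -
  obtain M :: nat and K :: real where K: "0 < K" and "2 * L \<le> 2 powr (M * p)"
    and berg: "\<And>(e :: complex ^ 'n) d. norm e = 1 \<Longrightarrow> 0 < d \<Longrightarrow> d \<le> 1 \<Longrightarrow> (\<lambda>w. test_fun e d w ^ M) \<in> bergman p \<omega>"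
    and int: "\<And>(e :: complex ^ 'n) d. norm e = 1 \<Longrightarrow> 0 < d \<Longrightarrow> d \<le> 1 \<Longrightarrow>
       powr_integral m p (\<lambda>w. test_fun e d w ^ M) \<le> ennreal (K * measure m (tent e d))"
    and block: "\<And>\<mu> a. sets \<mu> = sets m \<Longrightarrow> a \<in> ball 0 1 \<Longrightarrow> \<exists>e. norm e = 1 \<and>
       (measure m (tent e (1 - norm a)) \<le> K * measure m (carleson_block a) \<and>
        emeasure \<mu> (carleson_block a) \<le> ennreal K * powr_integral \<mu> q (\<lambda>w. test_fun e (1 - norm a) w ^ M))"
    by (rule test_functions[OF pq], rule that)
  have \<alpha>: "0 \<le> q / p" using pq by simp
  show ?thesis
  proof (intro exI[of _ "K * (K * K) powr (q / p)"] conjI allI impI ballI)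
    show "0 < K * (K * K) powr (q / p)" using K by simp
  next
    fix \<mu> and A :: real and a :: "complex ^ 'n"
    assume sets_\<mu>: "sets \<mu> = sets m" and A: "0 \<le> A" and a: "a \<in> ball 0 1"
      and emb: "\<forall>f\<in>bergman p \<omega>. powr_integral \<mu> q f
        \<le> ennreal (A * enn2real (powr_integral m p f) powr (q / p))"
    have d: "0 < 1 - norm a" "1 - norm a \<le> 1" using a by auto
    obtain e where e: "norm e = 1" and me: "measure m (tent e (1 - norm a)) \<le> K * measure m (carleson_block a)"
      and bl: "emeasure \<mu> (carleson_block a) \<le> ennreal K * powr_integral \<mu> q (\<lambda>w. test_fun e (1 - norm a) w ^ M)"
      using block[OF sets_\<mu> a] by blast
    have "enn2real (powr_integral m p (\<lambda>w. test_fun e (1 - norm a) w ^ M)) \<le> K * measure m (tent e (1 - norm a))"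
      using int[OF e d] K by (intro enn2real_leI) auto
    also have "\<dots> \<le> K * (K * measure m (carleson_block a))" using me K by (intro mult_left_mono) auto
    finally have I: "enn2real (powr_integral m p (\<lambda>w. test_fun e (1 - norm a) w ^ M)) \<le> (K * K) * measure m (carleson_block a)" by simp
    note bl
    also have "ennreal K * powr_integral \<mu> q (\<lambda>w. test_fun e (1 - norm a) w ^ M)
      \<le> ennreal K * ennreal (A * enn2real (powr_integral m p (\<lambda>w. test_fun e (1 - norm a) w ^ M)) powr (q / p))"
      using emb berg[OF e d] by (intro mult_left_mono) auto
    also have "\<dots> = ennreal (K * (A * enn2real (powr_integral m p (\<lambda>w. test_fun e (1 - norm a) w ^ M)) powr (q / p)))"
      using K A by (simp add: ennreal_mult)
    also have "\<dots> \<le> ennreal (K * (A * ((K * K) * measure m (carleson_block a)) powr (q / p)))"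
      using K A I \<alpha> by (intro ennreal_leI mult_left_mono powr_mono2) auto
    also have "K * (A * ((K * K) * measure m (carleson_block a)) powr (q / p))
      = K * (K * K) powr (q / p) * A * measure m (carleson_block a) powr (q / p)"
    proof -
      have "K * (A * (y * x) powr r) = K * y powr r * A * x powr r" for x y r :: real
        by (simp add: powr_mult mult_ac)
      then show ?thesis .
    qed
    finally show "carleson_ratio p q \<omega> \<mu> a \<le> ennreal (K * (K * K) powr (q / p) * A)"
      using K A by (subst carleson_ratio_le_iff[OF a]) auto
  qed
qed

lemma embedding_of_ratio:
  fixes p q :: real
  assumes pq: "0 < p" "p \<le> q"
  shows "\<exists>K>0. \<forall>\<mu> N. sets \<mu> = sets m \<longrightarrow> 0 \<le> N \<longrightarrow>
    (\<forall>e d. norm e = 1 \<longrightarrow> 0 < d \<longrightarrow> emeasure \<mu> (tent e d) \<le> ennreal (N * measure m (tent e d) powr (q / p))) \<longrightarrow>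
    (\<forall>f\<in>bergman p \<omega>. powr_integral \<mu> q f
      \<le> ennreal (K * N * enn2real (powr_integral m p f) powr (q / p)))"
proof -
  obtain K where K: "K > 0" and emb: "\<forall>\<mu> N \<alpha> f. sets \<mu> = sets m \<longrightarrow> 0 \<le> N \<longrightarrow> 1 \<le> \<alpha> \<longrightarrow>
    (\<forall>e d. norm e = 1 \<longrightarrow> 0 < d \<longrightarrow> emeasure \<mu> (tent e d) \<le> ennreal (N * measure m (tent e d) powr \<alpha>)) \<longrightarrow>
    holomorphic_on_ball f \<longrightarrow> powr_integral m p f < \<infinity> \<longrightarrow>
    powr_integral \<mu> (p * \<alpha>) f
      \<le> ennreal (N * (K * enn2real (powr_integral m p f)) powr \<alpha>)"
    using carleson_embedding[OF pq(1)] by blast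
  have \<alpha>: "1 \<le> q / p" "p * (q / p) = q" using pq by auto
  show ?thesis
  proof (intro exI[of _ "K powr (q / p)"] conjI allI impI ballI)
    show "0 < K powr (q / p)" using K by simp
  next
    fix \<mu> and N :: real and f :: "complex ^ 'n \<Rightarrow> complex"
    assume "sets \<mu> = sets m" "0 \<le> N" "f \<in> bergman p \<omega>"
      and "\<forall>e d. norm e = 1 \<longrightarrow> 0 < d \<longrightarrow> emeasure \<mu> (tent e d) \<le> ennreal (N * measure m (tent e d) powr (q / p))"
    then have "(\<integral>\<^sup>+z. ennreal (cmod (f z) powr (p * (q / p))) \<partial>\<mu>)
      \<le> ennreal (N * (K * enn2real (powr_integral m p f)) powr (q / p))"
      using emb \<alpha>(1) by (simp only: bergman_iff)
    then show "powr_integral \<mu> q f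
      \<le> ennreal (K powr (q / p) * N * enn2real (powr_integral m p f) powr (q / p))"
      unfolding \<alpha>(2) by (simp add: powr_mult mult_ac)
  qed
qed

theorem carleson_characterization:
  fixes p q :: real
  assumes pq: "0 < p" "p \<le> q"
  shows "\<exists>K>0. \<forall>\<mu>. sets \<mu> = sets m \<longrightarrow>
    (carleson_measure p q \<omega> \<mu> \<longleftrightarrow> (SUP a\<in>ball 0 1. carleson_ratio p q \<omega> \<mu> a) < \<infinity>) \<and>
    (carleson_measure p q \<omega> \<mu> \<longrightarrow>
      ennreal (inverse K * Id_norm p q \<omega> \<mu> powr q) \<le> (SUP a\<in>ball 0 1. carleson_ratio p q \<omega> \<mu> a) \<and>
      (SUP a\<in>ball 0 1. carleson_ratio p q \<omega> \<mu> a) \<le> ennreal (K * Id_norm p q \<omega> \<mu> powr q))"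
proof -
  have q: "0 < q" using pq by simp
  obtain K1 where K1: "K1 > 0" and r1: "\<forall>\<mu> A. sets \<mu> = sets m \<longrightarrow> 0 \<le> A \<longrightarrow>
    (\<forall>f\<in>bergman p \<omega>. powr_integral \<mu> q f
      \<le> ennreal (A * enn2real (powr_integral m p f) powr (q / p))) \<longrightarrow>
    (\<forall>a\<in>ball 0 1. carleson_ratio p q \<omega> \<mu> a \<le> ennreal (K1 * A))"
    using ratio_of_embedding[OF pq] by blast
  obtain K2 where K2: "K2 > 0" and r2: "\<forall>\<mu> N. sets \<mu> = sets m \<longrightarrow> 0 \<le> N \<longrightarrow>
    (\<forall>e d. norm e = 1 \<longrightarrow> 0 < d \<longrightarrow> emeasure \<mu> (tent e d) \<le> ennreal (N * measure m (tent e d) powr (q / p))) \<longrightarrow>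
    (\<forall>f\<in>bergman p \<omega>. powr_integral \<mu> q f
      \<le> ennreal (K2 * N * enn2real (powr_integral m p f) powr (q / p)))"
    using embedding_of_ratio[OF pq] by blast
  \<comment> \<open>The tent condition follows from the block condition at the cost of two
    doublings, hence the factor (L^2)^(q/p).\<close>
  define K3 where "K3 = K2 * (L\<^sup>2) powr (q / p)"
  have K3: "K3 > 0" using K2 L_pos by (simp add: K3_def)
  have necessity: "(SUP a\<in>ball 0 1. carleson_ratio p q \<omega> \<mu> a) \<le> ennreal (K1 * Id_norm p q \<omega> \<mu> powr q)"
    if s: "sets \<mu> = sets m" and cm: "carleson_measure p q \<omega> \<mu>" for \<mu>
    using r1 s carleson_measure_Id_norm(2)[OF pq(1) q s cm] by (intro SUP_least) simp
  have sufficiency: "carleson_measure p q \<omega> \<mu>" "Id_norm p q \<omega> \<mu> powr q \<le> K3 * enn2real (SUP a\<in>ball 0 1. carleson_ratio p q \<omega> \<mu> a)"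
    if s: "sets \<mu> = sets m" and fin: "(SUP a\<in>ball 0 1. carleson_ratio p q \<omega> \<mu> a) < \<infinity>" for \<mu>
  proof -
    let ?S = "SUP a\<in>ball 0 1. carleson_ratio p q \<omega> \<mu> a"
    define N where "N = enn2real ?S"
    have N: "0 \<le> N" "ennreal N = ?S" using fin by (auto simp: N_def)
    have ratio: "carleson_ratio p q \<omega> \<mu> a \<le> ennreal N" if "a \<in> ball 0 1" for a
      unfolding N(2) using that by (rule SUP_upper)
    have "emeasure \<mu> (tent e d) \<le> ennreal (N * (L\<^sup>2) powr (q / p) * measure m (tent e d) powr (q / p))"
      if ed: "norm e = 1" "0 < d" for e d
      by (rule tent_bound_of_ratio[OF s N(1) pq ed refl], rule ratio) (use ed in auto)
    then have emb: "\<And>f. f \<in> bergman p \<omega> \<Longrightarrow> powr_integral \<mu> q f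
      \<le> ennreal (K2 * (N * (L\<^sup>2) powr (q / p)) * enn2real (powr_integral m p f) powr (q / p))"
      using r2[rule_format, OF s, of "N * (L\<^sup>2) powr (q / p)"] N(1) by simp
    have nn: "0 \<le> K2 * (N * (L\<^sup>2) powr (q / p))" using N K2 by simp
    note c = carleson_measure_of_embedding[OF pq(1) q s nn emb]
    show "carleson_measure p q \<omega> \<mu>" by (rule c(1))
    show "Id_norm p q \<omega> \<mu> powr q \<le> K3 * enn2real ?S" using c(2) by (simp add: K3_def N_def mult_ac)
  qed
  let ?K = "max K1 K3"
  show ?thesis
  proof (intro exI[of _ ?K] conjI allI impI)
    show "0 < ?K" using K1 by simp
  next
    fix \<mu> :: "(complex ^ 'n) measure" assume s: "sets \<mu> = sets m"
    have fin: "(SUP a\<in>ball 0 1. carleson_ratio p q \<omega> \<mu> a) < \<infinity>" if "carleson_measure p q \<omega> \<mu>"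
      using necessity[OF s that] by (rule le_less_trans) simp
    then show "carleson_measure p q \<omega> \<mu> \<longleftrightarrow> (SUP a\<in>ball 0 1. carleson_ratio p q \<omega> \<mu> a) < \<infinity>"
      using sufficiency(1)[OF s] by blast
    assume cm: "carleson_measure p q \<omega> \<mu>"
    let ?S = "SUP a\<in>ball 0 1. carleson_ratio p q \<omega> \<mu> a"
    have "?S \<le> ennreal (K1 * Id_norm p q \<omega> \<mu> powr q)" by (rule necessity[OF s cm])
    also have "\<dots> \<le> ennreal (?K * Id_norm p q \<omega> \<mu> powr q)" by (intro ennreal_leI mult_right_mono) auto
    finally show "?S \<le> ennreal (?K * Id_norm p q \<omega> \<mu> powr q)" .
    have "Id_norm p q \<omega> \<mu> powr q \<le> K3 * enn2real ?S" by (rule sufficiency(2)[OF s fin[OF cm]])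
    also have "\<dots> \<le> ?K * enn2real ?S" by (intro mult_right_mono) auto
    finally have "inverse ?K * Id_norm p q \<omega> \<mu> powr q \<le> enn2real ?S" using K1 by (simp add: field_simps less_max_iff_disj)
    then have "ennreal (inverse ?K * Id_norm p q \<omega> \<mu> powr q) \<le> ennreal (enn2real ?S)" by (rule ennreal_leI)
    also have "\<dots> = ?S" using fin[OF cm] by simp
    finally show "ennreal (inverse ?K * Id_norm p q \<omega> \<mu> powr q) \<le> ?S" .
  qed
qed

end

section \<open>Normal families\<close>

text \<open>The filter expresses |a| -> 1 from inside the ball; the collar form is the shape in
  which both implications use the limit.\<close>

lemma tendsto_zero_at_unit_sphere_iff:
  fixes f :: "'a::real_normed_vector \<Rightarrow> ennreal"
  shows "(f \<longlongrightarrow> 0) (filtercomap norm (at_left 1)) \<longleftrightarrow>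
    (\<forall>\<epsilon>>0. \<exists>h>0. \<forall>a. 1 - h < norm a \<and> norm a < 1 \<longrightarrow> f a \<le> ennreal \<epsilon>)"
proof
  assume lim: "(f \<longlongrightarrow> 0) (filtercomap norm (at_left 1))"
  show "\<forall>\<epsilon>>0. \<exists>h>0. \<forall>a. 1 - h < norm a \<and> norm a < 1 \<longrightarrow> f a \<le> ennreal \<epsilon>"
  proof (intro allI impI)
    fix \<epsilon> :: real assume "0 < \<epsilon>"
    then have "eventually (\<lambda>a. f a < ennreal \<epsilon>) (filtercomap norm (at_left 1))"
      using lim by (intro order_tendstoD(2)) auto
    then obtain Q where Q: "eventually Q (at_left (1::real))" "\<And>a. Q (norm a) \<Longrightarrow> f a < ennreal \<epsilon>"
      by (auto simp: eventually_filtercomap)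
    from Q(1) obtain b where b: "b < 1" "\<And>y. b < y \<Longrightarrow> y < 1 \<Longrightarrow> Q y"
      using eventually_at_left[of 0 1 Q] by auto
    show "\<exists>h>0. \<forall>a. 1 - h < norm a \<and> norm a < 1 \<longrightarrow> f a \<le> ennreal \<epsilon>"
      using b Q(2) by (intro exI[of _ "1 - b"]) (auto intro: less_imp_le)
  qed
next
  assume R: "\<forall>\<epsilon>>0. \<exists>h>0. \<forall>a. 1 - h < norm a \<and> norm a < 1 \<longrightarrow> f a \<le> ennreal \<epsilon>"
  show "(f \<longlongrightarrow> 0) (filtercomap norm (at_left 1))"
  proof (rule order_tendstoI)
    fix b :: ennreal assume "0 < b"
    then obtain y where y: "0 < y" "y < b" using dense by blast
    then obtain \<epsilon> where e: "y = ennreal \<epsilon>" "0 < \<epsilon>" by (cases y) auto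
    then obtain h where h: "0 < h" "\<And>a. 1 - h < norm a \<and> norm a < 1 \<Longrightarrow> f a \<le> ennreal \<epsilon>" using R by blast
    have "eventually (\<lambda>t. 1 - h < t \<and> t < 1) (at_left (1::real))"
      using h(1) by (subst eventually_at_left[of 0]) (auto intro!: exI[of _ "1 - h"])
    then show "eventually (\<lambda>a. f a < b) (filtercomap norm (at_left 1))"
    proof -
      have "f a < b" if "1 - h < norm a \<and> norm a < 1" for a
        using h(2)[OF that] y(2) unfolding e(1) by (rule order_le_less_trans)
      then show ?thesis
        unfolding eventually_filtercomap using \<open>eventually _ (at_left (1::real))\<close>
        by (intro exI[of _ "\<lambda>t. 1 - h < t \<and> t < 1"]) simp
    qed
  qed auto
qed

text \<open>Valid for every q > 0, also where L^q is only quasi-normed: |a - b| is at most twice the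
  larger modulus.\<close>

lemma cmod_diff_powr_le:
  fixes q :: real
  assumes "0 < q"
  shows "cmod (a - b) powr q \<le> 2 powr q * (cmod a powr q + cmod b powr q)"
proof -
  have "cmod (a - b) \<le> 2 * max (cmod a) (cmod b)" using norm_triangle_ineq4[of a b] by simp
  then have "cmod (a - b) powr q \<le> (2 * max (cmod a) (cmod b)) powr q" using assms by (intro powr_mono2) auto
  also have "\<dots> = 2 powr q * max (cmod a) (cmod b) powr q" by (simp add: powr_mult)
  also have "\<dots> \<le> 2 powr q * (cmod a powr q + cmod b powr q)"
    by (intro mult_left_mono) (auto simp: max_def)
  finally show ?thesis .
qed

lemma nn_integral_diff_powr_le:
  fixes q :: real
  assumes q: "0 < q" and [measurable]: "f \<in> borel_measurable \<mu>" "g \<in> borel_measurable \<mu>"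
  shows "powr_integral \<mu> q (\<lambda>z. f z - g z)
    \<le> ennreal (2 powr q) * (powr_integral \<mu> q f + powr_integral \<mu> q g)"
proof -
  have "powr_integral \<mu> q (\<lambda>z. f z - g z)
    \<le> (\<integral>\<^sup>+z. ennreal (2 powr q) * (ennreal (cmod (f z) powr q) + ennreal (cmod (g z) powr q)) \<partial>\<mu>)"
    using cmod_diff_powr_le[OF q]
    by (intro nn_integral_mono) (simp add: ennreal_plus[symmetric] ennreal_mult[symmetric] ennreal_leI del: ennreal_plus)
  then show ?thesis by (simp add: nn_integral_cmult nn_integral_add)
qed

text \<open>Cauchy's estimate for the derivative of f along the complex line through x and y; it
  turns local bounds into equicontinuity.\<close>

lemma holomorphic_on_ball_lipschitz:
  fixes f :: "complex ^ 'n::finite \<Rightarrow> complex"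
  assumes f: "holomorphic_on_ball f" and r: "0 < r" "norm x + r < 1"
    and B: "\<And>w. norm (w - x) \<le> r \<Longrightarrow> cmod (f w) \<le> B" and y: "norm (y - x) \<le> r / 2"
  shows "cmod (f y - f x) \<le> 2 * (B + 1) / r * norm (y - x)"
proof (cases "y = x")
  case False
  define u where "u = sgn (y - x)"
  have u: "norm u = 1" using False by (simp add: u_def norm_sgn)
  have y_eq: "x + of_real (norm (y - x)) *s u = y"
  proof -
    have "of_real c *s v = c *\<^sub>R v" for c and v :: "complex ^ 'n"
      by (simp add: vec_eq_iff scaleR_conv_of_real[where 'a=complex])
    then show ?thesis using False by (simp add: u_def sgn_div_norm)
  qed
  define h where "h l = f (x + l *s u)" for l
  have hol: "h holomorphic_on ball 0 (1 - norm x)"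
    unfolding h_def
  proof (rule holomorphic_on_line[OF f])
    fix l :: complex assume "l \<in> ball 0 (1 - norm x)"
    then show "norm (x + l *s u) < 1"
      using norm_triangle_ineq[of x "l *s u"] u by (simp add: norm_smult_vec)
  qed simp
  have hB: "cmod (h l) \<le> B" if "cmod l \<le> r" for l
    unfolding h_def using that u by (intro B) (simp add: norm_smult_vec)
  have der: "cmod (deriv h z) \<le> 2 * (B + 1) / r" if z: "z \<in> cball 0 (r / 2)" for z
  proof -
    have sub: "cball z (r / 2) \<subseteq> cball 0 r"
    proof
      fix w assume "w \<in> cball z (r / 2)"
      then show "w \<in> cball 0 r" using z norm_triangle_ineq[of z "w - z"] by (simp add: dist_norm norm_minus_commute)
    qed
    have sub': "cball 0 r \<subseteq> ball 0 (1 - norm x)" using r by auto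
    \<comment> \<open>The derivative bound asks for values in an open disc, hence
      \<open>B + 1\<close> in place of \<open>B\<close>. Discs of radius r/2 around z stay in the
      disc of radius r where \<open>B\<close> is available.\<close>
    have "cmod ((deriv ^^ 1) h z) \<le> fact 1 * (B + 1) / (r / 2) ^ 1"
    proof (rule Cauchy_higher_deriv_bound[of _ _ _ 0])
      have "ball z (r / 2) \<subseteq> ball 0 (1 - norm x)" using sub sub' ball_subset_cball by blast
      then show "h holomorphic_on ball z (r / 2)" by (rule holomorphic_on_subset[OF hol])
      show "continuous_on (cball z (r / 2)) h"
        using sub sub' by (intro holomorphic_on_imp_continuous_on holomorphic_on_subset[OF hol]) blast
      fix w assume "w \<in> ball z (r / 2)"
      then have "w \<in> cball 0 r" using sub ball_subset_cball by blast
      then have "cmod (h w) \<le> B" by (intro hB) simp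
      then show "h w \<in> ball 0 (B + 1)" by simp
    qed (use r in auto)
    moreover have "fact 1 * (B + 1) / (r / 2) ^ 1 = 2 * (B + 1) / r" by (simp add: mult.commute)
    moreover have "(deriv ^^ 1) h = deriv h" by simp
    ultimately show ?thesis by (simp only:)
  qed
  have "cmod (h (of_real (norm (y - x))) - h 0) \<le> 2 * (B + 1) / r * cmod (of_real (norm (y - x)) - 0)"
  proof (rule field_differentiable_bound[where S="cball 0 (r / 2)" and f'="deriv h"])
    fix z :: complex assume z: "z \<in> cball 0 (r / 2)"
    have "cmod z < 1 - norm x" using z r by (simp only: mem_cball dist_0_norm)
    then have "z \<in> ball 0 (1 - norm x)" by (simp only: mem_ball dist_0_norm)
    then show "(h has_field_derivative deriv h z) (at z within cball 0 (r / 2))"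
      by (rule has_field_derivative_at_within[OF holomorphic_derivI[OF hol open_ball]])
    show "cmod (deriv h z) \<le> 2 * (B + 1) / r" by (rule der[OF z])
  qed (use r y in auto)
  then show ?thesis by (simp add: h_def y_eq)
qed simp

text \<open>Arzela-Ascoli on each closed ball of radius 1 - 1/(i+1), with equicontinuity from bounds
  on a slightly larger ball, followed by a diagonal subsequence over i.\<close>

lemma montel_ball:
  fixes f :: "nat \<Rightarrow> complex ^ 'n::finite \<Rightarrow> complex"
  assumes f: "\<And>k. holomorphic_on_ball (f k)"
    and bd: "\<And>r. r < 1 \<Longrightarrow> \<exists>B. \<forall>k. \<forall>z\<in>cball 0 r. cmod (f k z) \<le> B"
  shows "\<exists>s g. strict_mono (s :: nat \<Rightarrow> nat) \<and>
    (\<forall>r<1. \<forall>\<epsilon>>0. \<exists>N. \<forall>n\<ge>N. \<forall>z\<in>cball 0 r. cmod (f (s n) z - g z) < \<epsilon>)"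
proof -
  define K where "K i = cball (0 :: complex ^ 'n) (1 - 1 / real (Suc i))" for i
  define P where "P i t \<longleftrightarrow> (\<exists>g. \<forall>\<epsilon>>0. \<exists>N. \<forall>n\<ge>N. \<forall>z\<in>K i. cmod (f (t n) z - g z) < \<epsilon>)" for i and t :: "nat \<Rightarrow> nat"
  have sub: "\<exists>k :: nat \<Rightarrow> nat. strict_mono k \<and> P i (t \<circ> k)" for i t
  proof -
    define R where "R = 1 - 1 / real (Suc i)"
    have R: "0 \<le> R" "R < 1" by (auto simp: R_def field_simps)
    define r where "r = (1 - R) / 2"
    have r: "0 < r" "R + r < 1" using R by (auto simp: r_def field_simps)
    obtain B where B: "\<And>k z. z \<in> cball 0 (R + r) \<Longrightarrow> cmod (f k z) \<le> B" using bd[OF r(2)] by blast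
    have B0: "0 \<le> B" using B[of 0 0] R r by (meson centre_in_cball add_nonneg_nonneg less_imp_le norm_ge_zero order_trans)
    obtain g k where gk: "strict_mono (k :: nat \<Rightarrow> nat)"
      "\<And>e. 0 < e \<Longrightarrow> \<exists>N. \<forall>n x. n \<ge> N \<and> x \<in> K i \<longrightarrow> norm ((f \<circ> t) (k n) x - g x) < e"
    proof (rule Arzela_Ascoli[of "K i" "f \<circ> t" B])
      show "compact (K i)" by (simp add: K_def)
      show "cmod ((f \<circ> t) n x) \<le> B" if "x \<in> K i" for n x
        unfolding o_def using that r(1) by (intro B) (auto simp: K_def R_def)
      fix x and e :: real assume x: "x \<in> K i" and e: "0 < e"
      let ?c = "2 * (B + 1) / r"
      have c: "0 < ?c" using B0 r by simp
      have "cmod ((f \<circ> t) n x - (f \<circ> t) n y) < e" if y: "norm (x - y) < min (r / 2) (e / ?c)" for n y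
      proof -
        have "cmod (f (t n) y - f (t n) x) \<le> ?c * norm (y - x)"
        proof (rule holomorphic_on_ball_lipschitz[OF f r(1)])
          have nx: "norm x \<le> R" using x by (simp add: K_def R_def)
          then show "norm x + r < 1" using r by simp
          show "norm (y - x) \<le> r / 2" using y by (simp add: norm_minus_commute)
          fix w assume "norm (w - x) \<le> r"
          then have "norm w \<le> R + r" using norm_triangle_ineq[of x "w - x"] nx by simp
          then show "cmod (f (t n) w) \<le> B" by (intro B) simp
        qed
        also have "\<dots> < ?c * (e / ?c)" using y c by (intro mult_strict_left_mono) (auto simp: norm_minus_commute)
        also have "\<dots> = e" using c by (metis nonzero_mult_div_cancel_left less_irrefl times_divide_eq_right)
        finally show ?thesis by (simp add: norm_minus_commute)
      qed
      moreover have "0 < min (r / 2) (e / ?c)" using r(1) divide_pos_pos[OF e c] by (simp only: min_less_iff_conj half_gt_zero_iff)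
      ultimately show "\<exists>d>0. \<forall>n y. y \<in> K i \<and> norm (x - y) < d \<longrightarrow> cmod ((f \<circ> t) n x - (f \<circ> t) n y) < e" by blast
    qed (rule that)
    then have "P i (t \<circ> k)" unfolding P_def o_def by (intro exI[of _ g]) meson
    then show ?thesis using gk(1) by blast
  qed
  obtain s where s: "strict_mono (s :: nat \<Rightarrow> nat)" "\<And>i. P i (id \<circ> s)"
  proof (rule subsequence_diagonalization_lemma[of P id, OF sub])
    fix i and t k1 k2 :: "nat \<Rightarrow> nat" and N
    assume P1: "P i (t \<circ> k1)" and k2: "\<And>j. N \<le> j \<Longrightarrow> \<exists>j'\<ge>j. k2 j = k1 j'"
    then obtain g where g: "\<forall>\<epsilon>>0. \<exists>N. \<forall>n\<ge>N. \<forall>z\<in>K i. cmod (f (t (k1 n)) z - g z) < \<epsilon>" by (auto simp: P_def)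
    have "\<exists>N'. \<forall>n\<ge>N'. \<forall>z\<in>K i. cmod (f (t (k2 n)) z - g z) < \<epsilon>" if e: "0 < \<epsilon>" for \<epsilon>
    proof -
      obtain N1 where N1: "\<And>n z. n \<ge> N1 \<Longrightarrow> z \<in> K i \<Longrightarrow> cmod (f (t (k1 n)) z - g z) < \<epsilon>" using g e by blast
      show ?thesis
      proof (intro exI[of _ "max N N1"] allI impI ballI)
        fix n z assume n: "max N N1 \<le> n" and z: "z \<in> K i"
        obtain j where "j \<ge> n" "k2 n = k1 j" using k2[of n] n by auto
        then show "cmod (f (t (k2 n)) z - g z) < \<epsilon>" using N1[of j z] n z by simp
      qed
    qed
    then show "P i (t \<circ> k2)" unfolding P_def o_def by blast
  qed (rule that)
  \<comment> \<open>The limits on the individual compact balls agree with the pointwise limit, which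
    serves as one function for all of them.\<close>
  define g where "g z = lim (\<lambda>n. f (s n) z)" for z
  have "\<exists>N. \<forall>n\<ge>N. \<forall>z\<in>cball 0 r. cmod (f (s n) z - g z) < \<epsilon>" if r: "r < 1" and e: "0 < \<epsilon>" for r \<epsilon>
  proof -
    obtain i where i: "1 / real (Suc i) < 1 - r" using r nat_approx_posE[of "1 - r"] by auto
    have sub: "cball 0 r \<subseteq> K i" using i by (auto simp: K_def)
    obtain gi where gi: "\<forall>\<epsilon>>0. \<exists>N. \<forall>n\<ge>N. \<forall>z\<in>K i. cmod (f (s n) z - gi z) < \<epsilon>" using s(2)[of i] by (auto simp: P_def)
    have "gi z = g z" if z: "z \<in> K i" for z
    proof -
      have "(\<lambda>n. f (s n) z) \<longlonglongrightarrow> gi z"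
        unfolding LIMSEQ_iff using gi z by blast
      then show ?thesis by (simp add: g_def limI)
    qed
    then show ?thesis using gi e sub by (metis (no_types, lifting) subsetD)
  qed
  then show ?thesis using s(1) by blast
qed

section \<open>Vanishing Carleson measures\<close>

context weighted_ball
begin

text \<open>Point evaluation divides by the measure of a tent of size at least 1 - r. The number k
  of doublings that takes such a tent to the ball depends on r alone, so the constant is uniform in
  z and f.\<close>

lemma local_bound:
  fixes p :: real
  assumes p: "0 < p" and r: "r < 1"
  shows "\<exists>B\<ge>0. \<forall>f\<in>bergman p \<omega>. \<forall>z\<in>cball (0 :: complex ^ 'n) r.
    cmod (f z) powr p \<le> B * enn2real (powr_integral m p f)"
proof -
  obtain k where "2 / (1 - r) < 2 ^ k" using real_arch_pow[of 2 "2 / (1 - r)"] by auto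
  then have k: "2 \<le> 2 ^ k * (1 - r)" using r by (simp add: field_simps)
  let ?b = "measure m (ball 0 1)"
  define B where "B = C * L ^ k / ?b"
  have B: "0 \<le> B" using C_pos L_pos by (simp add: B_def)
  show ?thesis
  proof (intro exI[of _ B] conjI ballI B)
    fix f :: "complex ^ 'n \<Rightarrow> complex" and z :: "complex ^ 'n" assume f: "f \<in> bergman p \<omega>" and z: "z \<in> cball 0 r"
    then have hol: "holomorphic_on_ball f" and fin: "powr_integral m p f < \<infinity>"
      by (auto simp: bergman_iff)
    let ?I = "enn2real (powr_integral m p f)"
    have nz: "norm z \<le> r" using z by simp
    obtain e where e: "norm e = 1" "z = norm z *\<^sub>R e"
      by (rule obtain_direction)
    define d where "d = 1 - norm z"
    have d: "0 < d" "d \<le> 1" "z = (1 - d) *\<^sub>R e" using nz r e(2) by (auto simp: d_def)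
    have "tent e (2 ^ k * d) = ball 0 1"
    proof (rule tent_eq_ball[OF e(1)])
      have "2 ^ k * (1 - r) \<le> 2 ^ k * d" using nz by (intro mult_left_mono) (auto simp: d_def)
      then show "2 \<le> 2 ^ k * d" using k by linarith
    qed
    then have b: "?b \<le> L ^ k * measure m (tent e d)" using tent_double_power[OF e(1) d(1), of k] by simp
    have "ennreal (cmod (f z) powr p) * ennreal (measure m (tent e d)) \<le> ennreal C * powr_integral m p f"
      using point_evaluation[OF hol p e(1) d(1,2)] d(3) by simp
    also have "powr_integral m p f = ennreal ?I" using fin by simp
    finally have "cmod (f z) powr p * measure m (tent e d) \<le> C * ?I"
      using C_pos by (simp add: ennreal_mult[symmetric])
    then have "cmod (f z) powr p * (L ^ k * measure m (tent e d)) \<le> L ^ k * (C * ?I)"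
      using L_pos by (simp add: mult.left_commute)
    moreover have "cmod (f z) powr p * ?b \<le> cmod (f z) powr p * (L ^ k * measure m (tent e d))"
      using b by (intro mult_left_mono) auto
    ultimately have "cmod (f z) powr p * ?b \<le> L ^ k * (C * ?I)" by linarith
    then show "cmod (f z) powr p \<le> B * ?I"
      using m_ball_pos by (simp add: B_def field_simps)
  qed
qed

lemma borel_measurable_norm_m: "(norm :: complex ^ 'n \<Rightarrow> real) \<in> borel_measurable m"
  by (intro borel_measurable_m continuous_intros)

lemma collar_sets: "sets \<mu> = sets m \<Longrightarrow> {z \<in> ball 0 1. 1 - h < norm z} \<in> sets \<mu>"
proof -
  assume s: "sets \<mu> = sets m"
  have "{z \<in> space m. 1 - h < norm z} \<in> sets m" using borel_measurable_norm_m by measurable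
  then show ?thesis using s by (simp add: space_m)
qed

text \<open>Small tents see only blocks near the sphere, where the ratio is small, and
  \<open>tent_collar_estimate\<close> passes to all tents with a fixed loss. The embedding constant
  is independent of the measure and hence applies to the restriction to the collar.\<close>

lemma collar_embedding:
  fixes p q :: real
  assumes pq: "0 < p" "p \<le> q" and sets_\<mu>: "sets \<mu> = sets m"
    and lim: "((\<lambda>a. carleson_ratio p q \<omega> \<mu> a) \<longlongrightarrow> 0) (filtercomap norm (at_left 1))" and \<epsilon>: "0 < \<epsilon>"
  shows "\<exists>h>0. h < 1 \<and> (\<forall>f\<in>bergman p \<omega>.
    (\<integral>\<^sup>+z. ennreal (cmod (f z) powr q) * indicator {z \<in> ball 0 1. 1 - h < norm z} z \<partial>\<mu>)
      \<le> ennreal (\<epsilon> * enn2real (powr_integral m p f) powr (q / p)))"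
proof -
  have [measurable_cong]: "sets \<mu> = sets m" by fact
  have \<alpha>: "1 \<le> q / p" using pq by simp
  obtain K where K: "K > 0" and emb: "\<forall>\<mu> N. sets \<mu> = sets m \<longrightarrow> 0 \<le> N \<longrightarrow>
    (\<forall>e d. norm e = 1 \<longrightarrow> 0 < d \<longrightarrow> emeasure \<mu> (tent e d) \<le> ennreal (N * measure m (tent e d) powr (q / p))) \<longrightarrow>
    (\<forall>f\<in>bergman p \<omega>. powr_integral \<mu> q f
      \<le> ennreal (K * N * enn2real (powr_integral m p f) powr (q / p)))"
    using embedding_of_ratio[OF pq] by blast
  define c where "c = (L\<^sup>2) powr (q / p) * max 1 (L ^ 12) powr (q / p)"
  have c: "0 < c" using L_pos by (simp add: c_def)
  \<comment> \<open>Chosen so that the embedding constant K times the tent constant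
    \<open>N * c\<close> of the restricted measure equals \<epsilon>.\<close>
  define N where "N = \<epsilon> / (K * c)"
  have N: "0 < N" using \<epsilon> K c by (simp add: N_def)
  obtain h0 where h0: "0 < h0" "\<And>a :: complex ^ 'n. 1 - h0 < norm a \<and> norm a < 1 \<Longrightarrow> carleson_ratio p q \<omega> \<mu> a \<le> ennreal N"
    using lim N unfolding tendsto_zero_at_unit_sphere_iff by blast
  \<comment> \<open>Tents of size d \<le> 128 h are compared with blocks at depth 2 d \<le> 256 h;
    the divisor 512 gives 2 d < h0 and d < 1/2.\<close>
  define h where "h = min h0 1 / 512"
  have h: "0 < h" "h < 1" "512 * h \<le> h0" "512 * h \<le> 1" using h0 by (auto simp: h_def)
  let ?H = "{z \<in> ball (0 :: complex ^ 'n) 1. 1 - h < norm z}"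
  note [measurable] = collar_sets[OF sets_\<mu>, of h]
  let ?\<mu> = "density \<mu> (indicator ?H)"
  have small: "emeasure \<mu> (tent e d) \<le> ennreal (N * (L\<^sup>2) powr (q / p) * measure m (tent e d) powr (q / p))"
    if ed: "norm e = 1" "0 < d" "d \<le> 128 * h" for e d
  proof (rule tent_bound_of_ratio[OF sets_\<mu> less_imp_le[OF N] pq ed(1,2) refl])
    have "d < 1 / 2" "2 * d < h0" using ed h by linarith+
    then show "carleson_ratio p q \<omega> \<mu> (if d < 1 / 2 then (1 - 2 * d) *\<^sub>R e else 0) \<le> ennreal N"
      using ed h0(2)[of "(1 - 2 * d) *\<^sub>R e"] by simp
  qed
  have tents: "emeasure ?\<mu> (tent e d) \<le> ennreal (N * c * measure m (tent e d) powr (q / p))" if ed: "norm e = 1" "0 < d" for e d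
  proof -
    have "emeasure ?\<mu> (tent e d) = emeasure \<mu> (?H \<inter> tent e d)"
    proof (rule emeasure_restricted[OF collar_sets[OF sets_\<mu>]])
      show "tent e d \<in> sets \<mu>" using sets_\<mu> by simp
    qed
    also have "?H \<inter> tent e d = tent e d \<inter> {z. 1 - h < norm z}" using tent_subset_ball[of e d] by auto
    also have "emeasure \<mu> \<dots> \<le> ennreal (N * (L\<^sup>2) powr (q / p) * (max 1 (L ^ 12)) powr (q / p) * measure m (tent e d) powr (q / p))"
      using N by (intro tent_collar_estimate[OF sets_\<mu> h(1) small _ \<alpha> ed]) auto
    finally show ?thesis by (simp add: c_def mult.assoc)
  qed
  have Nc: "K * (N * c) = \<epsilon>" using K c by (simp add: N_def)
  show ?thesis
  proof (intro exI[of _ h] conjI h ballI)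
    fix f :: "complex ^ 'n \<Rightarrow> complex" assume f: "f \<in> bergman p \<omega>"
    then have [measurable]: "f \<in> borel_measurable m" using borel_measurable_holomorphic[of f] by (simp add: bergman_iff)
    have "(\<integral>\<^sup>+z. ennreal (cmod (f z) powr q) * indicator ?H z \<partial>\<mu>) = powr_integral ?\<mu> q f"
    proof (subst nn_integral_density)
      show "indicator ?H \<in> borel_measurable \<mu>" "(\<lambda>z. ennreal (cmod (f z) powr q)) \<in> borel_measurable \<mu>" by measurable
    qed (simp only: mult.commute)
    also have "\<dots> \<le> ennreal (K * (N * c) * enn2real (powr_integral m p f) powr (q / p))"
    proof -
      have 1: "sets ?\<mu> = sets m" using sets_\<mu> by simp
      have 2: "0 \<le> N * c" using N c by simp
      have 3: "\<forall>e d. norm e = 1 \<longrightarrow> 0 < d \<longrightarrow> emeasure ?\<mu> (tent e d) \<le> ennreal (N * c * measure m (tent e d) powr (q / p))"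
        using tents by blast
      show ?thesis by (rule emb[THEN spec, THEN spec, THEN mp, OF 1, THEN mp, OF 2, THEN mp, OF 3, THEN bspec, OF f])
    qed
    finally show "(\<integral>\<^sup>+z. ennreal (cmod (f z) powr q) * indicator ?H z \<partial>\<mu>)
      \<le> ennreal (\<epsilon> * enn2real (powr_integral m p f) powr (q / p))" unfolding Nc .
  qed
qed

lemma nn_integral_split_collar:
  fixes q :: real
  assumes sets_\<mu>: "sets \<mu> = sets m" and q: "0 < q" and [measurable]: "f \<in> borel_measurable m"
    and B: "\<And>z. z \<in> cball 0 (1 - h) \<Longrightarrow> cmod (f z) \<le> B" and h: "0 < h"
  shows "powr_integral \<mu> q f \<le> ennreal (B powr q) * emeasure \<mu> (cball 0 (1 - h))
    + (\<integral>\<^sup>+z. ennreal (cmod (f z) powr q) * indicator {z \<in> ball 0 1. 1 - h < norm z} z \<partial>\<mu>)"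
proof -
  have [measurable_cong]: "sets \<mu> = sets m" by fact
  note [measurable] = collar_sets[OF sets_\<mu>, of h]
  have [measurable]: "cball 0 (1 - h) \<in> sets \<mu>"
    using h by (auto simp: sets_\<mu> sets_m sets_restrict_space_iff)
  have space_\<mu>: "space \<mu> = ball 0 1" using sets_eq_imp_space_eq[OF sets_\<mu>] by (simp add: space_m)
  have "powr_integral \<mu> q f \<le> (\<integral>\<^sup>+z. ennreal (B powr q) * indicator (cball 0 (1 - h)) z
    + ennreal (cmod (f z) powr q) * indicator {z \<in> ball 0 1. 1 - h < norm z} z \<partial>\<mu>)"
  proof (rule nn_integral_mono)
    fix z assume z: "z \<in> space \<mu>"
    show "ennreal (cmod (f z) powr q) \<le> ennreal (B powr q) * indicator (cball 0 (1 - h)) z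
      + ennreal (cmod (f z) powr q) * indicator {z \<in> ball 0 1. 1 - h < norm z} z"
    proof (cases "1 - h < norm z")
      case True
      then show ?thesis using z by (simp add: space_\<mu>)
    next
      case False
      then have "cmod (f z) powr q \<le> B powr q" using q by (intro powr_mono2 B) auto
      then show ?thesis using False by (simp add: ennreal_leI)
    qed
  qed
  also have "\<dots> = (\<integral>\<^sup>+z. ennreal (B powr q) * indicator (cball 0 (1 - h)) z \<partial>\<mu>)
    + (\<integral>\<^sup>+z. ennreal (cmod (f z) powr q) * indicator {z \<in> ball 0 1. 1 - h < norm z} z \<partial>\<mu>)"
    by (rule nn_integral_add) measurable
  also have "(\<integral>\<^sup>+z. ennreal (B powr q) * indicator (cball 0 (1 - h)) z \<partial>\<mu>) = ennreal (B powr q) * emeasure \<mu> (cball 0 (1 - h))"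
    by (rule nn_integral_cmult_indicator) measurable
  finally show ?thesis .
qed

lemma vanishing_sufficient:
  fixes p q :: real
  assumes pq: "0 < p" "p \<le> q" and sets_\<mu>: "sets \<mu> = sets m" and fc: "finite_on_compacts \<mu>"
    and lim: "((\<lambda>a. carleson_ratio p q \<omega> \<mu> a) \<longlongrightarrow> 0) (filtercomap norm (at_left 1))"
  shows "vanishing_carleson_measure p q \<omega> \<mu>"
proof -
  have q: "0 < q" and \<alpha>: "0 < q / p" using pq by simp_all
  have [measurable_cong]: "sets \<mu> = sets m" by fact
  have space_\<mu>: "space \<mu> = ball 0 1" using sets_eq_imp_space_eq[OF sets_\<mu>] by (simp add: space_m)
  let ?I = "\<lambda>f. enn2real (powr_integral m p f)"
  let ?J = "\<lambda>f. powr_integral \<mu> q f"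
  have meas: "f \<in> borel_measurable m" if "f \<in> bergman p \<omega>" for f :: "complex ^ 'n \<Rightarrow> complex"
    using that borel_measurable_holomorphic[of f] by (simp add: bergman_iff)
  have meas\<mu>: "f \<in> borel_measurable \<mu>" if "f \<in> bergman p \<omega>" for f :: "complex ^ 'n \<Rightarrow> complex"
    using meas[OF that] by measurable
  have fcb: "emeasure \<mu> (cball 0 (1 - h)) < \<infinity>" if "0 < h" for h
    using fc that unfolding finite_on_compacts_def by (auto simp: cball_subset_ball_iff)
  \<comment> \<open>Any fixed collar serves here, so the collar estimate is taken with constant 1;
    on the remaining compact core f is bounded and \<mu> is finite.\<close>
  have sub: "bergman p \<omega> \<subseteq> Lq q \<mu>"
  proof
    fix f :: "complex ^ 'n \<Rightarrow> complex" assume f: "f \<in> bergman p \<omega>"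
    obtain h where h: "0 < h" "h < 1" and emb: "(\<integral>\<^sup>+z. ennreal (cmod (f z) powr q) * indicator {z \<in> ball 0 1. 1 - h < norm z} z \<partial>\<mu>)
      \<le> ennreal (1 * ?I f powr (q / p))"
      using collar_embedding[OF pq sets_\<mu> lim zero_less_one] f by blast
    have "continuous_on (cball 0 (1 - h)) f"
      using f h holomorphic_on_ball_continuous[of f] by (auto simp: bergman_iff cball_subset_ball_iff intro: continuous_on_subset)
    then have "bounded (f ` cball 0 (1 - h))" by (intro compact_imp_bounded compact_continuous_image) auto
    then obtain B where B: "\<And>z. z \<in> cball 0 (1 - h) \<Longrightarrow> cmod (f z) \<le> B" unfolding bounded_iff by blast
    have "?J f \<le> ennreal (B powr q) * emeasure \<mu> (cball 0 (1 - h)) + ennreal (1 * ?I f powr (q / p))"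
      by (rule order_trans[OF nn_integral_split_collar[OF sets_\<mu> q meas[OF f] _ h(1)] add_left_mono[OF emb]]) (rule B)
    also have "\<dots> < \<infinity>" using fcb[OF h(1)] by (simp add: ennreal_mult_less_top)
    finally show "f \<in> Lq q \<mu>" using meas\<mu>[OF f] by (simp add: Lq_iff)
  qed
  show ?thesis
    unfolding vanishing_carleson_measure_def
  proof (intro conjI sub allI impI)
    fix f :: "nat \<Rightarrow> complex ^ 'n \<Rightarrow> complex"
    assume "(\<forall>k. f k \<in> bergman p \<omega>) \<and> (\<exists>M. \<forall>k. bergman_norm p \<omega> (f k) \<le> M)"
    then obtain M where f: "\<And>k. f k \<in> bergman p \<omega>" and M: "\<And>k. bergman_norm p \<omega> (f k) \<le> M" by blast
    have hol: "holomorphic_on_ball (f k)" for k using f[of k] by (simp add: bergman_iff)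
    define A where "A = M powr p"
    have I: "?I (f k) \<le> A" for k
    proof -
      have "?I (f k) powr (1 / p) \<le> M" using M[of k] hol by (simp add: bergman_norm_eq)
      then have "(?I (f k) powr (1 / p)) powr p \<le> M powr p" using pq by (intro powr_mono2) auto
      then show ?thesis using pq by (simp add: powr_powr A_def)
    qed
    have A: "0 \<le> A" by (simp add: A_def)
    have "\<exists>B. \<forall>k. \<forall>z\<in>cball 0 r. cmod (f k z) \<le> B" if r: "r < 1" for r
    proof -
      obtain B where B: "B \<ge> 0" "\<And>f z. f \<in> bergman p \<omega> \<Longrightarrow> z \<in> cball (0 :: complex ^ 'n) r \<Longrightarrow> cmod (f z) powr p \<le> B * ?I f"
        using local_bound[OF pq(1) r] by blast
      have "cmod (f k z) \<le> (B * A) powr (1 / p)" if z: "z \<in> cball 0 r" for k z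
      proof -
        have "cmod (f k z) powr p \<le> B * ?I (f k)" by (rule B(2)[OF f z])
        also have "\<dots> \<le> B * A" using B(1) I by (intro mult_left_mono) auto
        finally have "(cmod (f k z) powr p) powr (1 / p) \<le> (B * A) powr (1 / p)" using pq by (intro powr_mono2) auto
        then show ?thesis using pq by (simp add: powr_powr)
      qed
      then show ?thesis by blast
    qed
    from montel_ball[OF hol this] obtain s g where s: "strict_mono (s :: nat \<Rightarrow> nat)"
      and g: "\<And>r \<epsilon>. r < 1 \<Longrightarrow> 0 < \<epsilon> \<Longrightarrow> \<exists>N. \<forall>n\<ge>N. \<forall>z\<in>cball 0 r. cmod (f (s n) z - g z) < \<epsilon>" by blast
    have ptw: "(\<lambda>n. f (s n) z) \<longlonglongrightarrow> g z" if z: "z \<in> ball 0 1" for z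
    proof -
      have "\<exists>N. \<forall>n\<ge>N. cmod (f (s n) z - g z) < \<epsilon>" if e: "0 < \<epsilon>" for \<epsilon>
      proof -
        have zc: "z \<in> cball 0 (norm z)" by simp
        have "norm z < 1" using z by simp
        from g[OF this e] obtain N where "\<forall>n\<ge>N. \<forall>w\<in>cball 0 (norm z). cmod (f (s n) w - g w) < \<epsilon>" by blast
        then show ?thesis using zc by blast
      qed
      then show ?thesis unfolding LIMSEQ_iff by blast
    qed
    have [measurable]: "f k \<in> borel_measurable \<mu>" for k using meas\<mu>[OF f] .
    have gm [measurable]: "g \<in> borel_measurable \<mu>"
      by (rule borel_measurable_LIMSEQ_metric[of "\<lambda>n. f (s n)"]) (auto intro: ptw simp: space_\<mu>)
    \<comment> \<open>Differences of members of the sequence are estimated first, because the collar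
      bound applies to elements of the Bergman space, whereas g comes only as a locally uniform
      limit.\<close>
    have cauchy: "\<exists>N. \<forall>n\<ge>N. \<forall>k\<ge>N. ?J (\<lambda>z. f (s n) z - f (s k) z) \<le> ennreal \<epsilon>" if \<epsilon>: "0 < \<epsilon>" for \<epsilon>
    proof -
      \<comment> \<open>Bounds the integral of |u|^p over all differences u, raised to q/p; the
        added 1 makes it a positive denominator.\<close>
      define A2 where "A2 = (2 powr p * (A + A)) powr (q / p) + 1"
      have A2: "0 < A2" by (simp add: A2_def add_nonneg_pos)
      define \<delta> where "\<delta> = \<epsilon> / (2 * A2)"
      have \<delta>: "0 < \<delta>" using \<epsilon> A2 by (simp add: \<delta>_def)
      obtain h where h: "0 < h" "h < 1" and emb: "\<And>f. f \<in> bergman p \<omega> \<Longrightarrow>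
        (\<integral>\<^sup>+z. ennreal (cmod (f z) powr q) * indicator {z \<in> ball 0 1. 1 - h < norm z} z \<partial>\<mu>) \<le> ennreal (\<delta> * ?I f powr (q / p))"
        using collar_embedding[OF pq sets_\<mu> lim \<delta>] by blast
      define V where "V = measure \<mu> (cball 0 (1 - h)) + 1"
      have V: "0 < V" by (simp add: V_def add_nonneg_pos)
      \<comment> \<open>With this \<eta> the core contributes at most \<eta>^q V = \<epsilon>/2,
        matching the \<epsilon>/2 left to the collar.\<close>
      define \<eta> where "\<eta> = (\<epsilon> / (2 * V)) powr (1 / q)"
      have \<eta>: "0 < \<eta>" using \<epsilon> V by (simp add: \<eta>_def)
      have \<eta>q: "\<eta> powr q = \<epsilon> / (2 * V)" using \<epsilon> V q by (simp add: \<eta>_def powr_powr)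
      have "1 - h < 1" "0 < \<eta> / 2" using h \<eta> by auto
      from g[OF this] obtain N where N: "\<And>n z. n \<ge> N \<Longrightarrow> z \<in> cball 0 (1 - h) \<Longrightarrow> cmod (f (s n) z - g z) < \<eta> / 2"
        by blast
      show ?thesis
      proof (intro exI[of _ N] allI impI)
        fix n k assume nk: "N \<le> n" "N \<le> k"
        let ?u = "\<lambda>z. f (s n) z - f (s k) z"
        have mu: "f (s n) \<in> borel_measurable m" "f (s k) \<in> borel_measurable m" using meas f by auto
        have "powr_integral m p ?u \<le> ennreal (2 powr p) * (ennreal A + ennreal A)"
        proof (rule order_trans[OF nn_integral_diff_powr_le[OF pq(1) mu]], rule mult_left_mono, rule add_mono)
          have "powr_integral m p (f j) \<le> ennreal A" for j
          proof -
            have "powr_integral m p (f j) = ennreal (?I (f j))" using f[of j] by (simp add: bergman_iff)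
            also have "\<dots> \<le> ennreal A" by (rule ennreal_leI[OF I])
            finally show ?thesis .
          qed
          then show "powr_integral m p (f (s n)) \<le> ennreal A"
            "powr_integral m p (f (s k)) \<le> ennreal A" by blast+
        qed simp
        also have "\<dots> = ennreal (2 powr p * (A + A))"
          using A by (simp only: ennreal_plus[symmetric]) (rule ennreal_mult[symmetric], auto)
        finally have Iu: "powr_integral m p ?u \<le> ennreal (2 powr p * (A + A))" .
        have ub: "?u \<in> bergman p \<omega>"
          using Iu hol by (auto simp: bergman_iff intro!: holomorphic_on_ball_diff intro: le_less_trans)
        have "?I ?u \<le> 2 powr p * (A + A)" using Iu A by (intro enn2real_leI) auto
        then have "\<delta> * ?I ?u powr (q / p) \<le> \<delta> * (2 powr p * (A + A)) powr (q / p)"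
          using \<delta> \<alpha> by (intro mult_left_mono powr_mono2) auto
        also have "\<dots> \<le> \<delta> * A2" using \<delta> by (simp add: A2_def)
        also have "\<dots> = \<epsilon> / 2" using A2 by (simp add: \<delta>_def)
        finally have outer: "(\<integral>\<^sup>+z. ennreal (cmod (?u z) powr q) * indicator {z \<in> ball 0 1. 1 - h < norm z} z \<partial>\<mu>) \<le> ennreal (\<epsilon> / 2)"
          using emb[OF ub] by (meson ennreal_leI order_trans)
        have ucb: "cmod (?u z) \<le> \<eta>" if z: "z \<in> cball 0 (1 - h)" for z
          using N[OF nk(1) z] N[OF nk(2) z] norm_triangle_ineq4[of "f (s n) z - g z" "f (s k) z - g z"] by simp
        have "ennreal (\<eta> powr q) * emeasure \<mu> (cball 0 (1 - h)) = ennreal (\<epsilon> / (2 * V) * measure \<mu> (cball 0 (1 - h)))"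
        proof -
          have fm: "emeasure \<mu> (cball 0 (1 - h)) = ennreal (measure \<mu> (cball 0 (1 - h)))"
            by (rule emeasure_eq_ennreal_measure) (use fcb[OF h(1)] in auto)
          show ?thesis unfolding \<eta>q fm by (rule ennreal_mult[symmetric]) (use \<epsilon> V in auto)
        qed
        also have "\<dots> \<le> ennreal (\<epsilon> / (2 * V) * V)"
          using \<epsilon> V by (intro ennreal_leI mult_left_mono) (auto simp: V_def)
        also have "\<epsilon> / (2 * V) * V = \<epsilon> / 2" using V by simp
        finally have inner: "ennreal (\<eta> powr q) * emeasure \<mu> (cball 0 (1 - h)) \<le> ennreal (\<epsilon> / 2)" .
        have "?J ?u \<le> ennreal (\<epsilon> / 2) + ennreal (\<epsilon> / 2)"
          by (rule order_trans[OF nn_integral_split_collar[OF sets_\<mu> q meas[OF ub] _ h(1)] add_mono[OF inner outer]]) (rule ucb)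
        also have "\<dots> = ennreal \<epsilon>" using \<epsilon> by (simp add: ennreal_plus[symmetric] del: ennreal_plus)
        finally show "?J ?u \<le> ennreal \<epsilon>" .
      qed
    qed
    have conv: "\<exists>N. \<forall>n\<ge>N. ?J (\<lambda>z. f (s n) z - g z) \<le> ennreal \<epsilon>" if \<epsilon>: "0 < \<epsilon>" for \<epsilon>
    proof -
      obtain N where N: "\<And>n k. n \<ge> N \<Longrightarrow> k \<ge> N \<Longrightarrow> ?J (\<lambda>z. f (s n) z - f (s k) z) \<le> ennreal \<epsilon>"
        using cauchy[OF \<epsilon>] by blast
      have "?J (\<lambda>z. f (s n) z - g z) \<le> ennreal \<epsilon>" if n: "N \<le> n" for n
      proof -
        \<comment> \<open>Fatou in k replaces \<open>f (s k)\<close> by its pointwise limit g and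
          turns the Cauchy bound into convergence.\<close>
        have "?J (\<lambda>z. f (s n) z - g z) = (\<integral>\<^sup>+z. liminf (\<lambda>k. ennreal (cmod (f (s n) z - f (s k) z) powr q)) \<partial>\<mu>)"
        proof (rule nn_integral_cong)
          fix z assume z: "z \<in> space \<mu>"
          have "(\<lambda>k. cmod (f (s n) z - f (s k) z) powr q) \<longlonglongrightarrow> cmod (f (s n) z - g z) powr q"
            using z q by (intro tendsto_powr' tendsto_intros ptw) (auto simp: space_\<mu>)
          then have "(\<lambda>k. ennreal (cmod (f (s n) z - f (s k) z) powr q)) \<longlonglongrightarrow> ennreal (cmod (f (s n) z - g z) powr q)"
            by (rule tendsto_ennrealI)
          then show "ennreal (cmod (f (s n) z - g z) powr q) = liminf (\<lambda>k. ennreal (cmod (f (s n) z - f (s k) z) powr q))"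
            by (intro lim_imp_Liminf[symmetric]) auto
        qed
        also have "\<dots> \<le> liminf (\<lambda>k. ?J (\<lambda>z. f (s n) z - f (s k) z))"
          by (rule nn_integral_liminf) measurable
        also have "\<dots> \<le> ennreal \<epsilon>"
        proof (rule Liminf_le)
          show "\<forall>\<^sub>F k in sequentially. ?J (\<lambda>z. f (s n) z - f (s k) z) \<le> ennreal \<epsilon>"
            using N[OF n] eventually_sequentially by auto
        qed simp
        finally show ?thesis .
      qed
      then show ?thesis by blast
    qed
    have gL: "g \<in> Lq q \<mu>"
    proof -
      obtain N where N: "?J (\<lambda>z. f (s N) z - g z) \<le> ennreal 1" using conv[of 1] by auto
      have "f (s N) \<in> Lq q \<mu>" using sub f by blast
      then have fN: "?J (f (s N)) < \<infinity>" by (simp add: Lq_iff)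
      have "?J g = ?J (\<lambda>z. f (s N) z - (f (s N) z - g z))" by simp
      also have "\<dots> \<le> ennreal (2 powr q) * (?J (f (s N)) + ?J (\<lambda>z. f (s N) z - g z))"
        by (rule nn_integral_diff_powr_le[OF q]) measurable
      also have "\<dots> < \<infinity>" using N fN by (simp add: ennreal_mult_less_top) (meson ennreal_less_top le_less_trans ennreal_one_less_top)
      finally show ?thesis by (simp add: Lq_iff)
    qed
    have "(\<lambda>k. Lq_norm q \<mu> (\<lambda>z. f (s k) z - g z)) \<longlonglongrightarrow> 0"
    proof (rule LIMSEQ_I)
      fix r :: real assume r: "0 < r"
      then obtain N where N: "\<And>n. n \<ge> N \<Longrightarrow> ?J (\<lambda>z. f (s n) z - g z) \<le> ennreal ((r / 2) powr q)"
        using conv[of "(r / 2) powr q"] by auto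
      show "\<exists>N. \<forall>n\<ge>N. norm (Lq_norm q \<mu> (\<lambda>z. f (s n) z - g z) - 0) < r"
      proof (intro exI[of _ N] allI impI)
        fix n assume "N \<le> n"
        then have "enn2real (?J (\<lambda>z. f (s n) z - g z)) \<le> (r / 2) powr q" using N by (intro enn2real_leI) auto
        then have "enn2real (?J (\<lambda>z. f (s n) z - g z)) powr (1 / q) \<le> ((r / 2) powr q) powr (1 / q)"
          using q by (intro powr_mono2) auto
        then have "Lq_norm q \<mu> (\<lambda>z. f (s n) z - g z) \<le> r / 2" using q r by (simp add: Lq_norm_eq powr_powr)
        moreover have "0 \<le> Lq_norm q \<mu> (\<lambda>z. f (s n) z - g z)" by (simp add: Lq_norm_def)
        ultimately show "norm (Lq_norm q \<mu> (\<lambda>z. f (s n) z - g z) - 0) < r" using r by simp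
      qed
    qed
    then show "\<exists>g\<in>Lq q \<mu>. \<exists>r :: nat \<Rightarrow> nat. strict_mono r \<and> (\<lambda>k. Lq_norm q \<mu> (\<lambda>z. f (r k) z - g z)) \<longlonglongrightarrow> 0"
      using gL s by blast
  qed
qed

end

section \<open>Necessity of the vanishing condition\<close>

context weighted_ball
begin

text \<open>Membership in L^q matters: for an infinite integral \<open>Lq_norm\<close> would be 0,
  since the integral of a function that is not integrable is 0 by convention.\<close>

lemma Lq_norm_tendsto_zeroD:
  fixes q :: real
  assumes q: "0 < q" and fin: "\<And>k. f k \<in> Lq q \<mu>" and lim: "(\<lambda>k. Lq_norm q \<mu> (f k)) \<longlonglongrightarrow> 0"
  shows "(\<lambda>k. powr_integral \<mu> q (f k)) \<longlonglongrightarrow> 0"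
proof -
  let ?J = "\<lambda>k. powr_integral \<mu> q (f k)"
  have J: "ennreal (Lq_norm q \<mu> (f k) powr q) = ?J k" for k
  proof -
    have "f k \<in> borel_measurable \<mu>" "?J k < \<infinity>" using fin[of k] by (auto simp: Lq_iff)
    then show ?thesis using q by (simp add: Lq_norm_eq powr_powr)
  qed
  have "(\<lambda>k. Lq_norm q \<mu> (f k) powr q) \<longlonglongrightarrow> 0 powr q"
    using q by (intro tendsto_powr' lim tendsto_const) (auto simp: Lq_norm_def)
  then have "(\<lambda>k. ennreal (Lq_norm q \<mu> (f k) powr q)) \<longlonglongrightarrow> ennreal (0 powr q)"
    by (rule tendsto_ennrealI)
  then show ?thesis unfolding J by simp
qed

lemma Lq_diff:
  fixes q :: real
  assumes q: "0 < q" and f: "f \<in> Lq q \<mu>" and g: "g \<in> Lq q \<mu>"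
  shows "(\<lambda>z. f z - g z) \<in> Lq q \<mu>"
proof -
  have [measurable]: "f \<in> borel_measurable \<mu>" "g \<in> borel_measurable \<mu>"
    and fin: "powr_integral \<mu> q f < \<infinity>" "powr_integral \<mu> q g < \<infinity>"
    using f g by (auto simp: Lq_iff)
  have "powr_integral \<mu> q (\<lambda>z. f z - g z)
    \<le> ennreal (2 powr q) * (powr_integral \<mu> q f + powr_integral \<mu> q g)"
    by (rule nn_integral_diff_powr_le[OF q]) measurable
  also have "\<dots> < \<infinity>" using fin by (simp add: ennreal_mult_less_top)
  finally show ?thesis by (simp add: Lq_iff)
qed

text \<open>Take the first j with 2^j d \<ge> 2, so that 2^j d < 4 and j doublings reach the ball.
  The condition on b gives (2 L)^j \<le> 2^(j b), which is of order d^(-b); the spare factor 2^j, of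
  order 1/d, yields the extra d. This d makes the normalised kernels tend to 0 pointwise.\<close>

lemma tent_measure_lower:
  fixes b :: real
  assumes b: "0 \<le> b" "2 * L \<le> 2 powr b" and e: "norm e = 1" "0 < d" "d \<le> 1"
  shows "d powr b \<le> (4 powr b / measure m (ball 0 1)) * d * measure m (tent e d)"
proof -
  let ?M = "measure m (ball 0 1)"
  define j where "j = (LEAST j. 2 \<le> 2 ^ j * d)"
  obtain k where "2 / d < 2 ^ k" using real_arch_pow[of 2 "2 / d"] by auto
  then have k: "2 \<le> 2 ^ k * d" using e by (simp add: field_simps)
  have j: "2 \<le> 2 ^ j * d" unfolding j_def by (rule LeastI[where k=k]) (rule k)
  have "j \<noteq> 0" using j e by (cases j) auto
  then obtain i where i: "j = Suc i" by (cases j) auto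
  have "\<not> 2 \<le> 2 ^ i * d" using not_less_Least[of i "\<lambda>j. 2 \<le> 2 ^ j * d"] i by (simp add: j_def)
  moreover have "2 ^ j * d = 2 * (2 ^ i * d)" by (simp add: i)
  ultimately have j4: "2 ^ j * d < 4" by linarith
  have "tent e (2 ^ j * d) = ball 0 1" by (rule tent_eq_ball[OF e(1) j])
  then have M: "?M \<le> L ^ j * measure m (tent e d)" using tent_double_power[OF e(1,2), of j] by simp
  have "2 ^ j * L ^ j \<le> (2 powr b) ^ j" using b L_pos by (subst power_mult_distrib[symmetric]) (intro power_mono, auto)
  also have "\<dots> = (2 ^ j) powr b" by (simp add: powr_powr powr_realpow[symmetric] mult.commute)
  finally have jL: "2 ^ j * L ^ j \<le> (2 ^ j) powr b" .
  have "(2 ^ j) powr b * d powr b \<le> 4 powr b"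
    using j4 b e by (subst powr_mult[symmetric]) (auto intro: powr_mono2)
  then have "2 ^ j * L ^ j * d powr b \<le> 4 powr b"
    using mult_right_mono[OF jL, of "d powr b"] by simp
  then have A: "2 ^ j * L ^ j * d powr b * (d * measure m (tent e d)) \<le> 4 powr b * (d * measure m (tent e d))"
    using e by (intro mult_right_mono) auto
  have "?M * d powr b \<le> (2 ^ j * d) * (L ^ j * measure m (tent e d)) * d powr b"
  proof (intro mult_right_mono)
    have "1 * ?M \<le> (2 ^ j * d) * (L ^ j * measure m (tent e d))"
      using j M L_pos by (intro mult_mono) auto
    then show "?M \<le> (2 ^ j * d) * (L ^ j * measure m (tent e d))" by simp
  qed simp
  also have "\<dots> = 2 ^ j * L ^ j * d powr b * (d * measure m (tent e d))" by (simp only: mult_ac)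
  also note A
  finally show ?thesis using m_ball_pos by (simp add: field_simps)
qed

lemma vanishing_necessary:
  fixes p q :: real
  assumes pq: "0 < p" "p \<le> q" and sets_\<mu>: "sets \<mu> = sets m" and van: "vanishing_carleson_measure p q \<omega> \<mu>"
  shows "((\<lambda>a. carleson_ratio p q \<omega> \<mu> a) \<longlongrightarrow> 0) (filtercomap norm (at_left 1))"
proof (rule ccontr)
  assume "\<not> ?thesis"
  then obtain \<epsilon> where \<epsilon>: "0 < \<epsilon>" and bad: "\<And>h. 0 < h \<Longrightarrow> \<exists>a :: complex ^ 'n. 1 - h < norm a \<and> norm a < 1 \<and> \<not> carleson_ratio p q \<omega> \<mu> a \<le> ennreal \<epsilon>"
    unfolding tendsto_zero_at_unit_sphere_iff by blast
  have q: "0 < q" and \<alpha>: "0 \<le> q / p" using pq by simp_all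
  have [measurable_cong]: "sets \<mu> = sets m" by fact
  have space_\<mu>: "space \<mu> = ball 0 1" using sets_eq_imp_space_eq[OF sets_\<mu>] by (simp add: space_m)
  obtain M :: nat and K :: real where K: "0 < K" and M: "2 * L \<le> 2 powr (M * p)"
    and berg: "\<And>(e :: complex ^ 'n) d. norm e = 1 \<Longrightarrow> 0 < d \<Longrightarrow> d \<le> 1 \<Longrightarrow> (\<lambda>w. test_fun e d w ^ M) \<in> bergman p \<omega>"
    and int: "\<And>(e :: complex ^ 'n) d. norm e = 1 \<Longrightarrow> 0 < d \<Longrightarrow> d \<le> 1 \<Longrightarrow>
       powr_integral m p (\<lambda>w. test_fun e d w ^ M) \<le> ennreal (K * measure m (tent e d))"
    and block: "\<And>\<mu> a. sets \<mu> = sets m \<Longrightarrow> a \<in> ball 0 1 \<Longrightarrow> \<exists>e. norm e = 1 \<and>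
       (measure m (tent e (1 - norm a)) \<le> K * measure m (carleson_block a) \<and>
        emeasure \<mu> (carleson_block a) \<le> ennreal K * powr_integral \<mu> q (\<lambda>w. test_fun e (1 - norm a) w ^ M))"
    by (rule test_functions[OF pq], rule that)
  have "\<exists>a :: complex ^ 'n. 1 - inverse (real (Suc n)) < norm a \<and> norm a < 1 \<and> \<not> carleson_ratio p q \<omega> \<mu> a \<le> ennreal \<epsilon>" for n
    by (rule bad) simp
  then obtain a :: "nat \<Rightarrow> complex ^ 'n" where a: "\<And>n. 1 - inverse (real (Suc n)) < norm (a n)" "\<And>n. norm (a n) < 1"
    "\<And>n. \<not> carleson_ratio p q \<omega> \<mu> (a n) \<le> ennreal \<epsilon>" by metis
  define d where "d n = 1 - norm (a n)" for n
  have d: "0 < d n" "d n \<le> 1" "d n < inverse (real (Suc n))" for n using a[of n] by (auto simp: d_def)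
  have aB: "a n \<in> ball 0 1" for n using a(2) by simp
  have "\<exists>e. norm e = 1 \<and> measure m (tent e (d n)) \<le> K * measure m (carleson_block (a n)) \<and>
     emeasure \<mu> (carleson_block (a n)) \<le> ennreal K * powr_integral \<mu> q (\<lambda>w. test_fun e (d n) w ^ M)" for n
    unfolding d_def using block[OF sets_\<mu> aB] by blast
  then obtain e where e: "\<And>n. norm (e n) = 1" "\<And>n. measure m (tent (e n) (d n)) \<le> K * measure m (carleson_block (a n))"
    "\<And>n. emeasure \<mu> (carleson_block (a n)) \<le> ennreal K * powr_integral \<mu> q (\<lambda>w. test_fun (e n) (d n) w ^ M)"
    by metis
  define t where "t n = measure m (tent (e n) (d n))" for n
  have t: "0 < t n" for n unfolding t_def by (rule tent_measure_pos[OF e(1) d(1)])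
  \<comment> \<open>Scales the p-integral of the kernel power to at most K, uniformly in n.\<close>
  define c where "c n = t n powr (- 1 / p)" for n
  have c: "0 < c n" "c n powr p = 1 / t n" "c n powr q = 1 / t n powr (q / p)" for n
  proof -
    have "- 1 / p * p = - 1" "- 1 / p * q = - (q / p)" using pq by simp_all
    then show "0 < c n" "c n powr p = 1 / t n" "c n powr q = 1 / t n powr (q / p)"
      using t[of n] unfolding c_def powr_powr by (simp_all add: powr_minus_divide)
  qed
  define F where "F n = (\<lambda>w. of_real (c n) * test_fun (e n) (d n) w ^ M)" for n
  have thol: "holomorphic_on_ball (\<lambda>w. test_fun (e n) (d n) w ^ M)" for n
    using berg[OF e(1) d(1,2)] by (simp add: bergman_iff)
  have Fhol: "holomorphic_on_ball (F n)" for n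
    unfolding F_def by (intro holomorphic_on_ball_mult holomorphic_on_ball_const thol)
  note [measurable] = borel_measurable_holomorphic[OF thol] borel_measurable_holomorphic[OF Fhol]
  have FI: "powr_integral m p (F n) \<le> ennreal K" for n
  proof -
    have "powr_integral m p (F n) = ennreal (c n powr p) * powr_integral m p (\<lambda>w. test_fun (e n) (d n) w ^ M)"
      unfolding F_def using c(1)[of n] by (intro nn_integral_powr_cmult) auto
    also have "\<dots> \<le> ennreal (1 / t n) * ennreal (K * t n)"
      unfolding c(2) t_def by (intro mult_left_mono int e(1) d(1,2)) simp
    also have "\<dots> = ennreal K" using t[of n] K by (simp add: ennreal_mult'[symmetric])
    finally show ?thesis .
  qed
  have Fb: "F n \<in> bergman p \<omega>" for n using FI[of n] Fhol by (auto simp: bergman_iff intro: le_less_trans)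
  have "bergman_norm p \<omega> (F n) \<le> K powr (1 / p)" for n
  proof -
    have "enn2real (powr_integral m p (F n)) \<le> K" using FI[of n] K by (intro enn2real_leI) auto
    then show ?thesis using pq by (simp add: bergman_norm_eq[OF Fhol] powr_mono2)
  qed
  then obtain g r where g: "g \<in> Lq q \<mu>" and r: "strict_mono (r :: nat \<Rightarrow> nat)"
    and conv: "(\<lambda>k. Lq_norm q \<mu> (\<lambda>z. F (r k) z - g z)) \<longlonglongrightarrow> 0"
    using van Fb unfolding vanishing_carleson_measure_def by blast
  have FL: "F n \<in> Lq q \<mu>" for n using van Fb unfolding vanishing_carleson_measure_def by blast
  have [measurable]: "g \<in> borel_measurable \<mu>" using g by (simp add: Lq_iff)
  have J: "(\<lambda>k. powr_integral \<mu> q (\<lambda>z. F (r k) z - g z)) \<longlonglongrightarrow> 0"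
    by (rule Lq_norm_tendsto_zeroD[OF q Lq_diff[OF q FL g] conv])
  have F0: "(\<lambda>n. F n z) \<longlonglongrightarrow> 0" if z: "z \<in> ball 0 1" for z
  proof -
    have z1: "norm z < 1" using z by simp
    \<comment> \<open>The denominator of the kernel is at least 1 - |z|, and
      \<open>tent_measure_lower\<close> compares its numerator with the measure of the tent;
      together they give |F n z|^p \<le> B d_n with B independent of n.\<close>
    define B where "B = (1 / (1 - norm z)) powr (M * p) * (4 powr (M * p) / measure m (ball 0 1))"
    have bound: "cmod (F n z) \<le> (B * inverse (real (Suc n))) powr (1 / p)" for n
    proof -
      have "1 - norm z \<le> cmod (1 - hinner z ((1 - d n) *\<^sub>R e n))"
      proof -
        have "cmod (hinner z ((1 - d n) *\<^sub>R e n)) \<le> norm z * (1 - d n)"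
          using hinner_Cauchy_Schwarz[of z "(1 - d n) *\<^sub>R e n"] d(2)[of n] e(1)[of n] by simp
        also have "\<dots> \<le> norm z * 1" using d(1)[of n] by (intro mult_left_mono) auto
        finally show ?thesis using norm_triangle_ineq2[of 1 "hinner z ((1 - d n) *\<^sub>R e n)"] by simp
      qed
      then have "cmod (test_fun (e n) (d n) z) \<le> d n / (1 - norm z)"
        unfolding cmod_test_fun[OF d(1)] using d(1)[of n] z1 by (intro frac_le) auto
      then have "cmod (test_fun (e n) (d n) z) powr (M * p) \<le> (1 / (1 - norm z) * d n) powr (M * p)"
        using pq by (intro powr_mono2) auto
      also have "\<dots> = (1 / (1 - norm z)) powr (M * p) * d n powr (M * p)" by (rule powr_mult)
      also have "\<dots> \<le> (1 / (1 - norm z)) powr (M * p) * ((4 powr (M * p) / measure m (ball 0 1)) * d n * t n)"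
        unfolding t_def using pq M by (intro mult_left_mono tent_measure_lower e(1) d(1,2)) auto
      also have "\<dots> = B * d n * t n" by (simp add: B_def)
      finally have *: "cmod (test_fun (e n) (d n) z) powr (M * p) \<le> B * d n * t n" .
      have "cmod (F n z) powr p = (1 / t n) * cmod (test_fun (e n) (d n) z) powr (M * p)"
        using c[of n] cmod_test_fun_power_powr[OF e(1) d(1,2) z1, where M=M and s=p]
        by (simp add: F_def norm_mult powr_mult)
      also have "\<dots> \<le> (1 / t n) * (B * d n * t n)" using * t[of n] by (intro mult_left_mono) auto
      also have "\<dots> = B * d n" using t[of n] by simp
      also have "\<dots> \<le> B * inverse (real (Suc n))" using d(3)[of n] by (intro mult_left_mono) (auto simp: B_def)
      finally have "(cmod (F n z) powr p) powr (1 / p) \<le> (B * inverse (real (Suc n))) powr (1 / p)"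
        using pq by (intro powr_mono2) auto
      then show ?thesis using pq by (simp add: powr_powr)
    qed
    have "(\<lambda>n. (B * inverse (real (Suc n))) powr (1 / p)) \<longlonglongrightarrow> (B * 0) powr (1 / p)"
      using pq by (intro tendsto_powr' tendsto_mult tendsto_const LIMSEQ_inverse_real_of_nat) (auto simp: B_def)
    then have lim0: "(\<lambda>n. (B * inverse (real (Suc n))) powr (1 / p)) \<longlonglongrightarrow> 0" by simp
    have "(\<lambda>n. cmod (F n z)) \<longlonglongrightarrow> 0"
      by (rule tendsto_sandwich[OF _ _ tendsto_const lim0]) (auto intro: always_eventually bound simp del: of_nat_Suc)
    then show ?thesis by (rule tendsto_norm_zero_cancel)
  qed
  \<comment> \<open>Fatou along the subsequence: \<open>F (r k)\<close> tends to 0 pointwise, so the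
    integral of |g|^q is at most the limit 0 of the integrals of |F (r k) - g|^q.\<close>
  have "powr_integral \<mu> q g = (\<integral>\<^sup>+z. liminf (\<lambda>k. ennreal (cmod (F (r k) z - g z) powr q)) \<partial>\<mu>)"
  proof (rule nn_integral_cong)
    fix z assume z: "z \<in> space \<mu>"
    have "(\<lambda>k. F (r k) z) \<longlonglongrightarrow> 0"
      using LIMSEQ_subseq_LIMSEQ[OF F0[of z] r] z by (simp add: space_\<mu> o_def)
    then have "(\<lambda>k. cmod (F (r k) z - g z) powr q) \<longlonglongrightarrow> cmod (0 - g z) powr q"
      using q by (intro tendsto_powr' tendsto_intros) auto
    then have "(\<lambda>k. ennreal (cmod (F (r k) z - g z) powr q)) \<longlonglongrightarrow> ennreal (cmod (0 - g z) powr q)"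
      by (rule tendsto_ennrealI)
    from lim_imp_Liminf[OF _ this]
    show "ennreal (cmod (g z) powr q) = liminf (\<lambda>k. ennreal (cmod (F (r k) z - g z) powr q))" by simp
  qed
  also have "\<dots> \<le> liminf (\<lambda>k. powr_integral \<mu> q (\<lambda>z. F (r k) z - g z))"
    by (rule nn_integral_liminf) measurable
  also have "\<dots> = 0" using lim_imp_Liminf[OF _ J] by simp
  finally have "powr_integral \<mu> q g = 0" by simp
  then have "AE z in \<mu>. ennreal (cmod (g z) powr q) = 0"
    by (subst (asm) nn_integral_0_iff_AE) auto
  then have g0: "AE z in \<mu>. g z = 0" by eventually_elim (use q in simp)
  have JF: "powr_integral \<mu> q (\<lambda>z. F (r k) z - g z) = powr_integral \<mu> q (F (r k))" for k
    by (rule nn_integral_cong_AE, use g0 in eventually_elim) simp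
  \<comment> \<open>Chosen so that the chain from the block to the kernel integral, with losses K
    and K^(q/p), ends at \<epsilon> and contradicts the choice of the points a.\<close>
  define \<delta> where "\<delta> = \<epsilon> / (K * K powr (q / p))"
  have \<delta>: "0 < \<delta>" using \<epsilon> K by (simp add: \<delta>_def)
  have "eventually (\<lambda>k. powr_integral \<mu> q (F (r k)) < ennreal \<delta>) sequentially"
    using order_tendstoD(2)[OF J, of "ennreal \<delta>"] \<delta> unfolding JF by simp
  then obtain k where k: "powr_integral \<mu> q (F (r k)) \<le> ennreal \<delta>"
    by (meson eventually_sequentially less_imp_le order_refl)
  let ?n = "r k"
  let ?X = "powr_integral \<mu> q (\<lambda>w. test_fun (e ?n) (d ?n) w ^ M)"
  have "powr_integral \<mu> q (\<lambda>z. F ?n z) = ennreal (c ?n powr q) * ?X"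
    unfolding F_def using c(1)[of ?n] by (intro nn_integral_powr_cmult) auto
  then have X: "ennreal (1 / t ?n powr (q / p)) * ?X \<le> ennreal \<delta>" using k c(3)[of ?n] by simp
  have "?X = ennreal (t ?n powr (q / p) * (1 / t ?n powr (q / p))) * ?X" using t[of ?n] by simp
  also have "\<dots> = ennreal (t ?n powr (q / p)) * (ennreal (1 / t ?n powr (q / p)) * ?X)"
    by (subst ennreal_mult) (auto simp: mult.assoc)
  also have "\<dots> \<le> ennreal (t ?n powr (q / p)) * ennreal \<delta>" by (rule mult_left_mono[OF X]) simp
  also have "\<dots> \<le> ennreal ((K * measure m (carleson_block (a ?n))) powr (q / p)) * ennreal \<delta>"
    using e(2)[of ?n] t[of ?n] \<alpha> by (intro mult_right_mono ennreal_leI powr_mono2) (auto simp: t_def)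
  finally have X2: "?X \<le> ennreal ((K * measure m (carleson_block (a ?n))) powr (q / p)) * ennreal \<delta>" .
  have "emeasure \<mu> (carleson_block (a ?n)) \<le> ennreal K * ?X" by (rule e(3))
  also have "\<dots> \<le> ennreal K * (ennreal ((K * measure m (carleson_block (a ?n))) powr (q / p)) * ennreal \<delta>)"
    by (rule mult_left_mono[OF X2]) simp
  also have "\<dots> = ennreal (K * ((K * measure m (carleson_block (a ?n))) powr (q / p) * \<delta>))"
    using K \<delta> by (simp add: ennreal_mult)
  also have "K * ((K * measure m (carleson_block (a ?n))) powr (q / p) * \<delta>)
    = (K * K powr (q / p) * \<delta>) * measure m (carleson_block (a ?n)) powr (q / p)"
    by (simp add: powr_mult)
  also have "K * K powr (q / p) * \<delta> = \<epsilon>" using K by (simp add: \<delta>_def)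
  finally have "carleson_ratio p q \<omega> \<mu> (a ?n) \<le> ennreal \<epsilon>"
    using \<epsilon> by (subst carleson_ratio_le_iff[OF aB]) auto
  then show False using a(3) by blast
qed

end

theorem theorem1:
  fixes p q :: real and \<omega> :: "real \<Rightarrow> real"
  assumes "0 < p" and "p \<le> q" and "doubling_weight TYPE('n::finite) \<omega>"
  shows
    "(\<forall>\<mu> :: (complex ^ 'n) measure. borel_measure_on_ball \<mu> \<longrightarrow>
        (carleson_measure p q \<omega> \<mu> \<longleftrightarrow> (SUP a\<in>ball 0 1. carleson_ratio p q \<omega> \<mu> a) < \<infinity>)) \<and>
     (\<exists>C>0. \<forall>\<mu> :: (complex ^ 'n) measure. borel_measure_on_ball \<mu> \<and> carleson_measure p q \<omega> \<mu> \<longrightarrow>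
        ennreal (inverse C * Id_norm p q \<omega> \<mu> powr q) \<le> (SUP a\<in>ball 0 1. carleson_ratio p q \<omega> \<mu> a) \<and>
        (SUP a\<in>ball 0 1. carleson_ratio p q \<omega> \<mu> a) \<le> ennreal (C * Id_norm p q \<omega> \<mu> powr q)) \<and>
     (\<forall>\<mu> :: (complex ^ 'n) measure. borel_measure_on_ball \<mu> \<and> finite_on_compacts \<mu> \<longrightarrow>
        (vanishing_carleson_measure p q \<omega> \<mu> \<longleftrightarrow>
          ((\<lambda>a. carleson_ratio p q \<omega> \<mu> a) \<longlongrightarrow> 0) (filtercomap norm (at_left 1))))"
proof -
  obtain m :: "(complex ^ 'n) measure" and L C where "weighted_ball m L C \<omega>"
    using doubling_weight_weighted_ball[OF assms(3)] by blast
  then interpret weighted_ball m L C \<omega> .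
  have sets: "borel_measure_on_ball \<mu> \<longleftrightarrow> sets \<mu> = sets m" for \<mu> :: "(complex ^ 'n) measure"
    by (simp add: borel_measure_on_ball_def sets_m)
  from carleson_characterization[OF assms(1,2)] show ?thesis
    using vanishing_sufficient[OF assms(1,2)] vanishing_necessary[OF assms(1,2)] unfolding sets by blast
qed

end
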